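(* Let $n$ be an odd positive integer and put $\omega=\exp(2\pi i/n)$. The following is a complete list of the irreducible complex representations of the quantum double $D(D_n)$, up to isomorphism and without repetition (each representation is specified by the matrices representing $\sigma$, $\tau$ and all $g^*$, $g\in D_n$): (1) The two one-dimensional representations $\sigma=1$, $\tau=\pm1$, $g^*=\delta(g,e)$; and for $1\le k\le (n-1)/2$, the two-dimensional representations $\sigma=\begin{bmatrix}\omega^k&0\\0&\omega^{-k}\end{bmatrix}$, $\tau=\begin{bmatrix}0&1\\1&0\end{bmatrix}$, $g^*=\delta(g,e)I_2$. (2) For $0\le j<n$ and $1\le k\le (n-1)/2$, the two-dimensional representations $\sigma=\begin{bmatrix}\omega^j&0\\0&\omega^{-j}\end{bmatrix}$, $\tau=\begin{bmatrix}0&1\\1&0\end{bmatrix}$, $(\sigma^k)^*=\begin{bmatrix}1&0\\0&0\end{bmatrix}$, $(\sigma^{-k})^*=\begin{bmatrix}0&0\\0&1\end{bmatrix}$, and $g^*=0$ for all other $g\in D_n$. (3) The two $n$-dimensional representations $\sigma=A$, $\tau=\pm B$, where for $1\le i,j\le n$, $[A]_{ij}=\delta(i,j+2)$ and $[B]_{ij}=\delta(i+j,2)$ (indices compared modulo $n$), and $(\sigma^i)^*=0$, $(\sigma^i\tau)^*=E^{i+1}_{i+1}$ for $0\le i<n$. Thus the list consists of $2$ one-dimensional representations, $2$ representations of dimension $n$ and $(n^2-1)/2$ two-dimensional representations.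
   Context: $D_n$ is the dihedral group of order $2n$ with generators $\sigma,\tau$ satisfying $\sigma^n=e$, $\tau^2=e$, $\tau\sigma=\sigma^{n-1}\tau$. For a finite group $G$, the quantum double $D(G)$ is the $|G|^2$-dimensional complex associative algebra with basis $\{gh^*: g,h\in G\}$, where the elements $g\in G$ multiply as in $G$, the dual elements satisfy $g^*h^*=\delta(g,h)h^*$, and $h^*g=g\,(g^{-1}hg)^*$ for $g,h\in G$. Here $g\in G$ is identified with $\sum_{h\in G}gh^*$ and $h^*$ with $eh^*$; the unit is $e=\sum_{h\in G}h^*$. Thus $D(G)$ is generated by $G$ and the elements $h^*$. $\delta(x,y)$ is $1$ if $x=y$ and $0$ otherwise; $E^i_j$ denotes the elementary matrix with $1$ in position $(i,j)$ and zeros elsewhere; $I_2$ is the $2\times2$ identity matrix. The same symbol is used for an element of the algebra and its representing matrix. *)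

theory Defs
  imports
    Complex_Main
    "HOL-Algebra.Coset"
    "HOL-Algebra.Generated_Groups"
    "HOL-Library.Multiset"
    "Jordan_Normal_Form.VS_Connect"
begin

section \<open>The dihedral group\<close>

locale dihedral = group G for G (structure) +
  fixes n :: nat and \<sigma> \<tau> :: 'a
  assumes n_pos: "0 < n"
    and order_G: "Coset.order G = 2 * n"
    and sigma_closed: "\<sigma> \<in> carrier G"
    and tau_closed: "\<tau> \<in> carrier G"
    and generated: "generate G {\<sigma>, \<tau>} = carrier G"
    and sigma_pow: "\<sigma> [^] n = \<one>"
    and tau_pow: "\<tau> [^] (2::nat) = \<one>"
    and tau_sigma: "\<tau> \<otimes> \<sigma> = \<sigma> [^] (n - 1) \<otimes> \<tau>"


text \<open>A model: \<open>(a, b)\<close> stands for \<open>\<sigma>\<^sup>a \<tau>\<^sup>b\<close>.\<close>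

definition dihedral_model :: "nat \<Rightarrow> (int \<times> bool) monoid" where
  "dihedral_model n = \<lparr>
     carrier = {0..<int n} \<times> UNIV,
     mult = (\<lambda>x y. ((fst x + (if snd x then - fst y else fst y)) mod int n, snd x \<noteq> snd y)),
     one = (0, False)\<rparr>"

lemma dihedral_dihedral_model:
  assumes n: "0 < n"
  shows "dihedral (dihedral_model n) n (1 mod int n, False) (0, True)"
proof -
  let ?G = "dihedral_model n"
  let ?s = "(1 mod int n, False)" and ?t = "(0::int, True)"
  have s: "carrier ?G = {0..<int n} \<times> UNIV"
    "\<And>x y. x \<otimes>\<^bsub>?G\<^esub> y = ((fst x + (if snd x then - fst y else fst y)) mod int n, snd x \<noteq> snd y)"
    "\<one>\<^bsub>?G\<^esub> = (0, False)"
    by (simp_all only: dihedral_model_def partial_object.simps monoid.simps)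
  have grp: "group ?G"
  proof (rule groupI)
    fix x y z assume "x \<in> carrier ?G" "y \<in> carrier ?G" "z \<in> carrier ?G"
    show "x \<otimes>\<^bsub>?G\<^esub> y \<otimes>\<^bsub>?G\<^esub> z = x \<otimes>\<^bsub>?G\<^esub> (y \<otimes>\<^bsub>?G\<^esub> z)"
      unfolding s by (cases "snd x"; cases "snd y"; cases "snd z") (simp_all add: mod_simps algebra_simps)
  next
    fix x assume x: "x \<in> carrier ?G"
    show "\<exists>y\<in>carrier ?G. y \<otimes>\<^bsub>?G\<^esub> x = \<one>\<^bsub>?G\<^esub>"
      by (rule bexI[of _ "(if snd x then fst x else (- fst x) mod int n, snd x)"])
         (use x n in \<open>auto simp: s mod_simps\<close>)
  qed (use n in \<open>auto simp: s\<close>)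
  interpret group ?G by (rule grp)
  have sc: "?s \<in> carrier ?G" and tc: "?t \<in> carrier ?G" using n by (auto simp: s)
  have pow: "?s [^]\<^bsub>?G\<^esub> k = (int k mod int n, False)" for k :: nat
    by (induction k) (simp_all add: s mod_simps add.commute)
  have gen_pow: "?s [^]\<^bsub>?G\<^esub> k \<in> generate ?G {?s, ?t}" for k :: nat
    by (induction k) (auto intro: generate.intros)
  have "x \<in> generate ?G {?s, ?t}" if x: "x \<in> carrier ?G" for x
  proof -
    obtain a b where ab: "x = (a, b)" by (cases x)
    then have a: "0 \<le> a" "a < int n" using x by (auto simp: s)
    have p: "?s [^]\<^bsub>?G\<^esub> nat a = (a, False)" using a by (simp add: pow)
    show ?thesis
    proof (cases b)
      case True
      have "x = ?s [^]\<^bsub>?G\<^esub> nat a \<otimes>\<^bsub>?G\<^esub> ?t" using ab a True unfolding p by (simp add: s)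
      moreover have "?t \<in> generate ?G {?s, ?t}" by (rule generate.incl) simp
      ultimately show ?thesis using gen_pow generate.eng by metis
    next
      case False
      then show ?thesis using gen_pow[of "nat a"] p ab by simp
    qed
  qed
  then have gen: "generate ?G {?s, ?t} = carrier ?G"
    using generate_incl[of "{?s, ?t}"] sc tc by auto
  have tp: "?t [^]\<^bsub>?G\<^esub> (2::nat) = \<one>\<^bsub>?G\<^esub>"
    by (simp add: numeral_2_eq_2 s)
  have ts: "?t \<otimes>\<^bsub>?G\<^esub> ?s = ?s [^]\<^bsub>?G\<^esub> (n - 1) \<otimes>\<^bsub>?G\<^esub> ?t"
    using n unfolding pow by (simp add: s mod_simps of_nat_diff zmod_minus1 flip: mod_add_self1[of "- 1" "int n"])
  have "Coset.order ?G = 2 * n"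
    by (simp add: Coset.order_def s card_cartesian_product card_UNIV_bool)
  then show ?thesis
    using n sc tc gen tp ts pow[of n] by unfold_locales (simp_all add: s(3))
qed


section \<open>The quantum double of a finite group\<close>

text \<open>
  An element of \<open>D(G)\<close> is given by its coefficients: \<open>x (g, h)\<close> is the coefficient of the basis
  element \<open>g h\<^sup>*\<close>. The product is the bilinear extension of
  \<open>(g h\<^sup>*) (g' h'\<^sup>*) = g g' (g'\<^sup>-\<^sup>1 h g')\<^sup>* h'\<^sup>* = \<delta>(g'\<^sup>-\<^sup>1 h g', h') g g' h'\<^sup>*\<close>.
\<close>

definition qd_basis :: "'a \<Rightarrow> 'a \<Rightarrow> 'a \<times> 'a \<Rightarrow> complex" where
  "qd_basis g h = (\<lambda>p. if p = (g, h) then 1 else 0)"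

definition quantum_double ::
    "('a, 'm) monoid_scheme \<Rightarrow> (complex, 'a \<times> 'a \<Rightarrow> complex) module" where
  "quantum_double G = \<lparr>
     carrier = {x. \<forall>p. p \<notin> carrier G \<times> carrier G \<longrightarrow> x p = 0},
     mult = (\<lambda>x y p. \<Sum>(g, h)\<in>carrier G \<times> carrier G. \<Sum>(g', h')\<in>carrier G \<times> carrier G.
               x (g, h) * y (g', h') *
               (if inv\<^bsub>G\<^esub> g' \<otimes>\<^bsub>G\<^esub> h \<otimes>\<^bsub>G\<^esub> g' = h' then qd_basis (g \<otimes>\<^bsub>G\<^esub> g') h' p else 0)),
     one = (\<lambda>p. \<Sum>h\<in>carrier G. qd_basis \<one>\<^bsub>G\<^esub> h p),
     zero = (\<lambda>p. 0),
     add = (\<lambda>x y p. x p + y p),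
     smult = (\<lambda>c x p. c * x p)\<rparr>"

definition qd_grp :: "('a, 'm) monoid_scheme \<Rightarrow> 'a \<Rightarrow> 'a \<times> 'a \<Rightarrow> complex" where
  "qd_grp G g = (\<lambda>p. \<Sum>h\<in>carrier G. qd_basis g h p)"

definition qd_dual :: "('a, 'm) monoid_scheme \<Rightarrow> 'a \<Rightarrow> 'a \<times> 'a \<Rightarrow> complex" where
  "qd_dual G h = qd_basis \<one>\<^bsub>G\<^esub> h"

lemma quantum_double_simps:
  "carrier (quantum_double G) = {x. \<forall>p. p \<notin> carrier G \<times> carrier G \<longrightarrow> x p = 0}"
  "x \<otimes>\<^bsub>quantum_double G\<^esub> y = (\<lambda>p. \<Sum>(g, h)\<in>carrier G \<times> carrier G. \<Sum>(g', h')\<in>carrier G \<times> carrier G.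
     x (g, h) * y (g', h') *
     (if inv\<^bsub>G\<^esub> g' \<otimes>\<^bsub>G\<^esub> h \<otimes>\<^bsub>G\<^esub> g' = h' then qd_basis (g \<otimes>\<^bsub>G\<^esub> g') h' p else 0))"
  "\<one>\<^bsub>quantum_double G\<^esub> = (\<lambda>p. \<Sum>h\<in>carrier G. qd_basis \<one>\<^bsub>G\<^esub> h p)"
  "\<zero>\<^bsub>quantum_double G\<^esub> = (\<lambda>p. 0)"
  "x \<oplus>\<^bsub>quantum_double G\<^esub> y = (\<lambda>p. x p + y p)"
  "c \<odot>\<^bsub>quantum_double G\<^esub> x = (\<lambda>p. c * x p)"
  by (simp_all only: quantum_double_def partial_object.simps monoid.simps ring.simps module.simps)

context group
begin

lemma conj_solve:
  assumes "b \<in> carrier G" "h \<in> carrier G" "v \<in> carrier G"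
  shows "inv b \<otimes> h \<otimes> b = v \<longleftrightarrow> h = b \<otimes> v \<otimes> inv b"
proof -
  have "b \<otimes> (inv b \<otimes> h \<otimes> b) \<otimes> inv b = (b \<otimes> inv b) \<otimes> h \<otimes> (b \<otimes> inv b)"
    using assms by (simp only: m_assoc m_closed inv_closed)
  moreover have "inv b \<otimes> (b \<otimes> v \<otimes> inv b) \<otimes> b = (inv b \<otimes> b) \<otimes> v \<otimes> (inv b \<otimes> b)"
    using assms by (simp only: m_assoc m_closed inv_closed)
  ultimately show ?thesis using assms by auto
qed

lemma qd_mult_outside:
  assumes "p \<notin> carrier G \<times> carrier G"
  shows "(x \<otimes>\<^bsub>quantum_double G\<^esub> y) p = 0"
  unfolding quantum_double_simps qd_basis_def
  using assms by (auto intro!: sum.neutral)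

lemma qd_mult_eq:
  assumes fin: "finite (carrier G)" and u: "u \<in> carrier G" and v: "v \<in> carrier G"
  shows "(x \<otimes>\<^bsub>quantum_double G\<^esub> y) (u, v)
         = (\<Sum>b\<in>carrier G. x (u \<otimes> inv b, b \<otimes> v \<otimes> inv b) * y (b, v))"
proof -
  let ?C = "carrier G"
  have inner: "(\<Sum>g\<in>?C. \<Sum>h\<in>?C. \<Sum>h'\<in>?C. x (g, h) * y (b, h') *
        (if inv b \<otimes> h \<otimes> b = h' then qd_basis (g \<otimes> b) h' (u, v) else 0))
      = x (u \<otimes> inv b, b \<otimes> v \<otimes> inv b) * y (b, v)" if b: "b \<in> ?C" for b
  proof -
    have iff: "(inv b \<otimes> h \<otimes> b = h' \<and> (u, v) = (g \<otimes> b, h')) \<longleftrightarrow>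
        (h' = v \<and> h = b \<otimes> v \<otimes> inv b \<and> g = u \<otimes> inv b)"
      if "g \<in> ?C" "h \<in> ?C" "h' \<in> ?C" for g h h'
      using that u v b conj_solve[of b h h'] inv_solve_right[of g u b] by auto
    have "(\<Sum>g\<in>?C. \<Sum>h\<in>?C. \<Sum>h'\<in>?C. x (g, h) * y (b, h') *
        (if inv b \<otimes> h \<otimes> b = h' then qd_basis (g \<otimes> b) h' (u, v) else 0))
      = (\<Sum>g\<in>?C. \<Sum>h\<in>?C. \<Sum>h'\<in>?C. if h' = v then
           (if h = b \<otimes> v \<otimes> inv b then (if g = u \<otimes> inv b then x (g, h) * y (b, h') else 0) else 0) else 0)"
      unfolding qd_basis_def using iff by (intro sum.cong refl) auto
    also have "\<dots> = x (u \<otimes> inv b, b \<otimes> v \<otimes> inv b) * y (b, v)"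
      using fin u v b by (simp add: sum.delta)
    finally show ?thesis .
  qed
  have "(x \<otimes>\<^bsub>quantum_double G\<^esub> y) (u, v) =
      (\<Sum>g\<in>?C. \<Sum>h\<in>?C. \<Sum>b\<in>?C. \<Sum>h'\<in>?C. x (g, h) * y (b, h') *
        (if inv b \<otimes> h \<otimes> b = h' then qd_basis (g \<otimes> b) h' (u, v) else 0))"
    unfolding quantum_double_simps by (simp only: sum.cartesian_product[symmetric])
  also have "\<dots> = (\<Sum>g\<in>?C. \<Sum>b\<in>?C. \<Sum>h\<in>?C. \<Sum>h'\<in>?C. x (g, h) * y (b, h') *
        (if inv b \<otimes> h \<otimes> b = h' then qd_basis (g \<otimes> b) h' (u, v) else 0))"
    by (intro sum.cong refl sum.swap)
  also have "\<dots> = (\<Sum>b\<in>?C. \<Sum>g\<in>?C. \<Sum>h\<in>?C. \<Sum>h'\<in>?C. x (g, h) * y (b, h') *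
        (if inv b \<otimes> h \<otimes> b = h' then qd_basis (g \<otimes> b) h' (u, v) else 0))"
    by (rule sum.swap)
  finally show ?thesis using inner by simp
qed

text \<open>The product just defined satisfies the defining relations of \<open>D(G)\<close>.\<close>

lemma qd_basis_closed:
  "g \<in> carrier G \<Longrightarrow> h \<in> carrier G \<Longrightarrow> qd_basis g h \<in> carrier (quantum_double G)"
  by (auto simp: quantum_double_simps qd_basis_def)

lemma qd_grp_apply:
  assumes "finite (carrier G)"
  shows "qd_grp G g (u, v) = (if u = g \<and> v \<in> carrier G then 1 else 0)"
proof -
  have "qd_grp G g (u, v) = (\<Sum>h\<in>carrier G. if h = v then (if u = g then 1 else 0) else 0)"
    unfolding qd_grp_def qd_basis_def by (intro sum.cong) auto
  then show ?thesis using assms by simp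
qed

lemma qd_grp_closed:
  "finite (carrier G) \<Longrightarrow> g \<in> carrier G \<Longrightarrow> qd_grp G g \<in> carrier (quantum_double G)"
  by (auto simp: quantum_double_simps qd_grp_apply)

lemma qd_one_eq: "\<one>\<^bsub>quantum_double G\<^esub> = qd_grp G \<one>"
  by (simp add: quantum_double_simps qd_grp_def)

lemma qd_eqI:
  assumes "x \<in> carrier (quantum_double G)" "y \<in> carrier (quantum_double G)"
    and "\<And>u v. u \<in> carrier G \<Longrightarrow> v \<in> carrier G \<Longrightarrow> x (u, v) = y (u, v)"
  shows "x = y"
proof
  fix p
  show "x p = y p"
  proof (cases "p \<in> carrier G \<times> carrier G")
    case True
    then show ?thesis using assms(3) by blast
  next
    case False
    then have "x p = 0" "y p = 0" using assms(1,2) unfolding quantum_double_simps(1) by blast+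
    then show ?thesis by simp
  qed
qed

lemma qd_mult_closed: "x \<otimes>\<^bsub>quantum_double G\<^esub> y \<in> carrier (quantum_double G)"
  unfolding quantum_double_simps(1) mem_Collect_eq using qd_mult_outside by blast

lemma qd_basis_mult:
  assumes "finite (carrier G)" "g \<in> carrier G" "h \<in> carrier G" "g' \<in> carrier G" "h' \<in> carrier G"
  shows "qd_basis g h \<otimes>\<^bsub>quantum_double G\<^esub> qd_basis g' h'
         = (if inv g' \<otimes> h \<otimes> g' = h' then qd_basis (g \<otimes> g') h' else (\<lambda>p. 0))"
    (is "_ = ?r")
proof (rule qd_eqI[OF qd_mult_closed])
  have aux: "(if u = w \<and> c = v \<and> v = h' then 1 else 0)
      = (if c = h' then qd_basis w h' else (\<lambda>p. 0)) (u, v)" for c w u v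
    by (cases "u = w"; cases "v = h'"; cases "c = h'")
       (simp_all only: qd_basis_def if_True if_False prod.inject simp_thms)
  show "?r \<in> carrier (quantum_double G)"
    using assms by (auto simp: qd_basis_closed) (simp add: quantum_double_simps)
  fix u v assume uv: "u \<in> carrier G" "v \<in> carrier G"
  have eq: "u \<otimes> inv g' = g \<longleftrightarrow> u = g \<otimes> g'"
    using assms uv inv_solve_right'[of g u g'] by auto
  have eq2: "inv g' \<otimes> h \<otimes> g' = v \<longleftrightarrow> g' \<otimes> v \<otimes> inv g' = h"
    using assms uv conj_solve[of g' h v] by auto
  have "(qd_basis g h \<otimes>\<^bsub>quantum_double G\<^esub> qd_basis g' h') (u, v)
      = (\<Sum>b\<in>carrier G. if b = g' then
           (if u \<otimes> inv g' = g \<and> g' \<otimes> v \<otimes> inv g' = h \<and> v = h' then 1 else 0) else 0)"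
    unfolding qd_mult_eq[OF assms(1) uv] by (intro sum.cong) (auto simp: qd_basis_def)
  also have "\<dots> = (if u = g \<otimes> g' \<and> inv g' \<otimes> h \<otimes> g' = v \<and> v = h' then 1 else 0)"
    unfolding eq eq2 using assms by simp
  also have "\<dots> = ?r (u, v)" by (rule aux)
  finally show "(qd_basis g h \<otimes>\<^bsub>quantum_double G\<^esub> qd_basis g' h') (u, v) = ?r (u, v)" .
qed

lemma qd_dual_mult:
  assumes "finite (carrier G)" "g \<in> carrier G" "h \<in> carrier G"
  shows "qd_dual G g \<otimes>\<^bsub>quantum_double G\<^esub> qd_dual G h = (if g = h then qd_dual G h else (\<lambda>p. 0))"
  using assms by (simp add: qd_dual_def qd_basis_mult)

lemma qd_grp_mult:
  assumes "finite (carrier G)" "g \<in> carrier G" "h \<in> carrier G"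
  shows "qd_grp G g \<otimes>\<^bsub>quantum_double G\<^esub> qd_grp G h = qd_grp G (g \<otimes> h)"
proof (rule qd_eqI[OF qd_mult_closed])
  show "qd_grp G (g \<otimes> h) \<in> carrier (quantum_double G)" using assms by (simp add: qd_grp_closed)
  fix u v assume uv: "u \<in> carrier G" "v \<in> carrier G"
  have "(qd_grp G g \<otimes>\<^bsub>quantum_double G\<^esub> qd_grp G h) (u, v)
      = (\<Sum>b\<in>carrier G. if b = h then (if u \<otimes> inv h = g then 1 else 0) else 0)"
    unfolding qd_mult_eq[OF assms(1) uv] using assms uv by (intro sum.cong) (auto simp: qd_grp_apply)
  also have "\<dots> = (if u = g \<otimes> h then 1 else 0)"
    using assms uv inv_solve_right' by auto
  finally show "(qd_grp G g \<otimes>\<^bsub>quantum_double G\<^esub> qd_grp G h) (u, v) = qd_grp G (g \<otimes> h) (u, v)"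
    using assms uv by (simp add: qd_grp_apply)
qed

lemma qd_grp_dual:
  assumes "finite (carrier G)" "g \<in> carrier G" "h \<in> carrier G"
  shows "qd_grp G g \<otimes>\<^bsub>quantum_double G\<^esub> qd_dual G h = qd_basis g h"
proof (rule qd_eqI[OF qd_mult_closed qd_basis_closed[OF assms(2,3)]])
  fix u v assume uv: "u \<in> carrier G" "v \<in> carrier G"
  have "(qd_grp G g \<otimes>\<^bsub>quantum_double G\<^esub> qd_dual G h) (u, v)
      = (\<Sum>b\<in>carrier G. if b = \<one> then (if u = g \<and> v = h then 1 else 0) else 0)"
    unfolding qd_mult_eq[OF assms(1) uv] qd_dual_def
    using assms uv by (intro sum.cong) (auto simp: qd_grp_apply qd_basis_def)
  then show "(qd_grp G g \<otimes>\<^bsub>quantum_double G\<^esub> qd_dual G h) (u, v) = qd_basis g h (u, v)"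
    using assms by (simp add: qd_basis_def)
qed

lemma qd_dual_grp:
  assumes "finite (carrier G)" "g \<in> carrier G" "h \<in> carrier G"
  shows "qd_dual G h \<otimes>\<^bsub>quantum_double G\<^esub> qd_grp G g
         = qd_grp G g \<otimes>\<^bsub>quantum_double G\<^esub> qd_dual G (inv g \<otimes> h \<otimes> g)"
proof -
  have c: "inv g \<otimes> h \<otimes> g \<in> carrier G" using assms by simp
  have "qd_dual G h \<otimes>\<^bsub>quantum_double G\<^esub> qd_grp G g = qd_basis g (inv g \<otimes> h \<otimes> g)"
  proof (rule qd_eqI[OF qd_mult_closed qd_basis_closed[OF assms(2) c]])
    fix u v assume uv: "u \<in> carrier G" "v \<in> carrier G"
    have eq: "g \<otimes> v \<otimes> inv g = h \<longleftrightarrow> inv g \<otimes> h \<otimes> g = v"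
      using conj_solve[of g h v] assms uv by metis
    have eq2: "u \<otimes> inv g = \<one> \<longleftrightarrow> u = g"
      using assms uv inv_solve_right' by auto
    have "(qd_dual G h \<otimes>\<^bsub>quantum_double G\<^esub> qd_grp G g) (u, v)
        = (\<Sum>b\<in>carrier G. if b = g then
             (if u = g \<and> inv g \<otimes> h \<otimes> g = v then 1 else 0) else 0)"
      unfolding qd_mult_eq[OF assms(1) uv] qd_dual_def
      using assms uv eq eq2 by (intro sum.cong) (auto simp: qd_grp_apply qd_basis_def)
    then show "(qd_dual G h \<otimes>\<^bsub>quantum_double G\<^esub> qd_grp G g) (u, v)
        = qd_basis g (inv g \<otimes> h \<otimes> g) (u, v)"
      using assms by (simp add: qd_basis_def)
  qed
  then show ?thesis using qd_grp_dual[OF assms(1,2) c] by simp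
qed

lemma qd_assoc:
  assumes fin: "finite (carrier G)"
  shows "(x \<otimes>\<^bsub>quantum_double G\<^esub> y) \<otimes>\<^bsub>quantum_double G\<^esub> z
         = x \<otimes>\<^bsub>quantum_double G\<^esub> (y \<otimes>\<^bsub>quantum_double G\<^esub> z)"
proof (rule qd_eqI[OF qd_mult_closed qd_mult_closed])
  fix u v assume uv: "u \<in> carrier G" "v \<in> carrier G"
  let ?C = "carrier G"
  let ?f = "\<lambda>d c. x (u \<otimes> inv d, d \<otimes> v \<otimes> inv d) * (y (d \<otimes> inv c, c \<otimes> v \<otimes> inv c) * z (c, v))"
  have "((x \<otimes>\<^bsub>quantum_double G\<^esub> y) \<otimes>\<^bsub>quantum_double G\<^esub> z) (u, v)
     = (\<Sum>c\<in>?C. \<Sum>b\<in>?C. x (u \<otimes> inv c \<otimes> inv b, b \<otimes> (c \<otimes> v \<otimes> inv c) \<otimes> inv b)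
         * y (b, c \<otimes> v \<otimes> inv c) * z (c, v))"
    using fin uv by (simp add: qd_mult_eq sum_distrib_right)
  also have "\<dots> = (\<Sum>c\<in>?C. \<Sum>b\<in>?C. ?f (b \<otimes> c) c)"
    using uv by (intro sum.cong refl) (simp add: inv_mult_group m_assoc)
  also have "\<dots> = (\<Sum>c\<in>?C. \<Sum>d\<in>?C. ?f d c)"
  proof (rule sum.cong[OF refl])
    fix c assume c: "c \<in> ?C"
    show "(\<Sum>b\<in>?C. ?f (b \<otimes> c) c) = (\<Sum>d\<in>?C. ?f d c)"
      by (rule sum.reindex_bij_witness[where i = "\<lambda>d. d \<otimes> inv c" and j = "\<lambda>b. b \<otimes> c"])
         (use c in \<open>auto simp: m_assoc\<close>)
  qed
  also have "\<dots> = (\<Sum>d\<in>?C. \<Sum>c\<in>?C. ?f d c)" by (rule sum.swap)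
  also have "\<dots> = (x \<otimes>\<^bsub>quantum_double G\<^esub> (y \<otimes>\<^bsub>quantum_double G\<^esub> z)) (u, v)"
    using fin uv by (simp add: qd_mult_eq sum_distrib_left)
  finally show "((x \<otimes>\<^bsub>quantum_double G\<^esub> y) \<otimes>\<^bsub>quantum_double G\<^esub> z) (u, v)
     = (x \<otimes>\<^bsub>quantum_double G\<^esub> (y \<otimes>\<^bsub>quantum_double G\<^esub> z)) (u, v)" .
qed

lemma quantum_double_ring:
  assumes fin: "finite (carrier G)"
  shows "ring (quantum_double G)"
proof (rule ringI)
  show "abelian_group (quantum_double G)"
  proof (rule abelian_groupI)
    fix x assume "x \<in> carrier (quantum_double G)"
    then show "\<exists>y\<in>carrier (quantum_double G). y \<oplus>\<^bsub>quantum_double G\<^esub> x = \<zero>\<^bsub>quantum_double G\<^esub>"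
      by (intro bexI[of _ "\<lambda>p. - x p"]) (auto simp: quantum_double_simps)
  qed (auto simp: quantum_double_simps)
  show "monoid (quantum_double G)"
  proof (rule monoidI)
    show "\<one>\<^bsub>quantum_double G\<^esub> \<in> carrier (quantum_double G)"
      using fin by (simp add: qd_one_eq qd_grp_closed)
    fix x assume x: "x \<in> carrier (quantum_double G)"
    show "\<one>\<^bsub>quantum_double G\<^esub> \<otimes>\<^bsub>quantum_double G\<^esub> x = x"
    proof (rule qd_eqI[OF qd_mult_closed x])
      fix u v assume uv: "u \<in> carrier G" "v \<in> carrier G"
      have "(\<one>\<^bsub>quantum_double G\<^esub> \<otimes>\<^bsub>quantum_double G\<^esub> x) (u, v)
          = (\<Sum>b\<in>carrier G. if b = u then x (u, v) else 0)"
        unfolding qd_mult_eq[OF fin uv] qd_one_eq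
        using fin uv inv_solve_right' by (intro sum.cong) (auto simp: qd_grp_apply)
      then show "(\<one>\<^bsub>quantum_double G\<^esub> \<otimes>\<^bsub>quantum_double G\<^esub> x) (u, v) = x (u, v)"
        using fin uv by simp
    qed
    show "x \<otimes>\<^bsub>quantum_double G\<^esub> \<one>\<^bsub>quantum_double G\<^esub> = x"
    proof (rule qd_eqI[OF qd_mult_closed x])
      fix u v assume uv: "u \<in> carrier G" "v \<in> carrier G"
      have "(x \<otimes>\<^bsub>quantum_double G\<^esub> \<one>\<^bsub>quantum_double G\<^esub>) (u, v)
          = (\<Sum>b\<in>carrier G. if b = \<one> then x (u, v) else 0)"
        unfolding qd_mult_eq[OF fin uv] qd_one_eq
        using fin uv by (intro sum.cong) (auto simp: qd_grp_apply)
      then show "(x \<otimes>\<^bsub>quantum_double G\<^esub> \<one>\<^bsub>quantum_double G\<^esub>) (u, v) = x (u, v)"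
        using fin uv by simp
    qed
  qed (simp_all add: qd_mult_closed qd_assoc[OF fin])
next
  fix x y z
  assume "x \<in> carrier (quantum_double G)" "y \<in> carrier (quantum_double G)"
    "z \<in> carrier (quantum_double G)"
  show "(x \<oplus>\<^bsub>quantum_double G\<^esub> y) \<otimes>\<^bsub>quantum_double G\<^esub> z
      = x \<otimes>\<^bsub>quantum_double G\<^esub> z \<oplus>\<^bsub>quantum_double G\<^esub> y \<otimes>\<^bsub>quantum_double G\<^esub> z"
    by (simp add: quantum_double_simps sum.distrib case_prod_unfold algebra_simps)
  show "z \<otimes>\<^bsub>quantum_double G\<^esub> (x \<oplus>\<^bsub>quantum_double G\<^esub> y)
      = z \<otimes>\<^bsub>quantum_double G\<^esub> x \<oplus>\<^bsub>quantum_double G\<^esub> z \<otimes>\<^bsub>quantum_double G\<^esub> y"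
    by (simp add: quantum_double_simps sum.distrib case_prod_unfold algebra_simps)
qed

end


section \<open>Matrix representations\<close>

definition qd_rep ::
    "('a, 'm) monoid_scheme \<Rightarrow> nat \<Rightarrow> (('a \<times> 'a \<Rightarrow> complex) \<Rightarrow> complex mat) \<Rightarrow> bool" where
  "qd_rep G d \<rho> \<longleftrightarrow>
     \<rho> \<in> Ring.ring_hom (quantum_double G) (ring_mat TYPE(complex) d ()) \<and>
     (\<forall>c. \<forall>x\<in>carrier (quantum_double G). \<rho> (c \<odot>\<^bsub>quantum_double G\<^esub> x) = c \<cdot>\<^sub>m \<rho> x)"

definition qd_irreducible ::
    "('a, 'm) monoid_scheme \<Rightarrow> nat \<Rightarrow> (('a \<times> 'a \<Rightarrow> complex) \<Rightarrow> complex mat) \<Rightarrow> bool" where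
  "qd_irreducible G d \<rho> \<longleftrightarrow>
     qd_rep G d \<rho> \<and> d > 0 \<and>
     (\<forall>W. VectorSpace.subspace class_ring W (module_vec TYPE(complex) d) \<and>
          (\<forall>x\<in>carrier (quantum_double G). \<forall>w\<in>W. \<rho> x *\<^sub>v w \<in> W)
          \<longrightarrow> W = {0\<^sub>v d} \<or> W = carrier_vec d)"

definition qd_isomorphic ::
    "('a, 'm) monoid_scheme \<Rightarrow> nat \<Rightarrow> (('a \<times> 'a \<Rightarrow> complex) \<Rightarrow> complex mat) \<Rightarrow>
     nat \<Rightarrow> (('a \<times> 'a \<Rightarrow> complex) \<Rightarrow> complex mat) \<Rightarrow> bool" where
  "qd_isomorphic G d \<rho> d' \<rho>' \<longleftrightarrow>
     d = d' \<and>
     (\<exists>P\<in>carrier_mat d d. invertible_mat P \<and>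
        (\<forall>x\<in>carrier (quantum_double G). P * \<rho> x = \<rho>' x * P))"


section \<open>The list of representations\<close>

text \<open>
  \<open>Char \<epsilon>\<close> (\<open>\<epsilon> = \<plusminus>1\<close>) and \<open>Planar k\<close> index the two parts of the first family, \<open>Rotation j k\<close> the
  second family and \<open>Reflection \<epsilon>\<close> (\<open>\<epsilon> = \<plusminus>1\<close>) the third.
\<close>

datatype irrep_label =
    Char complex
  | Planar nat
  | Rotation nat nat
  | Reflection complex

definition irrep_labels :: "nat \<Rightarrow> irrep_label set" where
  "irrep_labels n =
     Char ` {1, -1} \<union>
     Planar ` {1..(n - 1) div 2} \<union>
     {Rotation j k | j k. j < n \<and> 1 \<le> k \<and> k \<le> (n - 1) div 2} \<union>
     Reflection ` {1, -1}"

fun irrep_dim :: "nat \<Rightarrow> irrep_label \<Rightarrow> nat" where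
  "irrep_dim n (Char \<epsilon>) = 1"
| "irrep_dim n (Planar k) = 2"
| "irrep_dim n (Rotation j k) = 2"
| "irrep_dim n (Reflection \<epsilon>) = n"

definition omega :: "nat \<Rightarrow> complex" where
  "omega n = exp (2 * of_real pi * \<i> / of_nat n)"

definition omega_diag :: "nat \<Rightarrow> nat \<Rightarrow> complex mat" where
  "omega_diag n k = mat_of_rows_list 2 [[omega n powi int k, 0], [0, omega n powi (- int k)]]"

definition swap_mat :: "complex mat" where
  "swap_mat = mat_of_rows_list 2 [[0, 1], [1, 0]]"

text \<open>Rows and columns of library matrices are numbered from 0; the next four definitions use the
  1-based numbering.\<close>

definition mat1 :: "nat \<Rightarrow> (nat \<Rightarrow> nat \<Rightarrow> complex) \<Rightarrow> complex mat" where
  "mat1 m f = mat m m (\<lambda>(i, j). f (i + 1) (j + 1))"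

definition elem_mat :: "nat \<Rightarrow> nat \<Rightarrow> nat \<Rightarrow> complex mat" where
  "elem_mat m i j = mat1 m (\<lambda>r s. if r = i \<and> s = j then 1 else 0)"

definition A_mat :: "nat \<Rightarrow> complex mat" where
  "A_mat n = mat1 n (\<lambda>i j. if i mod n = (j + 2) mod n then 1 else 0)"

definition B_mat :: "nat \<Rightarrow> complex mat" where
  "B_mat n = mat1 n (\<lambda>i j. if (i + j) mod n = 2 mod n then 1 else 0)"

fun irrep_values ::
    "('a, 'm) monoid_scheme \<Rightarrow> nat \<Rightarrow> 'a \<Rightarrow> 'a \<Rightarrow> irrep_label \<Rightarrow>
     (('a \<times> 'a \<Rightarrow> complex) \<Rightarrow> complex mat) \<Rightarrow> bool" where
  "irrep_values G n \<sigma> \<tau> (Char \<epsilon>) \<rho> \<longleftrightarrow>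
     \<rho> (qd_grp G \<sigma>) = 1\<^sub>m 1 \<and>
     \<rho> (qd_grp G \<tau>) = \<epsilon> \<cdot>\<^sub>m 1\<^sub>m 1 \<and>
     (\<forall>g\<in>carrier G. \<rho> (qd_dual G g) = (if g = \<one>\<^bsub>G\<^esub> then 1\<^sub>m 1 else 0\<^sub>m 1 1))"
| "irrep_values G n \<sigma> \<tau> (Planar k) \<rho> \<longleftrightarrow>
     \<rho> (qd_grp G \<sigma>) = omega_diag n k \<and>
     \<rho> (qd_grp G \<tau>) = swap_mat \<and>
     (\<forall>g\<in>carrier G. \<rho> (qd_dual G g) = (if g = \<one>\<^bsub>G\<^esub> then 1\<^sub>m 2 else 0\<^sub>m 2 2))"
| "irrep_values G n \<sigma> \<tau> (Rotation j k) \<rho> \<longleftrightarrow>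
     \<rho> (qd_grp G \<sigma>) = omega_diag n j \<and>
     \<rho> (qd_grp G \<tau>) = swap_mat \<and>
     \<rho> (qd_dual G (\<sigma> [^]\<^bsub>G\<^esub> k)) = elem_mat 2 1 1 \<and>
     \<rho> (qd_dual G (\<sigma> [^]\<^bsub>G\<^esub> (- int k))) = elem_mat 2 2 2 \<and>
     (\<forall>g\<in>carrier G. g \<noteq> \<sigma> [^]\<^bsub>G\<^esub> k \<and> g \<noteq> \<sigma> [^]\<^bsub>G\<^esub> (- int k) \<longrightarrow> \<rho> (qd_dual G g) = 0\<^sub>m 2 2)"
| "irrep_values G n \<sigma> \<tau> (Reflection \<epsilon>) \<rho> \<longleftrightarrow>
     \<rho> (qd_grp G \<sigma>) = A_mat n \<and>
     \<rho> (qd_grp G \<tau>) = \<epsilon> \<cdot>\<^sub>m B_mat n \<and>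
     (\<forall>i<n. \<rho> (qd_dual G (\<sigma> [^]\<^bsub>G\<^esub> i)) = 0\<^sub>m n n \<and>
            \<rho> (qd_dual G (\<sigma> [^]\<^bsub>G\<^esub> i \<otimes>\<^bsub>G\<^esub> \<tau>)) = elem_mat n (i + 1) (i + 1))"

definition irrep_listed ::
    "('a, 'm) monoid_scheme \<Rightarrow> nat \<Rightarrow> 'a \<Rightarrow> 'a \<Rightarrow> irrep_label \<Rightarrow>
     (('a \<times> 'a \<Rightarrow> complex) \<Rightarrow> complex mat) \<Rightarrow> bool" where
  "irrep_listed G n \<sigma> \<tau> L \<rho> \<longleftrightarrow> qd_rep G (irrep_dim n L) \<rho> \<and> irrep_values G n \<sigma> \<tau> L \<rho>"

end

theory Submission
  imports Defs
begin

text \<open>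
  The idempotents \<open>h\<^sup>*\<close> decompose every representation of \<open>D(G)\<close> into components \<open>V\<^sub>h\<close> of degree
  \<open>h \<in> G\<close>, and the relation \<open>(g h g\<^sup>-\<^sup>1)\<^sup>* g = g h\<^sup>*\<close> says that \<open>g\<close> maps \<open>V\<^sub>h\<close> to the component of degree
  \<open>g h g\<^sup>-\<^sup>1\<close>. Representations of \<open>D(G)\<close> are therefore representations of \<open>G\<close> graded compatibly with
  conjugation, and an irreducible one is determined by a conjugacy class of degrees together with
  an irreducible representation of the centralizer of a member of the class. For odd \<open>n\<close> the
  classes of \<open>D\<^sub>n\<close> are \<open>{1}\<close>, the pairs \<open>{\<sigma>\<^sup>k, \<sigma>\<^sup>-\<^sup>k}\<close> with cyclic centralizer \<open>\<langle>\<sigma>\<rangle>\<close>, and the class of all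
  reflections with centralizers of order 2; they account for the three families.

  The proof makes this explicit without general theory. In a listed representation the generators
  permute the unit vectors up to scalars, and every unit vector has a degree
  (\<open>irrep_listed_iff\<close>). A graded monomial representation of the group extends to \<open>D(G)\<close>
  (\<open>exists_monomial_rep\<close>, built on \<open>graded_rep_mult\<close>), which gives existence. Irreducibility holds because
  the coordinate projections are in the image of the algebra and the group permutes the
  coordinates transitively (\<open>irreducible_if_projections_transitive\<close>). Inequivalent labels are
  separated by the degrees that occur and by one linear relation per family
  (\<open>label_eq_if_isomorphic\<close>).

  For completeness, take a nonzero vector of some degree in an irreducible representation
  (\<open>exists_graded\<close>). The centralizer of the degree contains a cyclic group, for which an eigenvector
  of the same degree is found by a finite Fourier transform (\<open>fourier_eigenvector\<close>) or, for \<open>\<tau>\<close>, by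
  forming \<open>u \<plusminus> \<tau> u\<close>. Its images under the group behave like the unit vectors of a listed
  representation, hence are the columns of a nonzero intertwiner (\<open>in_list_if_vectors\<close>), which is an
  isomorphism by Schur's lemma (\<open>isomorphic_if_nonzero_intertwiner\<close>).
\<close>

section \<open>The dihedral group\<close>

text \<open>The normal form is evaluated in an arbitrary monoid: its multiplication table is the same in
  the group and among matrices, and comparing the two evaluations yields the universal property.\<close>

definition dihedral_word :: "('b, 'c) monoid_scheme \<Rightarrow> 'b \<Rightarrow> 'b \<Rightarrow> nat \<Rightarrow> bool \<Rightarrow> 'b" where
  "dihedral_word H s t i b = s [^]\<^bsub>H\<^esub> i \<otimes>\<^bsub>H\<^esub> (if b then t else \<one>\<^bsub>H\<^esub>)"

text \<open>The relation \<open>s t s = t\<close> is equivalent, given \<open>s\<^sup>n = 1\<close>, to \<open>t s = s\<^sup>n\<^sup>-\<^sup>1 t\<close>, but for matrices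
  it can be verified without computing a power.\<close>

locale dihedral_pair = monoid H for H (structure) +
  fixes n :: nat and s t
  assumes modulus_pos: "0 < n" and s_closed: "s \<in> carrier H" and t_closed: "t \<in> carrier H"
    and s_pow: "s [^] n = \<one>" and t_t: "t \<otimes> t = \<one>" and s_t_s: "s \<otimes> t \<otimes> s = t"
begin

lemma pow_mod: "s [^] (i mod n) = s [^] i"
proof -
  have "s [^] i = s [^] (i mod n + n * (i div n))" by simp
  also have "\<dots> = s [^] (i mod n) \<otimes> (s [^] n) [^] (i div n)"
    using s_closed by (simp only: nat_pow_mult nat_pow_pow)
  finally show ?thesis using s_closed by (simp add: s_pow)
qed

lemma t_s: "t \<otimes> s = s [^] (n - 1) \<otimes> t"
proof -
  have "t \<otimes> s = s [^] (n - 1 + 1) \<otimes> (t \<otimes> s)"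
    using s_closed t_closed modulus_pos s_pow by simp
  also have "\<dots> = s [^] (n - 1) \<otimes> (s \<otimes> t \<otimes> s)"
    using s_closed t_closed by (simp add: m_assoc nat_pow_mult[symmetric])
  finally show ?thesis by (simp add: s_t_s)
qed

lemma t_s_pow: "t \<otimes> s [^] j = s [^] ((n - 1) * j) \<otimes> t"
proof (induction j)
  case (Suc j)
  have "t \<otimes> s [^] Suc j = s [^] ((n - 1) * j) \<otimes> (t \<otimes> s)"
    using s_closed t_closed Suc by (simp add: m_assoc[symmetric])
  also have "\<dots> = s [^] ((n - 1) * j + (n - 1)) \<otimes> t"
    using s_closed t_closed by (simp add: t_s m_assoc[symmetric] nat_pow_mult)
  finally show ?case by (simp add: add.commute)
qed (use t_closed in simp)

lemma dihedral_word_closed: "dihedral_word H s t i b \<in> carrier H"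
  using s_closed t_closed by (simp add: dihedral_word_def)

lemma dihedral_word_mult:
  "dihedral_word H s t i b \<otimes> dihedral_word H s t j c
   = dihedral_word H s t ((i + (if b then (n - 1) * j else j)) mod n) (b \<noteq> c)"
proof (cases b)
  case True
  have "s [^] i \<otimes> t \<otimes> (s [^] j \<otimes> x) = s [^] (i + (n - 1) * j) \<otimes> (t \<otimes> x)" if "x \<in> carrier H" for x
  proof -
    have "s [^] i \<otimes> t \<otimes> (s [^] j \<otimes> x) = s [^] i \<otimes> (t \<otimes> s [^] j) \<otimes> x"
      using that s_closed t_closed by (simp add: m_assoc)
    also have "\<dots> = s [^] i \<otimes> s [^] ((n - 1) * j) \<otimes> (t \<otimes> x)"
      using that s_closed t_closed by (simp add: t_s_pow m_assoc)
    finally show ?thesis using s_closed by (simp add: nat_pow_mult)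
  qed
  then show ?thesis
    using True s_closed t_closed by (simp add: dihedral_word_def t_t pow_mod)
next
  case False
  then show ?thesis
    using s_closed t_closed by (auto simp: dihedral_word_def pow_mod nat_pow_mult m_assoc[symmetric])
qed

end

context dihedral
begin

sublocale pair: dihedral_pair G n \<sigma> \<tau>
proof unfold_locales
  show "\<tau> \<otimes> \<tau> = \<one>" using tau_pow tau_closed by (simp add: numeral_2_eq_2)
  have "\<sigma> \<otimes> \<tau> \<otimes> \<sigma> = \<sigma> \<otimes> \<sigma> [^] (n - 1) \<otimes> \<tau>"
    using tau_sigma sigma_closed tau_closed by (simp add: m_assoc)
  also have "\<sigma> \<otimes> \<sigma> [^] (n - 1) = \<sigma> [^] n"
    using n_pos sigma_closed nat_pow_Suc2[of \<sigma> "n - 1"] by simp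
  finally show "\<sigma> \<otimes> \<tau> \<otimes> \<sigma> = \<tau>" using tau_closed by (simp add: sigma_pow)
qed (fact n_pos sigma_closed tau_closed sigma_pow)+

abbreviation "word \<equiv> dihedral_word G \<sigma> \<tau>"

lemma finite_carrier: "finite (carrier G)"
  using order_G n_pos card_gt_0_iff[of "carrier G"] by (simp add: Coset.order_def)

text \<open>The words form a set closed under products, and inverses of the generators are powers of
  them.\<close>

lemma word_surj: "(\<lambda>(i, b). word i b) ` ({..<n} \<times> UNIV) = carrier G"
proof -
  let ?N = "(\<lambda>(i, b). word i b) ` ({..<n} \<times> UNIV)"
  have inN: "word i b \<in> ?N" for i b
  proof -
    have "word i b = word (i mod n) b" by (simp add: dihedral_word_def pair.pow_mod)
    then show ?thesis using n_pos by (auto intro!: image_eqI[of _ _ "(i mod n, b)"])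
  qed
  have gens: "\<one> = word 0 False" "\<sigma> = word 1 False" "\<tau> = word 0 True"
    using sigma_closed tau_closed by (simp_all add: dihedral_word_def)
  have inv_s: "inv \<sigma> = word (n - 1) False"
  proof -
    have "word (n - 1) False \<otimes> \<sigma> = \<one>"
      using n_pos sigma_closed nat_pow_Suc[of \<sigma> "n - 1"] by (simp add: dihedral_word_def sigma_pow)
    then show ?thesis using sigma_closed pair.dihedral_word_closed by (metis inv_equality)
  qed
  have inv_t: "inv \<tau> = word 0 True"
    using pair.t_t tau_closed inv_equality gens(3) by metis
  have "x \<in> ?N" if "x \<in> generate G {\<sigma>, \<tau>}" for x
    using that
  proof induction
    case one
    then show ?case using inN gens(1) by metis
  next
    case (incl h)
    then show ?case using inN gens(2,3) by (metis empty_iff insert_iff)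
  next
    case (inv h)
    then show ?case using inN inv_s inv_t by (metis empty_iff insert_iff)
  next
    case (eng h1 h2)
    then show ?case using inN by (auto simp: pair.dihedral_word_mult)
  qed
  moreover have "?N \<subseteq> carrier G" using pair.dihedral_word_closed by auto
  ultimately show ?thesis using generated by auto
qed

text \<open>The group has order \<open>2 n\<close>, which is also the number of words, so no two of them coincide.\<close>

lemma word_inj: "inj_on (\<lambda>(i, b). word i b) ({..<n} \<times> UNIV)"
  by (rule eq_card_imp_inj_on)
     (use order_G in \<open>simp_all add: word_surj card_cartesian_product card_UNIV_bool Coset.order_def\<close>)

lemma word_cases:
  assumes "g \<in> carrier G"
  obtains i b where "i < n" "g = word i b"
proof -
  have "g \<in> (\<lambda>(i, b). word i b) ` ({..<n} \<times> UNIV)" using assms by (simp only: word_surj)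
  then show thesis using that by auto
qed

text \<open>Both generators have finite order, so every element is reached from the unit by left
  multiplications with \<open>\<sigma>\<close> and \<open>\<tau>\<close>, and inverses need no case of their own.\<close>

lemma dihedral_induct [consumes 1, case_names one sigma tau]:
  assumes g: "g \<in> carrier G" and one: "P \<one>"
    and sig: "\<And>g. g \<in> carrier G \<Longrightarrow> P g \<Longrightarrow> P (\<sigma> \<otimes> g)"
    and tau: "\<And>g. g \<in> carrier G \<Longrightarrow> P g \<Longrightarrow> P (\<tau> \<otimes> g)"
  shows "P g"
proof -
  obtain i b where ib: "g = word i b" using g word_cases by metis
  have t: "P (if b then \<tau> else \<one>)"
    using tau[of \<one>] one tau_closed by auto
  have "P (\<sigma> [^] i \<otimes> (if b then \<tau> else \<one>))"
  proof (induction i)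
    case 0
    then show ?case using t tau_closed by auto
  next
    case (Suc i)
    have "\<sigma> [^] Suc i \<otimes> (if b then \<tau> else \<one>) = \<sigma> \<otimes> (\<sigma> [^] i \<otimes> (if b then \<tau> else \<one>))"
      using sigma_closed tau_closed nat_pow_Suc2[of \<sigma> i] by (simp add: m_assoc)
    then show ?case using sig[OF _ Suc] sigma_closed tau_closed by simp
  qed
  then show ?thesis using ib by (simp add: dihedral_word_def)
qed

text \<open>Normal forms multiply by the same rule in \<open>G\<close> and in \<open>H\<close>, so replacing the generators of a
  normal form by \<open>s\<close> and \<open>t\<close> is multiplicative.\<close>

lemma universal_property:
  assumes "dihedral_pair H n s t"
  obtains R where "R \<in> hom G H" "R \<one> = \<one>\<^bsub>H\<^esub>" "R \<sigma> = s" "R \<tau> = t"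
proof -
  interpret H: dihedral_pair H n s t by (rule assms)
  let ?w = "\<lambda>(i, b). word i b"
  define R where "R g = (case the_inv_into ({..<n} \<times> UNIV) ?w g of (i, b) \<Rightarrow> dihedral_word H s t i b)" for g
  have R: "R (word i b) = dihedral_word H s t i b" for i b
  proof -
    have 1: "word i b = ?w (i mod n, b)" by (simp add: dihedral_word_def pair.pow_mod)
    have "the_inv_into ({..<n} \<times> UNIV) ?w (word i b) = (i mod n, b)"
      unfolding 1 by (rule the_inv_into_f_f[OF word_inj]) (use n_pos in simp)
    then show ?thesis by (simp add: R_def dihedral_word_def H.pow_mod)
  qed
  show thesis
  proof
    show "R \<in> hom G H"
    proof (rule homI)
      fix x assume "x \<in> carrier G"
      then obtain i b where "x = word i b" using word_cases by metis
      then show "R x \<in> carrier H" by (simp add: R H.dihedral_word_closed)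
      fix y assume "y \<in> carrier G"
      then obtain j c where "y = word j c" using word_cases by metis
      then show "R (x \<otimes> y) = R x \<otimes>\<^bsub>H\<^esub> R y"
        using \<open>x = _\<close> by (simp add: R pair.dihedral_word_mult H.dihedral_word_mult)
    qed
    show "R \<one> = \<one>\<^bsub>H\<^esub>" using R[of 0 False] by (simp add: dihedral_word_def)
    show "R \<sigma> = s" using R[of 1 False] sigma_closed H.s_closed by (simp add: dihedral_word_def)
    show "R \<tau> = t" using R[of 0 True] tau_closed H.t_closed by (simp add: dihedral_word_def)
  qed
qed

lemma sigma_int_mod: "\<sigma> [^] (i mod int n) = \<sigma> [^] (i :: int)"
proof -
  have "\<sigma> [^] i = \<sigma> [^] (i mod int n + int n * (i div int n))" by simp
  also have "\<dots> = \<sigma> [^] (i mod int n) \<otimes> (\<sigma> [^] int n) [^] (i div int n)"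
    using sigma_closed by (simp only: int_pow_mult int_pow_pow)
  finally show ?thesis using sigma_closed by (simp add: int_pow_int sigma_pow)
qed

lemma word_int: "word i b = \<sigma> [^] int i \<otimes> (if b then \<tau> else \<one>)"
  by (simp add: dihedral_word_def int_pow_int)

lemma word_nat_mod:
  "\<sigma> [^] (i :: int) = word (nat (i mod int n)) False"
  "\<sigma> [^] (i :: int) \<otimes> \<tau> = word (nat (i mod int n)) True"
  using n_pos sigma_closed by (simp_all add: word_int sigma_int_mod)

lemma word_eq_iff: "i < n \<Longrightarrow> j < n \<Longrightarrow> word i b = word j c \<longleftrightarrow> i = j \<and> b = c"
  using inj_on_eq_iff[OF word_inj, of "(i, b)" "(j, c)"] by simp

lemma nat_mod_eq_iff: "nat (i mod int n) = nat (j mod int n) \<longleftrightarrow> int n dvd i - j"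
  using n_pos by (simp add: nat_eq_iff mod_eq_dvd_iff)

lemma sigma_eq_iff: "\<sigma> [^] (i :: int) = \<sigma> [^] (j :: int) \<longleftrightarrow> int n dvd i - j"
  using n_pos by (simp add: word_nat_mod word_eq_iff nat_less_iff nat_mod_eq_iff)

lemma sigma_tau_eq_iff: "\<sigma> [^] (i :: int) \<otimes> \<tau> = \<sigma> [^] (j :: int) \<otimes> \<tau> \<longleftrightarrow> int n dvd i - j"
  unfolding word_nat_mod(2) using n_pos by (simp add: word_eq_iff nat_less_iff nat_mod_eq_iff)

lemma sigma_tau_neq: "\<sigma> [^] (i :: int) \<otimes> \<tau> \<noteq> \<sigma> [^] (j :: int)" "\<sigma> [^] (j :: int) \<noteq> \<sigma> [^] (i :: int) \<otimes> \<tau>"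
  unfolding word_nat_mod(2) unfolding word_nat_mod(1)
  using n_pos by (simp_all add: word_eq_iff nat_less_iff)

lemma carrier_cases:
  assumes "g \<in> carrier G"
  obtains i where "i < n" "g = \<sigma> [^] int i" | i where "i < n" "g = \<sigma> [^] int i \<otimes> \<tau>"
proof -
  obtain i b where "i < n" "g = word i b" using assms word_cases by metis
  then show thesis using that sigma_closed by (cases b) (auto simp: word_int)
qed

lemma inv_tau: "inv \<tau> = \<tau>"
  using pair.t_t tau_closed inv_equality by blast

lemma tau_sigma_int: "\<tau> \<otimes> \<sigma> [^] (i :: int) = \<sigma> [^] (- i) \<otimes> \<tau>"
proof -
  have "\<tau> \<otimes> \<sigma> [^] i = \<tau> \<otimes> \<sigma> [^] (nat (i mod int n))"
    using n_pos by (simp add: sigma_int_mod flip: int_pow_int)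
  also have "\<dots> = \<sigma> [^] int ((n - 1) * nat (i mod int n)) \<otimes> \<tau>"
    unfolding pair.t_s_pow int_pow_int ..
  also have "\<sigma> [^] int ((n - 1) * nat (i mod int n)) = \<sigma> [^] (- i)"
    unfolding sigma_eq_iff
  proof -
    have "int ((n - 1) * nat (i mod int n)) - (- i) = int n * (i mod int n) + (i - i mod int n)"
      using n_pos by (simp add: of_nat_diff algebra_simps)
    then show "int n dvd int ((n - 1) * nat (i mod int n)) - (- i)"
      by (metis dvd_add dvd_minus_mod dvd_triv_left)
  qed
  finally show ?thesis .
qed

lemma sigma_mult: "\<sigma> [^] (i :: int) \<otimes> \<sigma> [^] (j :: int) = \<sigma> [^] (i + j)"
  using sigma_closed by (simp add: int_pow_mult)

lemma sigma_tau_sigma: "\<sigma> [^] (i :: int) \<otimes> \<tau> \<otimes> \<sigma> [^] (j :: int) = \<sigma> [^] (i - j) \<otimes> \<tau>"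
proof -
  have "\<sigma> [^] i \<otimes> \<tau> \<otimes> \<sigma> [^] j = \<sigma> [^] i \<otimes> \<sigma> [^] (- j) \<otimes> \<tau>"
    using sigma_closed tau_closed by (simp add: m_assoc tau_sigma_int)
  then show ?thesis by (simp add: sigma_mult)
qed

text \<open>Conjugation by \<open>\<sigma>\<^sup>a\<close> moves the index of a reflection by \<open>2 a\<close>. This is where the shift by two in
  the \<open>n\<close>-dimensional representations comes from; and for odd \<open>n\<close> it makes all reflections
  conjugate.\<close>

lemma conj_sigma:
  "\<sigma> [^] (a :: int) \<otimes> \<sigma> [^] (i :: int) \<otimes> inv (\<sigma> [^] a) = \<sigma> [^] i"
  "\<sigma> [^] (a :: int) \<otimes> (\<sigma> [^] (i :: int) \<otimes> \<tau>) \<otimes> inv (\<sigma> [^] a) = \<sigma> [^] (i + 2 * a) \<otimes> \<tau>"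
  using sigma_closed tau_closed
  by (simp_all add: sigma_mult sigma_tau_sigma algebra_simps m_assoc[symmetric] flip: int_pow_neg)

lemma conj_tau:
  "\<tau> \<otimes> \<sigma> [^] (i :: int) \<otimes> inv \<tau> = \<sigma> [^] (- i)"
  "\<tau> \<otimes> (\<sigma> [^] (i :: int) \<otimes> \<tau>) \<otimes> inv \<tau> = \<sigma> [^] (- i) \<otimes> \<tau>"
  using sigma_closed tau_closed
  by (simp_all add: inv_tau tau_sigma_int m_assoc pair.t_t)

lemma sigma_int_1: "\<sigma> [^] (1 :: int) = \<sigma>"
  using sigma_closed by simp

end

section \<open>Linear algebra\<close>

lemma mat_eq_by_vec:
  fixes A B :: "'b :: semiring_1 mat"
  assumes A: "A \<in> carrier_mat m k" and B: "B \<in> carrier_mat m k"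
    and eq: "\<And>v. v \<in> carrier_vec k \<Longrightarrow> A *\<^sub>v v = B *\<^sub>v v"
  shows "A = B"
proof (rule eq_matI)
  fix i j assume ij: "i < dim_row B" "j < dim_col B"
  have "C $$ (i, j) = (C *\<^sub>v unit_vec k j) $ i" if "C \<in> carrier_mat m k" for C :: "'b mat"
    using that ij B by (simp add: scalar_prod_right_unit)
  then show "A $$ (i, j) = B $$ (i, j)" using A B eq by simp
qed (use A B in auto)

lemma zero_mat_mult_vec: "v \<in> carrier_vec k \<Longrightarrow> 0\<^sub>m m k *\<^sub>v v = (0\<^sub>v m :: 'b :: semiring_1 vec)"
  by (rule eq_vecI) (auto simp: scalar_prod_def)

lemma vec_subspace_iff:
  "VectorSpace.subspace class_ring W (module_vec TYPE('b :: field) d) \<longleftrightarrow>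
   W \<subseteq> carrier_vec d \<and> 0\<^sub>v d \<in> W \<and> (\<forall>v\<in>W. \<forall>w\<in>W. v + w \<in> W) \<and> (\<forall>c. \<forall>v\<in>W. c \<cdot>\<^sub>v v \<in> W)"
proof -
  have "vectorspace class_ring (module_vec TYPE('b) d)" by (rule vec_vs)
  moreover have "Module.module class_ring (module_vec TYPE('b) d)" by (rule vec_module)
  ultimately show ?thesis
    by (auto simp: VectorSpace.subspace_def submodule_def module_vec_simps)
qed

text \<open>The traces of \<open>A B\<close> and \<open>B A\<close> agree, and in characteristic zero the trace of an identity matrix
  determines its size.\<close>

lemma two_sided_inverse_square:
  fixes A B :: "'b :: field_char_0 mat"
  assumes A: "A \<in> carrier_mat m k" and B: "B \<in> carrier_mat k m"
    and AB: "A * B = 1\<^sub>m m" and BA: "B * A = 1\<^sub>m k"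
  shows "m = k"
proof -
  have "of_nat m = (\<Sum>i<m. (A * B) $$ (i, i))" unfolding AB by simp
  also have "\<dots> = (\<Sum>i<m. \<Sum>j<k. A $$ (i, j) * B $$ (j, i))"
    using A B by (simp add: scalar_prod_def lessThan_atLeast0)
  also have "\<dots> = (\<Sum>j<k. \<Sum>i<m. B $$ (j, i) * A $$ (i, j))"
    by (subst sum.swap) (simp add: mult.commute)
  also have "\<dots> = (\<Sum>j<k. (B * A) $$ (j, j))"
    using A B by (simp add: scalar_prod_def lessThan_atLeast0)
  also have "\<dots> = of_nat k" unfolding BA by simp
  finally show ?thesis by simp
qed

section \<open>Representations of the quantum double\<close>

lemma qd_add_closed:
  "x \<in> carrier (quantum_double G) \<Longrightarrow> y \<in> carrier (quantum_double G) \<Longrightarrow>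
   x \<oplus>\<^bsub>quantum_double G\<^esub> y \<in> carrier (quantum_double G)"
  by (simp add: quantum_double_simps)

lemma qd_smult_closed:
  "x \<in> carrier (quantum_double G) \<Longrightarrow> c \<odot>\<^bsub>quantum_double G\<^esub> x \<in> carrier (quantum_double G)"
  by (simp add: quantum_double_simps)

context group
begin

lemma qd_dual_closed: "h \<in> carrier G \<Longrightarrow> qd_dual G h \<in> carrier (quantum_double G)"
  by (simp add: qd_dual_def qd_basis_closed)

text \<open>The basis elements are presented as products \<open>g h\<^sup>*\<close>, so that a property compatible with
  multiplication can be checked on group elements and on dual elements separately.\<close>

lemma qd_induct [consumes 2, case_names basis smult add]:
  assumes fin: "finite (carrier G)" and x: "x \<in> carrier (quantum_double G)"
    and basis: "\<And>g h. g \<in> carrier G \<Longrightarrow> h \<in> carrier G \<Longrightarrow>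
      P (qd_grp G g \<otimes>\<^bsub>quantum_double G\<^esub> qd_dual G h)"
    and smult: "\<And>c x. x \<in> carrier (quantum_double G) \<Longrightarrow> P x \<Longrightarrow> P (c \<odot>\<^bsub>quantum_double G\<^esub> x)"
    and add: "\<And>x y. x \<in> carrier (quantum_double G) \<Longrightarrow> y \<in> carrier (quantum_double G) \<Longrightarrow>
      P x \<Longrightarrow> P y \<Longrightarrow> P (x \<oplus>\<^bsub>quantum_double G\<^esub> y)"
  shows "P x"
proof -
  have b: "P (qd_basis g h)" if "g \<in> carrier G" "h \<in> carrier G" for g h
    using basis[OF that] qd_grp_dual[OF fin that] by simp
  let ?r = "\<lambda>S p. if p \<in> S then x p else 0"
  have rc: "?r S \<in> carrier (quantum_double G)" for S
    using x by (auto simp: quantum_double_simps)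
  have "P (?r S)" if "finite S" "S \<subseteq> carrier G \<times> carrier G" for S
    using that
  proof (induction S)
    case empty
    have "P (0 \<odot>\<^bsub>quantum_double G\<^esub> qd_basis \<one> \<one>)"
      by (rule smult) (simp_all add: b qd_basis_closed)
    then show ?case by (simp add: quantum_double_simps)
  next
    case (insert p S)
    obtain g h where p: "p = (g, h)" by (cases p)
    have gh: "g \<in> carrier G" "h \<in> carrier G" using insert.prems p by auto
    have "?r (insert p S) = (x p \<odot>\<^bsub>quantum_double G\<^esub> qd_basis g h) \<oplus>\<^bsub>quantum_double G\<^esub> ?r S"
      using insert.hyps p by (auto simp: quantum_double_simps qd_basis_def)
    moreover have "P \<dots>"
      using insert gh by (intro add smult b qd_smult_closed qd_basis_closed rc) auto
    ultimately show ?case by simp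
  qed
  from this[of "carrier G \<times> carrier G"] have "P (?r (carrier G \<times> carrier G))" using fin by simp
  moreover have "?r (carrier G \<times> carrier G) = x" using x by (auto simp: quantum_double_simps)
  ultimately show ?thesis by simp
qed

end

locale qd_module = group G for G (structure) +
  fixes d :: nat and \<rho>
  assumes finite_group: "finite (carrier G)" and rep: "qd_rep G d \<rho>"
begin

abbreviation "D \<equiv> quantum_double G"
abbreviation "grp g \<equiv> \<rho> (qd_grp G g)"
abbreviation "dual h \<equiv> \<rho> (qd_dual G h)"

lemma hom: "\<rho> \<in> Ring.ring_hom D (ring_mat TYPE(complex) d ())"
  using rep by (simp add: qd_rep_def)

lemma rho_closed: "x \<in> carrier D \<Longrightarrow> \<rho> x \<in> carrier_mat d d"
  using ring_hom_closed[OF hom] by (simp add: ring_mat_simps)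

lemma rho_mult: "x \<in> carrier D \<Longrightarrow> y \<in> carrier D \<Longrightarrow> \<rho> (x \<otimes>\<^bsub>D\<^esub> y) = \<rho> x * \<rho> y"
  using ring_hom_mult[OF hom] by (simp add: ring_mat_simps)

lemma rho_add: "x \<in> carrier D \<Longrightarrow> y \<in> carrier D \<Longrightarrow> \<rho> (x \<oplus>\<^bsub>D\<^esub> y) = \<rho> x + \<rho> y"
  using ring_hom_add[OF hom] by (simp add: ring_mat_simps)

lemma rho_smult: "x \<in> carrier D \<Longrightarrow> \<rho> (c \<odot>\<^bsub>D\<^esub> x) = c \<cdot>\<^sub>m \<rho> x"
  using rep by (simp add: qd_rep_def)

lemma grp_in: "g \<in> carrier G \<Longrightarrow> qd_grp G g \<in> carrier D"
  by (simp add: finite_group qd_grp_closed)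

lemma dual_in: "g \<in> carrier G \<Longrightarrow> qd_dual G g \<in> carrier D"
  by (simp add: qd_dual_closed)

lemma grp_closed: "g \<in> carrier G \<Longrightarrow> grp g \<in> carrier_mat d d"
  by (simp add: grp_in rho_closed)

lemma dual_closed: "g \<in> carrier G \<Longrightarrow> dual g \<in> carrier_mat d d"
  by (simp add: dual_in rho_closed)

lemma grp_one: "grp \<one> = 1\<^sub>m d"
  using ring_hom_one[OF hom] by (simp add: ring_mat_simps qd_one_eq)

lemma grp_mult: "g \<in> carrier G \<Longrightarrow> h \<in> carrier G \<Longrightarrow> grp (g \<otimes> h) = grp g * grp h"
  by (simp add: rho_mult[symmetric] grp_in qd_grp_mult[OF finite_group])

text \<open>The commutation relation, written so that it describes where \<open>g\<close> moves the image of \<open>h\<^sup>*\<close>.\<close>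

lemma dual_grp:
  "g \<in> carrier G \<Longrightarrow> h \<in> carrier G \<Longrightarrow> dual (g \<otimes> h \<otimes> inv g) * grp g = grp g * dual h"
  using conj_solve[of g "g \<otimes> h \<otimes> inv g" h]
  by (simp add: rho_mult[symmetric] grp_in dual_in qd_dual_grp[OF finite_group])

lemma zero_closed: "(\<lambda>p. 0) \<in> carrier D"
  by (simp add: quantum_double_simps)

lemma rho_zero: "\<rho> (\<lambda>p. 0) = 0\<^sub>m d d"
proof -
  have "\<rho> (0 \<odot>\<^bsub>D\<^esub> (\<lambda>p. 0)) = 0 \<cdot>\<^sub>m \<rho> (\<lambda>p. 0)" by (rule rho_smult[OF zero_closed])
  moreover have "0 \<cdot>\<^sub>m \<rho> (\<lambda>p. 0) = 0\<^sub>m d d"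
    by (rule eq_matI) (use rho_closed[OF zero_closed] in auto)
  ultimately show ?thesis by (simp add: quantum_double_simps)
qed

lemma dual_dual:
  "g \<in> carrier G \<Longrightarrow> h \<in> carrier G \<Longrightarrow> dual g * dual h = (if g = h then dual h else 0\<^sub>m d d)"
  by (simp add: rho_mult[symmetric] dual_in qd_dual_mult[OF finite_group] rho_zero)

text \<open>The orthogonal idempotents \<open>h\<^sup>*\<close> make every representation a \<open>G\<close>-graded space; this is its
  component of degree \<open>h\<close>.\<close>

definition graded :: "'a \<Rightarrow> complex vec set" where
  "graded h = {v \<in> carrier_vec d. dual h *\<^sub>v v = v}"

lemma gradedD: "v \<in> graded h \<Longrightarrow> v \<in> carrier_vec d" "v \<in> graded h \<Longrightarrow> dual h *\<^sub>v v = v"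
  by (auto simp: graded_def)

lemma graded_add:
  "h \<in> carrier G \<Longrightarrow> v \<in> graded h \<Longrightarrow> w \<in> graded h \<Longrightarrow> v + w \<in> graded h"
  using dual_closed[of h] by (simp add: graded_def mult_add_distrib_mat_vec[of _ d d])

lemma graded_smult: "h \<in> carrier G \<Longrightarrow> v \<in> graded h \<Longrightarrow> c \<cdot>\<^sub>v v \<in> graded h"
  using dual_closed[of h] by (simp add: graded_def mult_mat_vec[of _ d d])

lemma dual_image_graded: "h \<in> carrier G \<Longrightarrow> v \<in> carrier_vec d \<Longrightarrow> dual h *\<^sub>v v \<in> graded h"
  using dual_closed[of h] dual_dual[of h h] by (simp add: graded_def flip: assoc_mult_mat_vec[of _ d d _ d])

lemma dual_graded:
  assumes "g \<in> carrier G" "h \<in> carrier G" "v \<in> graded h"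
  shows "dual g *\<^sub>v v = (if g = h then v else 0\<^sub>v d)"
proof -
  note c = dual_closed[OF assms(1)] dual_closed[OF assms(2)] gradedD[OF assms(3)]
  have "dual g *\<^sub>v v = (dual g * dual h) *\<^sub>v v"
    using c by (simp add: assoc_mult_mat_vec[of _ d d _ d])
  then show ?thesis unfolding dual_dual[OF assms(1,2)] using c by auto
qed

lemma grp_graded:
  assumes "g \<in> carrier G" "h \<in> carrier G" "v \<in> graded h"
  shows "grp g *\<^sub>v v \<in> graded (g \<otimes> h \<otimes> inv g)"
proof -
  note c = grp_closed[OF assms(1)] dual_closed[OF assms(2)] gradedD[OF assms(3)]
  have "dual (g \<otimes> h \<otimes> inv g) \<in> carrier_mat d d" using assms by (simp add: dual_closed)
  then have "dual (g \<otimes> h \<otimes> inv g) *\<^sub>v (grp g *\<^sub>v v) = (dual (g \<otimes> h \<otimes> inv g) * grp g) *\<^sub>v v"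
    using c by (simp add: assoc_mult_mat_vec[of _ d d _ d])
  also have "\<dots> = grp g *\<^sub>v (dual h *\<^sub>v v)"
    unfolding dual_grp[OF assms(1,2)] using c by (simp add: assoc_mult_mat_vec[of _ d d _ d])
  finally show ?thesis using c mult_mat_vec_carrier[OF c(1,3)] by (simp add: graded_def)
qed

lemma grp_mult_vec:
  "g \<in> carrier G \<Longrightarrow> h \<in> carrier G \<Longrightarrow> v \<in> carrier_vec d \<Longrightarrow>
   grp g *\<^sub>v (grp h *\<^sub>v v) = grp (g \<otimes> h) *\<^sub>v v"
  using grp_closed by (simp add: grp_mult assoc_mult_mat_vec[of _ d d _ d])

lemma grp_vec_nonzero:
  assumes "g \<in> carrier G" "v \<in> carrier_vec d" "v \<noteq> 0\<^sub>v d"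
  shows "grp g *\<^sub>v v \<noteq> 0\<^sub>v d"
proof
  assume "grp g *\<^sub>v v = 0\<^sub>v d"
  then have "grp (inv g) *\<^sub>v (grp g *\<^sub>v v) = 0\<^sub>v d"
    using assms grp_closed[of "inv g"] by (auto simp: scalar_prod_def)
  then show False using assms by (simp add: grp_mult_vec grp_one)
qed

text \<open>If all \<open>h\<^sup>*\<close> acted by zero, so would every \<open>g h\<^sup>*\<close> and hence the whole algebra, but the unit acts
  by the identity matrix.\<close>

lemma exists_graded:
  assumes "d > 0"
  obtains h v where "h \<in> carrier G" "v \<in> graded h" "v \<noteq> 0\<^sub>v d"
proof -
  have "\<exists>h\<in>carrier G. dual h \<noteq> 0\<^sub>m d d"
  proof (rule ccontr)
    assume "\<not> ?thesis"
    then have z: "\<And>h. h \<in> carrier G \<Longrightarrow> dual h = 0\<^sub>m d d" by blast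
    have "\<rho> x = 0\<^sub>m d d" if "x \<in> carrier D" for x
      using finite_group that
    proof (induction x rule: qd_induct)
      case (basis g h)
      then show ?case using grp_closed[of g] by (simp add: rho_mult grp_in dual_in z)
    qed (simp_all add: rho_smult rho_add)
    from this[OF grp_in[of \<one>]] have "1\<^sub>m d = (0\<^sub>m d d :: complex mat)" by (simp add: grp_one)
    then have "(1\<^sub>m d :: complex mat) $$ (0, 0) = 0\<^sub>m d d $$ (0, 0)" by simp
    then show False using assms by simp
  qed
  then obtain h where h: "h \<in> carrier G" "dual h \<noteq> 0\<^sub>m d d" by blast
  obtain v where v: "v \<in> carrier_vec d" "dual h *\<^sub>v v \<noteq> 0\<^sub>m d d *\<^sub>v v"
    using mat_eq_by_vec[of "dual h" d d "0\<^sub>m d d"] h dual_closed by auto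
  show thesis
  proof (rule that)
    show "dual h *\<^sub>v v \<in> graded h" using h v by (simp add: dual_image_graded)
    show "dual h *\<^sub>v v \<noteq> 0\<^sub>v d" using v by (simp add: zero_mat_mult_vec)
  qed (fact h)
qed

end

subsection \<open>Intertwiners\<close>

text \<open>The elements on which the intertwining relation holds form a subalgebra, and \<open>D(G)\<close> is generated
  by \<open>\<sigma>\<close>, \<open>\<tau>\<close> and the dual elements.\<close>

lemma (in dihedral) intertwines_if_generators:
  assumes rep: "qd_rep G d \<rho>" and rep': "qd_rep G d' \<rho>'" and F: "F \<in> carrier_mat d d'"
    and sig: "\<rho> (qd_grp G \<sigma>) * F = F * \<rho>' (qd_grp G \<sigma>)"
    and tau: "\<rho> (qd_grp G \<tau>) * F = F * \<rho>' (qd_grp G \<tau>)"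
    and dual: "\<And>h. h \<in> carrier G \<Longrightarrow> \<rho> (qd_dual G h) * F = F * \<rho>' (qd_dual G h)"
    and x: "x \<in> carrier (quantum_double G)"
  shows "\<rho> x * F = F * \<rho>' x"
proof -
  interpret A: qd_module G d \<rho> by unfold_locales (fact finite_carrier rep)+
  interpret B: qd_module G d' \<rho>' by unfold_locales (fact finite_carrier rep')+
  have mult: "\<rho> (x \<otimes>\<^bsub>A.D\<^esub> y) * F = F * \<rho>' (x \<otimes>\<^bsub>A.D\<^esub> y)"
    if "\<rho> x * F = F * \<rho>' x" "\<rho> y * F = F * \<rho>' y" "x \<in> carrier A.D" "y \<in> carrier A.D" for x y
  proof -
    note c = A.rho_closed[OF that(3)] A.rho_closed[OF that(4)] B.rho_closed[OF that(3)]
      B.rho_closed[OF that(4)]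
    have "\<rho> (x \<otimes>\<^bsub>A.D\<^esub> y) * F = \<rho> x * (\<rho> y * F)"
      using c F that by (simp add: A.rho_mult)
    also have "\<dots> = (\<rho> x * F) * \<rho>' y"
      unfolding that(2) using c F by simp
    also have "\<dots> = F * \<rho>' (x \<otimes>\<^bsub>A.D\<^esub> y)"
      unfolding that(1) using c F that by (simp add: B.rho_mult)
    finally show ?thesis .
  qed
  have grp: "\<rho> (qd_grp G g) * F = F * \<rho>' (qd_grp G g)" if "g \<in> carrier G" for g
    using that
  proof (induction g rule: dihedral_induct)
    case one
    then show ?case using F by (simp add: A.grp_one B.grp_one)
  next
    case (sigma g)
    then show ?case using mult[OF sig sigma(2)] sigma_closed
      by (simp add: A.grp_in qd_grp_mult[OF finite_carrier])
  next
    case (tau g)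
    then show ?case using mult[OF assms(5) tau(2)] tau_closed
      by (simp add: A.grp_in qd_grp_mult[OF finite_carrier])
  qed
  show ?thesis using finite_carrier x
  proof (induction x rule: qd_induct)
    case (basis g h)
    then show ?case by (intro mult grp dual A.grp_in A.dual_in)
  next
    case (smult c x)
    then show ?case using F A.rho_closed[of x] B.rho_closed[of x]
      by (simp add: A.rho_smult B.rho_smult mult_smult_assoc_mat[of _ d d] mult_smult_distrib[of _ d d'])
  next
    case (add x y)
    then show ?case using F A.rho_closed[of x] B.rho_closed[of x] A.rho_closed[of y] B.rho_closed[of y]
      by (simp add: A.rho_add B.rho_add add_mult_distrib_mat[of _ d d] mult_add_distrib_mat[of _ d d'])
  qed
qed

text \<open>Schur's lemma: the image and the kernel of an intertwiner are invariant, so a nonzero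
  intertwiner between irreducible representations is bijective. A two-sided inverse is assembled
  from preimages of the unit vectors, and its existence forces the dimensions to agree.\<close>

lemma (in group) isomorphic_if_nonzero_intertwiner:
  assumes fin: "finite (carrier G)"
    and irr: "qd_irreducible G d \<rho>" and irr': "qd_irreducible G d' \<rho>'"
    and F: "F \<in> carrier_mat d d'" and nz: "F \<noteq> 0\<^sub>m d d'"
    and int: "\<And>x. x \<in> carrier (quantum_double G) \<Longrightarrow> \<rho> x * F = F * \<rho>' x"
  shows "qd_isomorphic G d \<rho> d' \<rho>'"
proof -
  interpret A: qd_module G d \<rho> by unfold_locales (use fin irr in \<open>simp_all add: qd_irreducible_def\<close>)
  interpret B: qd_module G d' \<rho>' by unfold_locales (use fin irr' in \<open>simp_all add: qd_irreducible_def\<close>)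
  have Fu: "F *\<^sub>v u \<in> carrier_vec d" if "u \<in> carrier_vec d'" for u using F that by simp
  have Fx: "\<rho> x *\<^sub>v (F *\<^sub>v u) = F *\<^sub>v (\<rho>' x *\<^sub>v u)"
    if "x \<in> carrier A.D" "u \<in> carrier_vec d'" for x u
    using int[OF that(1)] that F A.rho_closed[of x] B.rho_closed[of x]
    by (simp flip: assoc_mult_mat_vec)
  have Fz: "F *\<^sub>v 0\<^sub>v d' = 0\<^sub>v d" using F by (auto simp: scalar_prod_def)
  obtain u0 where u0: "u0 \<in> carrier_vec d'" "F *\<^sub>v u0 \<noteq> 0\<^sub>v d"
    using mat_eq_by_vec[OF F zero_carrier_mat] nz zero_mat_mult_vec by metis
  let ?I = "{F *\<^sub>v u | u. u \<in> carrier_vec d'}"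
  have "VectorSpace.subspace class_ring ?I (module_vec TYPE(complex) d)"
    unfolding vec_subspace_iff
  proof (intro conjI ballI allI)
    show "0\<^sub>v d \<in> ?I" using Fz[symmetric] zero_carrier_vec by blast
    fix v w assume "v \<in> ?I" "w \<in> ?I"
    then obtain a b where "v = F *\<^sub>v a" "w = F *\<^sub>v b" "a \<in> carrier_vec d'" "b \<in> carrier_vec d'" by auto
    then have "v + w = F *\<^sub>v (a + b)" "a + b \<in> carrier_vec d'"
      using F by (simp_all add: mult_add_distrib_mat_vec)
    then show "v + w \<in> ?I" by blast
  next
    fix c v assume "v \<in> ?I"
    then obtain a where "v = F *\<^sub>v a" "a \<in> carrier_vec d'" by auto
    then have "c \<cdot>\<^sub>v v = F *\<^sub>v (c \<cdot>\<^sub>v a)" "c \<cdot>\<^sub>v a \<in> carrier_vec d'"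
      using F by (simp_all add: mult_mat_vec)
    then show "c \<cdot>\<^sub>v v \<in> ?I" by blast
  qed (use Fu in auto)
  moreover have "\<rho> x *\<^sub>v w \<in> ?I" if "x \<in> carrier A.D" "w \<in> ?I" for x w
    using that Fx mult_mat_vec_carrier[OF B.rho_closed] by blast
  moreover have "?I \<noteq> {0\<^sub>v d}" using u0 by blast
  ultimately have I: "?I = carrier_vec d" using irr unfolding qd_irreducible_def by blast
  let ?K = "{u \<in> carrier_vec d'. F *\<^sub>v u = 0\<^sub>v d}"
  have "VectorSpace.subspace class_ring ?K (module_vec TYPE(complex) d')"
    unfolding vec_subspace_iff
    using F Fz by (auto simp: mult_add_distrib_mat_vec[of _ d d'] mult_mat_vec[of _ d d'])
  moreover have "\<rho>' x *\<^sub>v u \<in> ?K" if "x \<in> carrier A.D" "u \<in> ?K" for x u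
  proof -
    have "\<rho> x *\<^sub>v 0\<^sub>v d = 0\<^sub>v d" using A.rho_closed[OF that(1)] by (auto simp: scalar_prod_def)
    then show ?thesis using that Fx[of x u, symmetric] mult_mat_vec_carrier[OF B.rho_closed] by auto
  qed
  moreover have "?K \<noteq> carrier_vec d'" using u0 by blast
  ultimately have K: "?K = {0\<^sub>v d'}" using irr' unfolding qd_irreducible_def by blast
  have "\<forall>i. \<exists>q. q \<in> carrier_vec d' \<and> F *\<^sub>v q = unit_vec d i"
    using I unit_vec_carrier by (smt (verit, best) mem_Collect_eq)
  then obtain q where q: "\<And>i. q i \<in> carrier_vec d'" "\<And>i. F *\<^sub>v q i = unit_vec d i" by metis
  define Q where "Q = mat d' d (\<lambda>(a, i). q i $ a)"
  have Q: "Q \<in> carrier_mat d' d" by (simp add: Q_def)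
  have colQ: "col Q i = q i" if "i < d" for i
    using that q(1)[of i] by (intro eq_vecI) (auto simp: Q_def)
  have FQ: "F * Q = 1\<^sub>m d"
  proof (rule eq_matI)
    fix i j assume "i < dim_row (1\<^sub>m d :: complex mat)" "j < dim_col (1\<^sub>m d :: complex mat)"
    then have ij: "i < d" "j < d" by auto
    have "(F * Q) $$ (i, j) = (F *\<^sub>v q j) $ i" using ij F Q colQ by simp
    then show "(F * Q) $$ (i, j) = 1\<^sub>m d $$ (i, j)" using ij by (simp add: q(2))
  qed (use F Q in auto)
  have QF: "Q * F = 1\<^sub>m d'"
  proof (rule mat_eq_by_vec[of _ d' d'])
    fix v :: "complex vec" assume v: "v \<in> carrier_vec d'"
    have c: "Q *\<^sub>v (F *\<^sub>v v) \<in> carrier_vec d'" using Q F v by simp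
    have "F *\<^sub>v (Q *\<^sub>v (F *\<^sub>v v)) = (F * Q) *\<^sub>v (F *\<^sub>v v)"
      using F Q v by (simp add: assoc_mult_mat_vec[of _ d d' _ d])
    then have "F *\<^sub>v (Q *\<^sub>v (F *\<^sub>v v)) = F *\<^sub>v v" using Fu[OF v] by (simp add: FQ)
    then have "F *\<^sub>v (Q *\<^sub>v (F *\<^sub>v v) - v) = 0\<^sub>v d"
      using F c v Fu[OF v] by (simp add: mult_minus_distrib_mat_vec[of _ d d'])
    then have "Q *\<^sub>v (F *\<^sub>v v) - v \<in> ?K" using c v by simp
    then have z: "Q *\<^sub>v (F *\<^sub>v v) - v = 0\<^sub>v d'" using K by blast
    have "Q *\<^sub>v (F *\<^sub>v v) = v"
    proof (rule eq_vecI)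
      fix i assume i: "i < dim_vec v"
      then have "(Q *\<^sub>v (F *\<^sub>v v) - v) $ i = 0" using z v by simp
      then show "(Q *\<^sub>v (F *\<^sub>v v)) $ i = v $ i" using i by simp
    qed (use c v Q in auto)
    then show "(Q * F) *\<^sub>v v = 1\<^sub>m d' *\<^sub>v v"
      using F Q v by (simp add: assoc_mult_mat_vec[of _ d' d _ d'])
  qed (use F Q in auto)
  have dd: "d = d'" using two_sided_inverse_square[OF F Q FQ QF] .
  have "Q * \<rho> x = \<rho>' x * Q" if x: "x \<in> carrier A.D" for x
  proof -
    note c = A.rho_closed[OF x] B.rho_closed[OF x]
    have "Q * \<rho> x = Q * (\<rho> x * (F * Q))" unfolding FQ using c Q by simp
    also have "\<dots> = Q * (\<rho> x * F) * Q"
      using c F Q by (simp add: assoc_mult_mat[of _ d d _ d' _ d] assoc_mult_mat[of _ d' d _ d' _ d])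
    also have "\<dots> = (Q * F) * \<rho>' x * Q"
      unfolding int[OF x] using c F Q dd by simp
    finally show ?thesis using c QF by simp
  qed
  moreover have "invertible_mat Q"
    using F Q FQ QF dd by (auto simp: invertible_mat_def inverts_mat_def)
  ultimately show ?thesis unfolding qd_isomorphic_def using dd Q by auto
qed

text \<open>If the coordinate projections lie in the image of the algebra, an invariant subspace
  containing a vector with a nonzero coordinate contains the corresponding unit vector;
  transitivity then carries this unit vector to all the others.\<close>

lemma (in group) irreducible_if_projections_transitive:
  assumes fin: "finite (carrier G)" and rep: "qd_rep G d \<rho>" and d: "d > 0"
    and proj: "\<And>b. b < d \<Longrightarrow> \<exists>x\<in>carrier (quantum_double G).
      \<forall>v\<in>carrier_vec d. \<rho> x *\<^sub>v v = v $ b \<cdot>\<^sub>v unit_vec d b"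
    and trans: "\<And>a b. a < d \<Longrightarrow> b < d \<Longrightarrow> \<exists>x\<in>carrier (quantum_double G). \<exists>c. c \<noteq> 0 \<and>
      \<rho> x *\<^sub>v unit_vec d b = c \<cdot>\<^sub>v unit_vec d a"
  shows "qd_irreducible G d \<rho>"
  unfolding qd_irreducible_def
proof (intro conjI allI impI)
  fix W assume "VectorSpace.subspace class_ring W (module_vec TYPE(complex) d) \<and>
     (\<forall>x\<in>carrier (quantum_double G). \<forall>w\<in>W. \<rho> x *\<^sub>v w \<in> W)"
  then have W: "W \<subseteq> carrier_vec d" "0\<^sub>v d \<in> W" "\<And>v w. v \<in> W \<Longrightarrow> w \<in> W \<Longrightarrow> v + w \<in> W"
      "\<And>c v. v \<in> W \<Longrightarrow> c \<cdot>\<^sub>v v \<in> W"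
    and inv: "\<And>x w. x \<in> carrier (quantum_double G) \<Longrightarrow> w \<in> W \<Longrightarrow> \<rho> x *\<^sub>v w \<in> W"
    unfolding vec_subspace_iff by blast+
  have cancel: "v \<in> W" if "c \<cdot>\<^sub>v v \<in> W" "c \<noteq> 0" for c v
    using W(4)[OF that(1), of "inverse c"] that(2) by (simp add: smult_smult_assoc)
  show "W = {0\<^sub>v d} \<or> W = carrier_vec d"
  proof (cases "W = {0\<^sub>v d}")
    case False
    then obtain w where w: "w \<in> W" "w \<noteq> 0\<^sub>v d" using W(2) by blast
    then have wc: "w \<in> carrier_vec d" using W(1) by blast
    have "\<exists>b<d. w $ b \<noteq> 0"
    proof (rule ccontr)
      assume "\<not> ?thesis"
      then have "w = 0\<^sub>v d" using wc by (intro eq_vecI) auto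
      then show False using w(2) by simp
    qed
    then obtain b where b: "b < d" "w $ b \<noteq> 0" by blast
    obtain x where x: "x \<in> carrier (quantum_double G)" "\<rho> x *\<^sub>v w = w $ b \<cdot>\<^sub>v unit_vec d b"
      using proj[OF b(1)] wc by blast
    have eb: "unit_vec d b \<in> W" using inv[OF x(1) w(1)] x(2) cancel b(2) by metis
    have ea: "unit_vec d a \<in> W" if a: "a < d" for a
    proof -
      obtain x c where "x \<in> carrier (quantum_double G)" "c \<noteq> 0"
        "\<rho> x *\<^sub>v unit_vec d b = c \<cdot>\<^sub>v unit_vec d a"
        using trans[OF a b(1)] by blast
      then show ?thesis using inv[OF _ eb] cancel by metis
    qed
    have "v \<in> W" if v: "v \<in> carrier_vec d" for v
    proof -
      have "vec d (\<lambda>i. if i < m then v $ i else 0) \<in> W" if "m \<le> d" for m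
        using that
      proof (induction m)
        case 0
        have "vec d (\<lambda>i. if i < 0 then v $ i else 0) = 0\<^sub>v d" by auto
        then show ?case using W(2) by simp
      next
        case (Suc m)
        have "vec d (\<lambda>i. if i < Suc m then v $ i else 0)
            = vec d (\<lambda>i. if i < m then v $ i else 0) + v $ m \<cdot>\<^sub>v unit_vec d m"
          using Suc.prems by (intro eq_vecI) (auto simp: less_Suc_eq)
        then show ?case using Suc W(3,4) ea[of m] by simp
      qed
      from this[of d] show ?thesis using v by (auto simp: vec_eq_iff elim!: back_subst[of "\<lambda>v. v \<in> W"])
    qed
    then show ?thesis using W(1) by blast
  qed simp
qed (use rep d in auto)

text \<open>Isomorphic representations satisfy the same linear relations. Relations between two
  elements suffice to tell the listed representations apart.\<close>

lemma (in group) isomorphic_transfers_relation: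
  assumes fin: "finite (carrier G)" and rep: "qd_rep G d \<rho>" and rep': "qd_rep G d' \<rho>'"
    and iso: "qd_isomorphic G d \<rho> d' \<rho>'"
    and x: "x \<in> carrier (quantum_double G)" and y: "y \<in> carrier (quantum_double G)"
    and rel: "\<rho> x = c \<cdot>\<^sub>m \<rho> y"
  shows "\<rho>' x = c \<cdot>\<^sub>m \<rho>' y"
proof -
  interpret A: qd_module G d \<rho> by unfold_locales (fact fin rep)+
  interpret B: qd_module G d' \<rho>' by unfold_locales (fact fin rep')+
  obtain P where d: "d' = d" and P: "P \<in> carrier_mat d d" "invertible_mat P"
    and int: "\<And>x. x \<in> carrier (quantum_double G) \<Longrightarrow> P * \<rho> x = \<rho>' x * P"
    using iso unfolding qd_isomorphic_def by auto
  obtain Q where PQ: "P * Q = 1\<^sub>m d" and QP: "Q * P = 1\<^sub>m (dim_row Q)"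
    using P unfolding invertible_mat_def inverts_mat_def by auto
  have "dim_col (P * Q) = d" "dim_col (Q * P) = dim_row Q" unfolding PQ QP by simp_all
  then have Q: "Q \<in> carrier_mat d d" using P by auto
  note c = A.rho_closed[OF x] B.rho_closed[OF x] A.rho_closed[OF y] B.rho_closed[OF y]
  have conj: "\<rho>' z = P * \<rho> z * Q" if z: "z \<in> carrier (quantum_double G)" for z
    unfolding int[OF z] using B.rho_closed[OF z] P Q PQ d by simp
  show ?thesis
    unfolding conj[OF x] conj[OF y] rel
    using c P Q by (simp add: mult_smult_assoc_mat[of _ d d] mult_smult_distrib[of _ d d])
qed

section \<open>Monomial matrices\<close>

text \<open>The matrix sending the \<open>b\<close>-th unit vector to \<open>c b\<close> times the unit vector with index \<open>\<pi> b\<close>, indices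
  starting from 0. In each listed representation \<open>\<sigma>\<close>, \<open>\<tau>\<close> and all dual elements act by such
  matrices, which allows a uniform treatment.\<close>

definition monomial_mat :: "nat \<Rightarrow> (nat \<Rightarrow> nat) \<Rightarrow> (nat \<Rightarrow> complex) \<Rightarrow> complex mat" where
  "monomial_mat d \<pi> c = mat d d (\<lambda>(a, b). if a = \<pi> b then c b else 0)"

lemma monomial_mat_closed: "monomial_mat d \<pi> c \<in> carrier_mat d d"
  by (simp add: monomial_mat_def)

lemma monomial_mat_dim: "dim_row (monomial_mat d \<pi> c) = d" "dim_col (monomial_mat d \<pi> c) = d"
  by (simp_all add: monomial_mat_def)

lemma monomial_mat_index:
  "a < d \<Longrightarrow> b < d \<Longrightarrow> monomial_mat d \<pi> c $$ (a, b) = (if a = \<pi> b then c b else 0)"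
  by (simp add: monomial_mat_def)

lemma monomial_mat_cong:
  "(\<And>b. b < d \<Longrightarrow> \<pi> b = \<pi>' b) \<Longrightarrow> (\<And>b. b < d \<Longrightarrow> c b = c' b) \<Longrightarrow>
   monomial_mat d \<pi> c = monomial_mat d \<pi>' c'"
  by (rule eq_matI) (auto simp: monomial_mat_def)

lemma monomial_mat_one: "monomial_mat d (\<lambda>b. b) (\<lambda>_. 1) = 1\<^sub>m d"
  by (rule eq_matI) (auto simp: monomial_mat_def)

lemma mat_mult_monomial:
  assumes M: "M \<in> carrier_mat m d" and \<pi>: "\<forall>b<d. \<pi> b < d"
  shows "M * monomial_mat d \<pi> c = mat m d (\<lambda>(a, b). M $$ (a, \<pi> b) * c b)"
proof (rule eq_matI)
  fix a b assume "a < dim_row (mat m d (\<lambda>(a, b). M $$ (a, \<pi> b) * c b))"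
    "b < dim_col (mat m d (\<lambda>(a, b). M $$ (a, \<pi> b) * c b))"
  then have ab: "a < m" "b < d" by simp_all
  have "(M * monomial_mat d \<pi> c) $$ (a, b)
      = (\<Sum>i<d. M $$ (a, i) * monomial_mat d \<pi> c $$ (i, b))"
    using ab M by (simp add: scalar_prod_def monomial_mat_dim lessThan_atLeast0)
  also have "\<dots> = (\<Sum>i<d. if i = \<pi> b then M $$ (a, i) * c b else 0)"
    using ab by (intro sum.cong) (auto simp: monomial_mat_index)
  also have "\<dots> = M $$ (a, \<pi> b) * c b" using \<pi> ab(2) by simp
  finally show "(M * monomial_mat d \<pi> c) $$ (a, b) = mat m d (\<lambda>(a, b). M $$ (a, \<pi> b) * c b) $$ (a, b)"
    using ab by simp
qed (use M in \<open>simp_all add: monomial_mat_dim\<close>)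

lemma monomial_mat_mult:
  assumes "\<forall>b<d. \<pi>' b < d"
  shows "monomial_mat d \<pi> c * monomial_mat d \<pi>' c' = monomial_mat d (\<lambda>b. \<pi> (\<pi>' b)) (\<lambda>b. c (\<pi>' b) * c' b)"
  unfolding mat_mult_monomial[OF monomial_mat_closed assms]
  using assms by (intro eq_matI) (auto simp: monomial_mat_def)

lemma monomial_mat_pow:
  assumes "\<forall>b<d. \<pi> b < d"
  shows "monomial_mat d \<pi> c [^]\<^bsub>ring_mat TYPE(complex) d ()\<^esub> m
         = monomial_mat d (\<pi> ^^ m) (\<lambda>b. \<Prod>i<m. c ((\<pi> ^^ i) b))"
proof (induction m)
  case 0
  then show ?case by (simp add: ring_mat_simps monomial_mat_one id_def)
next
  case (Suc m)
  interpret semiring "ring_mat TYPE(complex) d ()" by (rule semiring_mat)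
  have "monomial_mat d \<pi> c [^]\<^bsub>ring_mat TYPE(complex) d ()\<^esub> Suc m
      = monomial_mat d (\<pi> ^^ m) (\<lambda>b. \<Prod>i<m. c ((\<pi> ^^ i) b)) * monomial_mat d \<pi> c"
    by (simp add: Suc ring_mat_simps)
  also have "\<dots> = monomial_mat d (\<pi> ^^ Suc m) (\<lambda>b. \<Prod>i<Suc m. c ((\<pi> ^^ i) b))"
    unfolding monomial_mat_mult[OF assms]
    by (intro monomial_mat_cong)
       (simp_all add: prod.lessThan_Suc_shift funpow_swap1 mult.commute del: prod.lessThan_Suc)
  finally show ?case .
qed


lemma monomial_mat_unit_vec:
  assumes "b < d" "\<pi> b < d"
  shows "monomial_mat d \<pi> c *\<^sub>v unit_vec d b = c b \<cdot>\<^sub>v unit_vec d (\<pi> b)"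
  using assms by (intro eq_vecI) (auto simp: monomial_mat_def scalar_prod_right_unit)

lemma diagonal_mat_mult_vec:
  assumes v: "v \<in> carrier_vec d"
  shows "monomial_mat d (\<lambda>b. b) c *\<^sub>v v = vec d (\<lambda>a. c a * v $ a)"
proof (rule eq_vecI)
  fix a assume "a < dim_vec (vec d (\<lambda>a. c a * v $ a))"
  then have a: "a < d" by simp
  have "(monomial_mat d (\<lambda>b. b) c *\<^sub>v v) $ a = (\<Sum>i<d. monomial_mat d (\<lambda>b. b) c $$ (a, i) * v $ i)"
    using a v by (simp add: monomial_mat_dim scalar_prod_def lessThan_atLeast0)
  also have "\<dots> = (\<Sum>i<d. if i = a then c i * v $ i else 0)"
    using a by (intro sum.cong) (auto simp: monomial_mat_index)
  finally have "(monomial_mat d (\<lambda>b. b) c *\<^sub>v v) $ a = (\<Sum>i<d. if i = a then c i * v $ i else 0)" .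
  then show "(monomial_mat d (\<lambda>b. b) c *\<^sub>v v) $ a = vec d (\<lambda>a. c a * v $ a) $ a"
    using a by simp
qed (simp add: monomial_mat_dim)

text \<open>An intertwiner out of a monomial representation is nothing but a family of vectors, its
  columns, which the acting matrix permutes up to the prescribed scalars.\<close>

lemma intertwines_monomial:
  fixes M :: "complex mat"
  assumes M: "M \<in> carrier_mat d d" and w: "\<And>b. b < m \<Longrightarrow> w b \<in> carrier_vec d"
    and \<pi>: "\<And>b. b < m \<Longrightarrow> \<pi> b < m"
    and eq: "\<And>b. b < m \<Longrightarrow> M *\<^sub>v w b = c b \<cdot>\<^sub>v w (\<pi> b)"
  shows "M * mat d m (\<lambda>(i, b). w b $ i) = mat d m (\<lambda>(i, b). w b $ i) * monomial_mat m \<pi> c"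
    (is "M * ?F = _")

proof -
  have F: "?F \<in> carrier_mat d m" by simp
  have \<pi>': "\<forall>b<m. \<pi> b < m" using \<pi> by blast
  show "M * ?F = ?F * monomial_mat m \<pi> c"
    unfolding mat_mult_monomial[OF F \<pi>']
  proof (rule eq_matI)
    fix i b assume "i < dim_row (mat d m (\<lambda>(a, b). ?F $$ (a, \<pi> b) * c b))"
      "b < dim_col (mat d m (\<lambda>(a, b). ?F $$ (a, \<pi> b) * c b))"
    then have ib: "i < d" "b < m" by simp_all
    have "col ?F b = w b" using ib w[of b] by (intro eq_vecI) auto
    then have "(M * ?F) $$ (i, b) = (M *\<^sub>v w b) $ i" using ib M by simp
    then show "(M * ?F) $$ (i, b) = mat d m (\<lambda>(a, b). ?F $$ (a, \<pi> b) * c b) $$ (i, b)"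
      using ib w[OF \<pi>[OF ib(2)]] \<pi>[OF ib(2)] by (simp add: eq[OF ib(2)])
  qed (use M in auto)
qed

section \<open>Graded representations of the group\<close>

text \<open>A matrix representation of \<open>G\<close> whose unit vectors carry degrees in \<open>G\<close> extends to \<open>D(G)\<close>: since \<open>h\<^sup>*\<close>
  is the projection to the unit vectors of degree \<open>h\<close>, only the coefficients of the elements
  \<open>g (deg b)\<^sup>*\<close> contribute to column \<open>b\<close>.\<close>

definition graded_rep ::
    "('a, 'm) monoid_scheme \<Rightarrow> nat \<Rightarrow> (nat \<Rightarrow> 'a) \<Rightarrow> ('a \<Rightarrow> complex mat) \<Rightarrow>
     ('a \<times> 'a \<Rightarrow> complex) \<Rightarrow> complex mat" where
  "graded_rep G d deg R x = mat d d (\<lambda>(a, b). \<Sum>g\<in>carrier G. x (g, deg b) * R g $$ (a, b))"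

locale graded_group_rep = group G for G (structure) +
  fixes d :: nat and deg :: "nat \<Rightarrow> 'a" and R :: "'a \<Rightarrow> complex mat"
  assumes finite_group: "finite (carrier G)"
    and deg_closed: "b < d \<Longrightarrow> deg b \<in> carrier G"
    and R_hom: "R \<in> hom G (ring_mat TYPE(complex) d ())"
    and R_one: "R \<one> = 1\<^sub>m d"
    and R_graded: "g \<in> carrier G \<Longrightarrow> a < d \<Longrightarrow> b < d \<Longrightarrow> R g $$ (a, b) \<noteq> 0 \<Longrightarrow>
      deg a = g \<otimes> deg b \<otimes> inv g"
begin

lemma R_closed: "g \<in> carrier G \<Longrightarrow> R g \<in> carrier_mat d d"
  using R_hom by (auto simp: hom_def ring_mat_simps)

lemma R_mult_index:
  assumes "g \<in> carrier G" "h \<in> carrier G" "a < d" "b < d"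
  shows "R (g \<otimes> h) $$ (a, b) = (\<Sum>i<d. R g $$ (a, i) * R h $$ (i, b))"
proof -
  have "R (g \<otimes> h) = R g * R h"
    using hom_mult[OF R_hom assms(1,2)] by (simp add: ring_mat_simps)
  then show ?thesis
    using assms R_closed[OF assms(1)] R_closed[OF assms(2)]
    by (simp add: scalar_prod_def lessThan_atLeast0)
qed

lemma graded_rep_grp:
  assumes g: "g \<in> carrier G"
  shows "graded_rep G d deg R (qd_grp G g) = R g"
proof (rule eq_matI)
  fix a b assume "a < dim_row (R g)" "b < dim_col (R g)"
  then have ab: "a < d" "b < d" using R_closed[OF g] by auto
  have "(\<Sum>u\<in>carrier G. qd_grp G g (u, deg b) * R u $$ (a, b))
      = (\<Sum>u\<in>carrier G. if u = g then R u $$ (a, b) else 0)"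
    using deg_closed[OF ab(2)] by (intro sum.cong) (auto simp: qd_grp_apply[OF finite_group])
  then show "graded_rep G d deg R (qd_grp G g) $$ (a, b) = R g $$ (a, b)"
    using ab g finite_group by (simp add: graded_rep_def)
qed (use R_closed[OF g] in \<open>auto simp: graded_rep_def\<close>)

lemma graded_rep_dual:
  assumes h: "h \<in> carrier G"
  shows "graded_rep G d deg R (qd_dual G h) = monomial_mat d (\<lambda>b. b) (\<lambda>b. if deg b = h then 1 else 0)"
proof (rule eq_matI)
  fix a b assume "a < dim_row (monomial_mat d (\<lambda>b. b) (\<lambda>b. if deg b = h then 1 else 0))"
    "b < dim_col (monomial_mat d (\<lambda>b. b) (\<lambda>b. if deg b = h then 1 else 0))"
  then have ab: "a < d" "b < d" by (simp_all add: monomial_mat_dim)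
  have "(\<Sum>u\<in>carrier G. qd_dual G h (u, deg b) * R u $$ (a, b))
      = (\<Sum>u\<in>carrier G. if u = \<one> then (if deg b = h then R u $$ (a, b) else 0) else 0)"
    by (intro sum.cong) (auto simp: qd_dual_def qd_basis_def)
  then show "graded_rep G d deg R (qd_dual G h) $$ (a, b)
      = monomial_mat d (\<lambda>b. b) (\<lambda>b. if deg b = h then 1 else 0) $$ (a, b)"
    using ab finite_group by (simp add: graded_rep_def monomial_mat_index R_one)
qed (auto simp: graded_rep_def monomial_mat_def)

text \<open>The product in \<open>D(G)\<close> is a convolution in which the second index is conjugated. A nonzero
  entry of the matrix of \<open>w\<close> links degrees conjugate under \<open>w\<close>, and so turns the conjugated index
  into the degree of the intermediate unit vector.\<close>

lemma graded_rep_mult: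
  "graded_rep G d deg R (x \<otimes>\<^bsub>quantum_double G\<^esub> y) = graded_rep G d deg R x * graded_rep G d deg R y"
proof (rule eq_matI)
  let ?C = "carrier G"
  fix a c assume "a < dim_row (graded_rep G d deg R x * graded_rep G d deg R y)"
    "c < dim_col (graded_rep G d deg R x * graded_rep G d deg R y)"
  then have ac: "a < d" "c < d" by (simp_all add: graded_rep_def)
  let ?v = "deg c"
  have v: "?v \<in> ?C" using ac deg_closed by simp
  \<comment> \<open>where \<open>R w\<close> does not vanish, the conjugate of the degree of \<open>c\<close> by \<open>w\<close> is the degree of \<open>i\<close>\<close>
  have support: "x (g, w \<otimes> ?v \<otimes> inv w) * R w $$ (i, c) = x (g, deg i) * R w $$ (i, c)"
    if "w \<in> ?C" "i < d" for g w i
    using R_graded[OF that ac(2)] by (cases "R w $$ (i, c) = 0") auto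
  have "graded_rep G d deg R (x \<otimes>\<^bsub>quantum_double G\<^esub> y) $$ (a, c)
      = (\<Sum>u\<in>?C. \<Sum>w\<in>?C. x (u \<otimes> inv w, w \<otimes> ?v \<otimes> inv w) * y (w, ?v) * R u $$ (a, c))"
    using ac by (simp add: graded_rep_def qd_mult_eq[OF finite_group _ v] sum_distrib_right)
  also have "\<dots> = (\<Sum>w\<in>?C. \<Sum>u\<in>?C. x (u \<otimes> inv w, w \<otimes> ?v \<otimes> inv w) * y (w, ?v) * R u $$ (a, c))"
    by (rule sum.swap)
  also have "\<dots> = (\<Sum>w\<in>?C. \<Sum>g\<in>?C. x (g, w \<otimes> ?v \<otimes> inv w) * y (w, ?v) * R (g \<otimes> w) $$ (a, c))"
  proof (rule sum.cong[OF refl])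
    fix w assume w: "w \<in> ?C"
    show "(\<Sum>u\<in>?C. x (u \<otimes> inv w, w \<otimes> ?v \<otimes> inv w) * y (w, ?v) * R u $$ (a, c))
        = (\<Sum>g\<in>?C. x (g, w \<otimes> ?v \<otimes> inv w) * y (w, ?v) * R (g \<otimes> w) $$ (a, c))"
      by (rule sum.reindex_bij_witness[where j = "\<lambda>u. u \<otimes> inv w" and i = "\<lambda>g. g \<otimes> w"])
         (use w in \<open>auto simp: m_assoc\<close>)
  qed
  also have "\<dots> = (\<Sum>w\<in>?C. \<Sum>g\<in>?C. \<Sum>i<d. x (g, deg i) * R g $$ (a, i) * (y (w, ?v) * R w $$ (i, c)))"
  proof (intro sum.cong refl)
    fix w g assume wg: "w \<in> ?C" "g \<in> ?C"
    have "x (g, w \<otimes> ?v \<otimes> inv w) * y (w, ?v) * R (g \<otimes> w) $$ (a, c)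
        = (\<Sum>i<d. (x (g, w \<otimes> ?v \<otimes> inv w) * R w $$ (i, c)) * (R g $$ (a, i) * y (w, ?v)))"
      using wg ac by (simp add: R_mult_index sum_distrib_left mult_ac)
    also have "\<dots> = (\<Sum>i<d. x (g, deg i) * R g $$ (a, i) * (y (w, ?v) * R w $$ (i, c)))"
      using support[OF wg(1)] by (intro sum.cong) (simp_all add: mult_ac)
    finally show "x (g, w \<otimes> ?v \<otimes> inv w) * y (w, ?v) * R (g \<otimes> w) $$ (a, c)
        = (\<Sum>i<d. x (g, deg i) * R g $$ (a, i) * (y (w, ?v) * R w $$ (i, c)))" .
  qed
  also have "\<dots> = (\<Sum>w\<in>?C. \<Sum>i<d. \<Sum>g\<in>?C. x (g, deg i) * R g $$ (a, i) * (y (w, ?v) * R w $$ (i, c)))"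
    by (intro sum.cong refl sum.swap)
  also have "\<dots> = (\<Sum>i<d. \<Sum>w\<in>?C. \<Sum>g\<in>?C. x (g, deg i) * R g $$ (a, i) * (y (w, ?v) * R w $$ (i, c)))"
    by (rule sum.swap)
  also have "\<dots> = (\<Sum>i<d. (\<Sum>g\<in>?C. x (g, deg i) * R g $$ (a, i)) * (\<Sum>w\<in>?C. y (w, ?v) * R w $$ (i, c)))"
    by (simp add: sum_distrib_left sum_distrib_right)
  also have "\<dots> = (graded_rep G d deg R x * graded_rep G d deg R y) $$ (a, c)"
    using ac by (simp add: graded_rep_def scalar_prod_def lessThan_atLeast0)
  finally show "graded_rep G d deg R (x \<otimes>\<^bsub>quantum_double G\<^esub> y) $$ (a, c)
      = (graded_rep G d deg R x * graded_rep G d deg R y) $$ (a, c)" .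
qed (simp_all add: graded_rep_def)

lemma graded_rep_is_rep: "qd_rep G d (graded_rep G d deg R)"
  unfolding qd_rep_def
proof (intro conjI ballI allI ring_hom_memI)
  show "graded_rep G d deg R \<one>\<^bsub>quantum_double G\<^esub> = \<one>\<^bsub>ring_mat TYPE(complex) d ()\<^esub>"
    by (simp add: qd_one_eq graded_rep_grp R_one ring_mat_simps)
  show "graded_rep G d deg R (c \<odot>\<^bsub>quantum_double G\<^esub> x) = c \<cdot>\<^sub>m graded_rep G d deg R x" for c x
    by (rule eq_matI) (auto simp: graded_rep_def quantum_double_simps sum_distrib_left mult.assoc)
  show "graded_rep G d deg R (x \<oplus>\<^bsub>quantum_double G\<^esub> y)
      = graded_rep G d deg R x \<oplus>\<^bsub>ring_mat TYPE(complex) d ()\<^esub> graded_rep G d deg R y" for x y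
    unfolding ring_mat_simps
    by (rule eq_matI) (auto simp: graded_rep_def quantum_double_simps sum.distrib algebra_simps)
qed (simp_all add: ring_mat_simps graded_rep_mult, simp add: graded_rep_def)

end

text \<open>The permutations and scalars need only satisfy the defining relations of the dihedral group,
  and the degrees need only be compatible with the two generators; both properties then extend to
  the whole group.\<close>

lemma (in dihedral) exists_monomial_rep:
  assumes \<pi>: "\<And>b. b < d \<Longrightarrow> \<pi> b < d" "\<And>b. b < d \<Longrightarrow> \<pi>' b < d"
    and s_pow: "\<And>b. b < d \<Longrightarrow> (\<pi> ^^ n) b = b" "\<And>b. b < d \<Longrightarrow> (\<Prod>i<n. c ((\<pi> ^^ i) b)) = 1"
    and t_t: "\<And>b. b < d \<Longrightarrow> \<pi>' (\<pi>' b) = b" "\<And>b. b < d \<Longrightarrow> c' (\<pi>' b) * c' b = 1"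
    and s_t_s: "\<And>b. b < d \<Longrightarrow> \<pi> (\<pi>' (\<pi> b)) = \<pi>' b"
      "\<And>b. b < d \<Longrightarrow> c (\<pi>' (\<pi> b)) * c' (\<pi> b) * c b = c' b"
    and deg: "\<And>b. b < d \<Longrightarrow> deg b \<in> carrier G"
    and deg_s: "\<And>b. b < d \<Longrightarrow> deg (\<pi> b) = \<sigma> \<otimes> deg b \<otimes> inv \<sigma>"
    and deg_t: "\<And>b. b < d \<Longrightarrow> deg (\<pi>' b) = \<tau> \<otimes> deg b \<otimes> inv \<tau>"
  shows "\<exists>\<rho>. qd_rep G d \<rho> \<and> \<rho> (qd_grp G \<sigma>) = monomial_mat d \<pi> c \<and>
    \<rho> (qd_grp G \<tau>) = monomial_mat d \<pi>' c' \<and>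
    (\<forall>h\<in>carrier G. \<rho> (qd_dual G h) = monomial_mat d (\<lambda>b. b) (\<lambda>b. if deg b = h then 1 else 0))"
proof -
  let ?M = "ring_mat TYPE(complex) d ()"
  let ?S = "monomial_mat d \<pi> c" and ?T = "monomial_mat d \<pi>' c'"
  interpret M: semiring ?M by (rule semiring_mat)
  have \<pi>s: "\<forall>b<d. \<pi> b < d" "\<forall>b<d. \<pi>' b < d" using \<pi> by blast+
  have "dihedral_pair ?M n ?S ?T"
  proof unfold_locales
    show "?S \<in> carrier ?M" "?T \<in> carrier ?M" by (simp_all add: ring_mat_simps monomial_mat_closed)
    show "?S [^]\<^bsub>?M\<^esub> n = \<one>\<^bsub>?M\<^esub>"
      unfolding monomial_mat_pow[OF \<pi>s(1)] ring_mat_simps monomial_mat_one[symmetric]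
      by (intro monomial_mat_cong s_pow)
    show "?T \<otimes>\<^bsub>?M\<^esub> ?T = \<one>\<^bsub>?M\<^esub>"
      unfolding ring_mat_simps monomial_mat_one[symmetric] monomial_mat_mult[OF \<pi>s(2)]
      by (intro monomial_mat_cong t_t)
    show "?S \<otimes>\<^bsub>?M\<^esub> ?T \<otimes>\<^bsub>?M\<^esub> ?S = ?T"
      unfolding ring_mat_simps monomial_mat_mult[OF \<pi>s(2)] monomial_mat_mult[OF \<pi>s(1)]
      by (intro monomial_mat_cong s_t_s)
  qed (rule n_pos)
  then obtain R where R: "R \<in> hom G ?M" "R \<one> = \<one>\<^bsub>?M\<^esub>" "R \<sigma> = ?S" "R \<tau> = ?T"
    by (rule universal_property)
  have Rc: "R g \<in> carrier_mat d d" if "g \<in> carrier G" for g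
    using R(1) that by (auto simp: hom_def ring_mat_simps)
  have step: "deg a = (s \<otimes> g) \<otimes> deg b \<otimes> inv (s \<otimes> g)"
    if s: "s \<in> carrier G" "R s = monomial_mat d p k" "\<And>b. b < d \<Longrightarrow> deg (p b) = s \<otimes> deg b \<otimes> inv s"
      and g: "g \<in> carrier G" "\<And>a b. a < d \<Longrightarrow> b < d \<Longrightarrow> R g $$ (a, b) \<noteq> 0 \<Longrightarrow> deg a = g \<otimes> deg b \<otimes> inv g"
      and ab: "a < d" "b < d" "R (s \<otimes> g) $$ (a, b) \<noteq> 0" for s p k g a b
  proof -
    have "R (s \<otimes> g) = R s * R g" using hom_mult[OF R(1) s(1) g(1)] by (simp add: ring_mat_simps)
    then have "R (s \<otimes> g) $$ (a, b) = (\<Sum>i<d. R s $$ (a, i) * R g $$ (i, b))"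
      using ab Rc[OF s(1)] Rc[OF g(1)] by (simp add: scalar_prod_def lessThan_atLeast0)
    then obtain i where i: "i < d" "R s $$ (a, i) * R g $$ (i, b) \<noteq> 0"
      using ab(3) by (metis (no_types, lifting) lessThan_iff sum.neutral)
    then have "a = p i" "R g $$ (i, b) \<noteq> 0"
      using ab i by (auto simp: s(2) monomial_mat_index split: if_splits)
    then have "deg a = s \<otimes> (g \<otimes> deg b \<otimes> inv g) \<otimes> inv s" using s(3)[OF i(1)] g(2)[OF i(1) ab(2)] by simp
    then show ?thesis using s(1) g(1) deg[OF ab(2)] by (simp add: inv_mult_group m_assoc)
  qed
  have graded: "deg a = g \<otimes> deg b \<otimes> inv g"
    if "g \<in> carrier G" "a < d" "b < d" "R g $$ (a, b) \<noteq> 0" for g a b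
    using that
  proof (induction g arbitrary: a b rule: dihedral_induct)
    case one
    then show ?case using deg by (auto simp: R(2) ring_mat_simps split: if_splits)
  next
    case (sigma g)
    show ?case by (rule step[OF sigma_closed R(3) deg_s sigma(1)]) (use sigma in auto)
  next
    case (tau g)
    show ?case by (rule step[OF tau_closed R(4) deg_t tau(1)]) (use tau in auto)
  qed
  interpret gr: graded_group_rep G d deg R
    by unfold_locales (use finite_carrier deg R graded in \<open>auto simp: ring_mat_simps\<close>)
  show ?thesis
    using gr.graded_rep_is_rep gr.graded_rep_grp gr.graded_rep_dual R sigma_closed tau_closed by metis
qed

section \<open>Roots of unity and eigenvectors\<close>

lemma omega_nonzero: "omega n \<noteq> 0"
  by (simp add: omega_def)

lemma omega_power: "omega n ^ k = cis (2 * pi * real k / real n)"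
proof -
  have "omega n = cis (2 * pi / real n)"
    unfolding omega_def cis_conv_exp by (rule arg_cong[where f = exp]) simp
  then show ?thesis by (simp add: DeMoivre mult_ac)
qed

lemma omega_power_eq_one: "n > 0 \<Longrightarrow> omega n ^ n = 1"
  by (simp add: omega_power)

lemma omega_powi_mod:
  assumes "n > 0"
  shows "omega n powi i = omega n ^ nat (i mod int n)"
proof -
  have "omega n powi i = omega n powi (int n * (i div int n) + i mod int n)" by simp
  also have "\<dots> = omega n powi (int n * (i div int n)) * omega n powi (i mod int n)"
    by (rule power_int_add) (simp add: omega_nonzero)
  also have "omega n powi (int n * (i div int n)) = (omega n powi int n) powi (i div int n)"
    by (rule power_int_mult)
  also have "omega n powi int n = 1" using assms by (simp add: omega_power_eq_one)
  finally show ?thesis using assms by (simp add: power_int_def)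
qed

lemma omega_powi_eq_iff:
  assumes n: "n > 0"
  shows "omega n powi i = omega n powi j \<longleftrightarrow> int n dvd i - j"
proof -
  have inj: "inj_on (\<lambda>k. cis (2 * pi * real k / real n)) {..<n}"
    using bij_betw_roots_unity[OF n] by (rule bij_betw_imp_inj_on)
  have "omega n powi i = omega n powi j \<longleftrightarrow> nat (i mod int n) = nat (j mod int n)"
    unfolding omega_powi_mod[OF n] omega_power
    using inj_on_eq_iff[OF inj, of "nat (i mod int n)" "nat (j mod int n)"] n by (simp add: nat_less_iff)
  also have "\<dots> \<longleftrightarrow> int n dvd i - j"
    using n by (simp add: nat_eq_iff mod_eq_dvd_iff)
  finally show ?thesis .
qed

lemma sum_omega_powers:
  assumes "m < n" "m > 0"
  shows "(\<Sum>j<n. omega n powi (- (int j * int m))) = 0"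
proof -
  let ?z = "omega n powi (- int m)"
  have n: "n > 0" using assms by simp
  have "?z \<noteq> omega n powi 0"
    unfolding omega_powi_eq_iff[OF n] using assms zdvd_imp_le[of "int n" "int m"] by auto
  then have z: "?z \<noteq> 1" by simp
  have "?z ^ n = (omega n powi int n) powi (- int m)"
    by (simp only: power_int_power power_int_mult[symmetric] power_int_of_nat[symmetric] mult.commute)
  then have "?z ^ n = 1" using n by (simp add: omega_power_eq_one)
  moreover have "omega n powi (- (int j * int m)) = ?z ^ j" for j
    by (simp only: power_int_of_nat[symmetric] power_int_mult[symmetric]) (simp add: mult.commute)
  ultimately show ?thesis using z by (simp add: geometric_sum)
qed

lemma mat_mult_vec_comb:
  fixes M :: "complex mat"
  assumes M: "M \<in> carrier_mat d d" and f: "\<And>m. m \<in> I \<Longrightarrow> f m \<in> carrier_vec d"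
  shows "M *\<^sub>v vec d (\<lambda>i. \<Sum>m\<in>I. c m * f m $ i) = vec d (\<lambda>i. \<Sum>m\<in>I. c m * (M *\<^sub>v f m) $ i)"
proof (rule eq_vecI)
  fix i assume "i < dim_vec (vec d (\<lambda>i. \<Sum>m\<in>I. c m * (M *\<^sub>v f m) $ i))"
  then have i: "i < d" by simp
  have "(M *\<^sub>v vec d (\<lambda>i. \<Sum>m\<in>I. c m * f m $ i)) $ i = (\<Sum>l<d. \<Sum>m\<in>I. M $$ (i, l) * (c m * f m $ l))"
    using i M by (simp add: scalar_prod_def lessThan_atLeast0 sum_distrib_left)
  also have "\<dots> = (\<Sum>m\<in>I. \<Sum>l<d. M $$ (i, l) * (c m * f m $ l))" by (rule sum.swap)
  also have "\<dots> = (\<Sum>m\<in>I. c m * (M *\<^sub>v f m) $ i)"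
    using i M f by (intro sum.cong)
      (auto simp: scalar_prod_def lessThan_atLeast0 sum_distrib_left mult_ac dest: f)
  finally show "(M *\<^sub>v vec d (\<lambda>i. \<Sum>m\<in>I. c m * f m $ i)) $ i = vec d (\<lambda>i. \<Sum>m\<in>I. c m * (M *\<^sub>v f m) $ i) $ i"
    using i by simp
qed (use M in simp)

text \<open>The vectors \<open>f m = M\<^sup>m v\<close> have period \<open>n\<close>, and their discrete Fourier transforms are
  eigenvectors. The transforms add up to \<open>n v\<close>, so one of them is nonzero. It is returned as an
  explicit combination of the \<open>f m\<close>, whence it stays in every subspace that contains them.\<close>

lemma fourier_eigenvector:
  fixes M :: "complex mat"
  assumes n: "n > 0" and M: "M \<in> carrier_mat d d" and f: "\<And>m. f m \<in> carrier_vec d"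
    and step: "\<And>m. M *\<^sub>v f m = f (Suc m)" and period: "f n = f 0" and nz: "f 0 \<noteq> 0\<^sub>v d"
  obtains j c where "j < n" "vec d (\<lambda>i. \<Sum>m<n. c m * f m $ i) \<noteq> 0\<^sub>v d"
    "M *\<^sub>v vec d (\<lambda>i. \<Sum>m<n. c m * f m $ i)
     = omega n powi int j \<cdot>\<^sub>v vec d (\<lambda>i. \<Sum>m<n. c m * f m $ i)"
proof -
  let ?c = "\<lambda>j m. omega n powi (- (int j * int m))"
  let ?w = "\<lambda>j. vec d (\<lambda>i. \<Sum>m<n. ?c j m * f m $ i)"
  have "\<exists>j<n. ?w j \<noteq> 0\<^sub>v d"
  proof (rule ccontr)
    assume "\<not> ?thesis"
    then have z: "?w j = 0\<^sub>v d" if "j < n" for j using that by blast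
    have "f 0 $ i = 0" if i: "i < d" for i
    proof -
      have "(\<Sum>m<n. ?c j m * f m $ i) = 0" if "j < n" for j
        using arg_cong[OF z[OF that], of "\<lambda>v. v $ i"] i by simp
      then have "0 = (\<Sum>j<n. \<Sum>m<n. ?c j m * f m $ i)" by simp
      also have "\<dots> = (\<Sum>m<n. (\<Sum>j<n. ?c j m) * f m $ i)"
        by (subst sum.swap) (simp add: sum_distrib_right)
      also have "\<dots> = (\<Sum>m<n. if m = 0 then of_nat n * f 0 $ i else 0)"
        by (intro sum.cong) (auto simp: sum_omega_powers)
      also have "\<dots> = of_nat n * f 0 $ i" using n by simp
      finally show ?thesis using n by simp
    qed
    then have "f 0 = 0\<^sub>v d" using f[of 0] by (intro eq_vecI) auto
    then show False using nz by simp
  qed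
  then obtain j where j: "j < n" "?w j \<noteq> 0\<^sub>v d" by blast
  have "M *\<^sub>v ?w j = vec d (\<lambda>i. \<Sum>m<n. ?c j m * f (Suc m) $ i)"
    unfolding mat_mult_vec_comb[OF M f] step ..
  also have "\<dots> = omega n powi int j \<cdot>\<^sub>v ?w j"
  proof (rule eq_vecI)
    fix i assume "i < dim_vec (omega n powi int j \<cdot>\<^sub>v ?w j)"
    then have i: "i < d" by simp
    define h where "h m = ?c j m * f m $ i" for m
    have "?c j m * f (Suc m) $ i = omega n powi int j * h (Suc m)" for m
    proof -
      have "?c j m = omega n powi (int j + - (int j * int (Suc m)))"
        by (rule arg_cong[where f = "\<lambda>i. omega n powi i"]) (simp add: algebra_simps)
      also have "\<dots> = omega n powi int j * ?c j (Suc m)"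
        by (rule power_int_add) (simp add: omega_nonzero)
      finally show ?thesis unfolding h_def by (simp only: mult.assoc)
    qed
    then have "(\<Sum>m<n. ?c j m * f (Suc m) $ i) = omega n powi int j * (\<Sum>m<n. h (Suc m))"
      by (simp add: sum_distrib_left)
    moreover have "(\<Sum>m<n. h (Suc m)) = (\<Sum>m<n. h m)"
    proof -
      have "?c j n = omega n powi 0"
        unfolding omega_powi_eq_iff[OF n] by simp
      then have "h n = h 0" unfolding h_def by (simp add: period)
      moreover have "(\<Sum>m<Suc n. h m) = h 0 + (\<Sum>m<n. h (Suc m))" by (rule sum.lessThan_Suc_shift)
      ultimately show ?thesis by simp
    qed
    ultimately show "vec d (\<lambda>i. \<Sum>m<n. ?c j m * f (Suc m) $ i) $ i = (omega n powi int j \<cdot>\<^sub>v ?w j) $ i"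
      using i by (simp add: h_def)
  qed simp
  finally show thesis using that[of j "?c j"] j by blast
qed

section \<open>The listed representations\<close>

lemma ball_split_two:
  "p \<in> C \<Longrightarrow> q \<in> C \<Longrightarrow> (\<forall>h\<in>C. P h) \<longleftrightarrow> P p \<and> P q \<and> (\<forall>g\<in>C. g \<noteq> p \<and> g \<noteq> q \<longrightarrow> P g)"
  by metis

lemma mod_add_cancel_nat: "(a + c) mod m = (b + c) mod m \<longleftrightarrow> a mod m = b mod (m :: nat)"
  unfolding nat_mod_eq_iff by simp

lemma neg_mod_iff:
  fixes a b n :: nat
  assumes "a < n" "b \<le> n"
  shows "a = (n - b) mod n \<longleftrightarrow> n dvd a + b"
proof -
  have "a = (n - b) mod n \<longleftrightarrow> a mod n = (n - b) mod n" using assms by simp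
  also have "\<dots> \<longleftrightarrow> (a + b) mod n = ((n - b) + b) mod n" unfolding mod_add_cancel_nat ..
  also have "\<dots> \<longleftrightarrow> n dvd a + b" using assms by (simp add: mod_eq_0_iff_dvd)
  finally show ?thesis .
qed

lemma irrep_labels_iff:
  assumes "n > 0"
  shows "Char \<epsilon> \<in> irrep_labels n \<longleftrightarrow> \<epsilon> = 1 \<or> \<epsilon> = - 1"
    "Planar k \<in> irrep_labels n \<longleftrightarrow> 0 < k \<and> 2 * k < n"
    "Rotation j k \<in> irrep_labels n \<longleftrightarrow> j < n \<and> 0 < k \<and> 2 * k < n"
    "Reflection \<epsilon> \<in> irrep_labels n \<longleftrightarrow> \<epsilon> = 1 \<or> \<epsilon> = - 1"
  using assms by (auto simp: irrep_labels_def)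

text \<open>The action of \<open>\<sigma>\<close> and \<open>\<tau>\<close> on the unit vectors of the representation with a given label. Unit
  vectors are numbered from 0, so that in the \<open>n\<close>-dimensional case \<open>i + j = 2\<close> becomes
  \<open>i + j = 0\<close> modulo \<open>n\<close>.\<close>

fun sigma_perm :: "nat \<Rightarrow> irrep_label \<Rightarrow> nat \<Rightarrow> nat" where
  "sigma_perm n (Char \<epsilon>) b = b"
| "sigma_perm n (Planar k) b = b"
| "sigma_perm n (Rotation j k) b = b"
| "sigma_perm n (Reflection \<epsilon>) b = (b + 2) mod n"

fun sigma_coeff :: "nat \<Rightarrow> irrep_label \<Rightarrow> nat \<Rightarrow> complex" where
  "sigma_coeff n (Char \<epsilon>) b = 1"
| "sigma_coeff n (Planar k) b = omega n powi (if b = 0 then int k else - int k)"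
| "sigma_coeff n (Rotation j k) b = omega n powi (if b = 0 then int j else - int j)"
| "sigma_coeff n (Reflection \<epsilon>) b = 1"

fun tau_perm :: "nat \<Rightarrow> irrep_label \<Rightarrow> nat \<Rightarrow> nat" where
  "tau_perm n (Char \<epsilon>) b = b"
| "tau_perm n (Planar k) b = 1 - b"
| "tau_perm n (Rotation j k) b = 1 - b"
| "tau_perm n (Reflection \<epsilon>) b = (n - b) mod n"

fun tau_coeff :: "irrep_label \<Rightarrow> nat \<Rightarrow> complex" where
  "tau_coeff (Char \<epsilon>) b = \<epsilon>"
| "tau_coeff (Planar k) b = 1"
| "tau_coeff (Rotation j k) b = 1"
| "tau_coeff (Reflection \<epsilon>) b = \<epsilon>"

lemma omega_diag_monomial:
  "omega_diag n k = monomial_mat 2 (\<lambda>b. b) (\<lambda>b. omega n powi (if b = 0 then int k else - int k))"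
  by (rule eq_matI) (auto simp: omega_diag_def mat_of_rows_list_def monomial_mat_def less_2_cases_iff)

lemma swap_mat_monomial: "swap_mat = monomial_mat 2 (\<lambda>b. 1 - b) (\<lambda>_. 1)"
  by (rule eq_matI) (auto simp: swap_mat_def mat_of_rows_list_def monomial_mat_def less_2_cases_iff)

lemma elem_mat_monomial:
  "elem_mat m (i + 1) (i + 1) = monomial_mat m (\<lambda>b. b) (\<lambda>b. if b = i then 1 else 0)"
  by (rule eq_matI) (auto simp: elem_mat_def mat1_def monomial_mat_def)

lemma zero_mat_monomial: "0\<^sub>m m m = monomial_mat m \<pi> (\<lambda>_. 0)"
  by (rule eq_matI) (auto simp: monomial_mat_def)

lemma smult_monomial: "c \<cdot>\<^sub>m monomial_mat m \<pi> k = monomial_mat m \<pi> (\<lambda>b. c * k b)"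
  by (rule eq_matI) (auto simp: monomial_mat_def)

lemma A_mat_monomial: "A_mat n = monomial_mat n (\<lambda>b. (b + 2) mod n) (\<lambda>_. 1)"
proof (rule eq_matI)
  fix a b assume "a < dim_row (monomial_mat n (\<lambda>b. (b + 2) mod n) (\<lambda>_. 1))"
    "b < dim_col (monomial_mat n (\<lambda>b. (b + 2) mod n) (\<lambda>_. 1))"
  then have ab: "a < n" "b < n" by (simp_all add: monomial_mat_dim)
  have "(a + 1) mod n = (b + 1 + 2) mod n \<longleftrightarrow> a = (b + 2) mod n"
    using mod_add_cancel_nat[of a 1 n "b + 2"] ab by (simp add: add.commute)
  then show "A_mat n $$ (a, b) = monomial_mat n (\<lambda>b. (b + 2) mod n) (\<lambda>_. 1) $$ (a, b)"
    using ab by (simp add: A_mat_def mat1_def monomial_mat_def)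
qed (simp_all add: A_mat_def mat1_def monomial_mat_dim)

lemma B_mat_monomial: "B_mat n = monomial_mat n (\<lambda>b. (n - b) mod n) (\<lambda>_. 1)"
proof (rule eq_matI)
  fix a b assume "a < dim_row (monomial_mat n (\<lambda>b. (n - b) mod n) (\<lambda>_. 1))"
    "b < dim_col (monomial_mat n (\<lambda>b. (n - b) mod n) (\<lambda>_. 1))"
  then have ab: "a < n" "b < n" by (simp_all add: monomial_mat_dim)
  have "(a + 1 + (b + 1)) mod n = 2 mod n \<longleftrightarrow> a = (n - b) mod n"
    using mod_add_cancel_nat[of "a + b" 2 n 0] neg_mod_iff[of a n b] ab
    by (simp add: mod_eq_0_iff_dvd numeral_2_eq_2)
  then show "B_mat n $$ (a, b) = monomial_mat n (\<lambda>b. (n - b) mod n) (\<lambda>_. 1) $$ (a, b)"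
    using ab by (simp add: B_mat_def mat1_def monomial_mat_def)
qed (simp_all add: B_mat_def mat1_def monomial_mat_dim)

locale odd_dihedral = dihedral +
  assumes odd_n: "odd n"
begin

fun label_degree :: "irrep_label \<Rightarrow> nat \<Rightarrow> 'a" where
  "label_degree (Char \<epsilon>) b = \<one>"
| "label_degree (Planar k) b = \<one>"
| "label_degree (Rotation j k) b = (if b = 0 then \<sigma> [^] int k else \<sigma> [^] (- int k))"
| "label_degree (Reflection \<epsilon>) b = \<sigma> [^] int b \<otimes> \<tau>"

lemmas labels_iff = irrep_labels_iff[OF n_pos]

lemma dvd_small: "int n dvd x \<Longrightarrow> \<bar>x\<bar> < int n \<Longrightarrow> x = 0"
  using dvd_imp_le_int[of x "int n"] by fastforce

lemma double_not_dvd: "0 < k \<Longrightarrow> 2 * k < n \<Longrightarrow> \<not> int n dvd int k - - int k"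
  using dvd_small[of "int k - - int k"] by auto

text \<open>All labels take the same form in terms of monomial matrices; the dual element \<open>h\<^sup>*\<close>
  is the projection to the unit vectors of degree \<open>h\<close>.\<close>

lemma irrep_listed_iff:
  assumes "L \<in> irrep_labels n"
  shows "irrep_listed G n \<sigma> \<tau> L \<rho> \<longleftrightarrow> qd_rep G (irrep_dim n L) \<rho> \<and>
    \<rho> (qd_grp G \<sigma>) = monomial_mat (irrep_dim n L) (sigma_perm n L) (sigma_coeff n L) \<and>
    \<rho> (qd_grp G \<tau>) = monomial_mat (irrep_dim n L) (tau_perm n L) (tau_coeff L) \<and>
    (\<forall>h\<in>carrier G. \<rho> (qd_dual G h) =
      monomial_mat (irrep_dim n L) (\<lambda>b. b) (\<lambda>b. if label_degree L b = h then 1 else 0))"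
proof (cases L)
  case (Char \<epsilon>)
  have 1: "monomial_mat 1 (sigma_perm n (Char \<epsilon>)) (sigma_coeff n (Char \<epsilon>)) = 1\<^sub>m 1"
    "monomial_mat 1 (tau_perm n (Char \<epsilon>)) (tau_coeff (Char \<epsilon>)) = \<epsilon> \<cdot>\<^sub>m 1\<^sub>m 1"
    unfolding monomial_mat_one[symmetric] smult_monomial by (rule monomial_mat_cong; simp)+
  have 2: "monomial_mat 1 (\<lambda>b. b) (\<lambda>b. if label_degree (Char \<epsilon>) b = h then 1 else 0)
      = (if h = \<one> then 1\<^sub>m 1 else 0\<^sub>m 1 1)" for h
    unfolding monomial_mat_one[symmetric] zero_mat_monomial[of 1 "\<lambda>b. b"]
    by (auto intro: monomial_mat_cong)
  show ?thesis unfolding irrep_listed_def Char irrep_dim.simps 1 2 by simp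
next
  case (Planar k)
  have 1: "monomial_mat 2 (sigma_perm n (Planar k)) (sigma_coeff n (Planar k)) = omega_diag n k"
    "monomial_mat 2 (tau_perm n (Planar k)) (tau_coeff (Planar k)) = swap_mat"
    unfolding omega_diag_monomial swap_mat_monomial by (rule monomial_mat_cong; simp)+
  have 2: "monomial_mat 2 (\<lambda>b. b) (\<lambda>b. if label_degree (Planar k) b = h then 1 else 0)
      = (if h = \<one> then 1\<^sub>m 2 else 0\<^sub>m 2 2)" for h
    unfolding monomial_mat_one[symmetric] zero_mat_monomial[of 2 "\<lambda>b. b"]
    by (auto intro: monomial_mat_cong)
  show ?thesis unfolding irrep_listed_def Planar irrep_dim.simps 1 2 by simp
next
  case (Rotation j k)
  then have k: "0 < k" "2 * k < n" using assms by (simp_all add: labels_iff)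
  have ne: "\<sigma> [^] int k \<noteq> \<sigma> [^] (- int k)" unfolding sigma_eq_iff using double_not_dvd k by simp
  have 1: "monomial_mat 2 (sigma_perm n (Rotation j k)) (sigma_coeff n (Rotation j k)) = omega_diag n j"
    "monomial_mat 2 (tau_perm n (Rotation j k)) (tau_coeff (Rotation j k)) = swap_mat"
    unfolding omega_diag_monomial swap_mat_monomial by (rule monomial_mat_cong; simp)+
  let ?m = "\<lambda>h. monomial_mat 2 (\<lambda>b. b) (\<lambda>b. if label_degree (Rotation j k) b = h then 1 else 0)"
  have e: "elem_mat 2 1 1 = monomial_mat 2 (\<lambda>b. b) (\<lambda>b. if b = 0 then 1 else 0)"
    "elem_mat 2 2 2 = monomial_mat 2 (\<lambda>b. b) (\<lambda>b. if b = 1 then 1 else 0)"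
    using elem_mat_monomial[of 2 0] elem_mat_monomial[of 2 1] by (simp_all add: numeral_2_eq_2)
  have 2: "?m (\<sigma> [^] int k) = elem_mat 2 1 1" "?m (\<sigma> [^] (- int k)) = elem_mat 2 2 2"
    unfolding e using ne by (intro monomial_mat_cong; auto)+
  have 3: "?m h = 0\<^sub>m 2 2" if "h \<noteq> \<sigma> [^] int k" "h \<noteq> \<sigma> [^] (- int k)" for h
    unfolding zero_mat_monomial[of 2 "\<lambda>b. b"] using that by (intro monomial_mat_cong) auto
  have 4: "(\<forall>h\<in>carrier G. \<rho> (qd_dual G h) = ?m h) \<longleftrightarrow>
     \<rho> (qd_dual G (\<sigma> [^] int k)) = elem_mat 2 1 1 \<and>
     \<rho> (qd_dual G (\<sigma> [^] (- int k))) = elem_mat 2 2 2 \<and>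
     (\<forall>g\<in>carrier G. g \<noteq> \<sigma> [^] int k \<and> g \<noteq> \<sigma> [^] (- int k) \<longrightarrow> \<rho> (qd_dual G g) = 0\<^sub>m 2 2)"
    (is "?l \<longleftrightarrow> ?r")
  proof -
    have "?l \<longleftrightarrow> \<rho> (qd_dual G (\<sigma> [^] int k)) = ?m (\<sigma> [^] int k) \<and>
      \<rho> (qd_dual G (\<sigma> [^] (- int k))) = ?m (\<sigma> [^] (- int k)) \<and>
      (\<forall>g\<in>carrier G. g \<noteq> \<sigma> [^] int k \<and> g \<noteq> \<sigma> [^] (- int k) \<longrightarrow> \<rho> (qd_dual G g) = ?m g)"
      by (rule ball_split_two) (simp_all add: sigma_closed)
    then show ?thesis unfolding 2 using 3 by simp
  qed
  show ?thesis unfolding irrep_listed_def Rotation irrep_dim.simps 1 4 by (simp add: int_pow_int)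
next
  case (Reflection \<epsilon>)
  have 1: "monomial_mat n (sigma_perm n (Reflection \<epsilon>)) (sigma_coeff n (Reflection \<epsilon>)) = A_mat n"
    "monomial_mat n (tau_perm n (Reflection \<epsilon>)) (tau_coeff (Reflection \<epsilon>)) = \<epsilon> \<cdot>\<^sub>m B_mat n"
    unfolding A_mat_monomial B_mat_monomial smult_monomial by (rule monomial_mat_cong; simp)+
  let ?m = "\<lambda>h. monomial_mat n (\<lambda>b. b) (\<lambda>b. if label_degree (Reflection \<epsilon>) b = h then 1 else 0)"
  have 2: "?m (\<sigma> [^] int i) = 0\<^sub>m n n" for i
    unfolding zero_mat_monomial[of n "\<lambda>b. b"] using sigma_tau_neq(1)
    by (intro monomial_mat_cong) auto
  have 3: "?m (\<sigma> [^] int i \<otimes> \<tau>) = elem_mat n (i + 1) (i + 1)" if "i < n" for i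
    unfolding elem_mat_monomial
  proof (rule monomial_mat_cong)
    fix b assume "b < n"
    then have "int n dvd int b - int i \<longleftrightarrow> b = i" using that dvd_small[of "int b - int i"] by auto
    then show "(if label_degree (Reflection \<epsilon>) b = \<sigma> [^] int i \<otimes> \<tau> then 1 else 0)
        = (if b = i then 1 else (0 :: complex))"
      by (simp add: sigma_tau_eq_iff)
  qed simp
  have 4: "(\<forall>h\<in>carrier G. \<rho> (qd_dual G h) = ?m h) \<longleftrightarrow>
     (\<forall>i<n. \<rho> (qd_dual G (\<sigma> [^] int i)) = 0\<^sub>m n n \<and>
            \<rho> (qd_dual G (\<sigma> [^] int i \<otimes> \<tau>)) = elem_mat n (i + 1) (i + 1))" (is "?l \<longleftrightarrow> ?r")
  proof
    assume ?l
    then show ?r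
      using 2 3 m_closed[OF int_pow_closed[OF sigma_closed] tau_closed] int_pow_closed[OF sigma_closed]
      by simp
  next
    assume r: ?r
    show ?l
    proof
      fix h assume "h \<in> carrier G"
      then show "\<rho> (qd_dual G h) = ?m h" using r 2 3 by (cases h rule: carrier_cases) metis+
    qed
  qed
  show ?thesis unfolding irrep_listed_def Reflection irrep_dim.simps 1 4 by (simp add: int_pow_int)
qed

subsection \<open>Existence and uniqueness\<close>

lemma sigma_perm_pow:
  assumes "b < irrep_dim n L"
  shows "(sigma_perm n L ^^ m) b = (case L of Reflection _ \<Rightarrow> (b + 2 * m) mod n | _ \<Rightarrow> b)"
  using assms by (induction m) (cases L; simp add: mod_simps)+

lemma irrep_dim_pos: "L \<in> irrep_labels n \<Longrightarrow> 0 < irrep_dim n L"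
  using n_pos by (cases L) auto

lemma perm_less:
  assumes "b < irrep_dim n L"
  shows "sigma_perm n L b < irrep_dim n L" "tau_perm n L b < irrep_dim n L"
  using assms n_pos by (cases L; simp)+

lemma label_degree_closed: "label_degree L b \<in> carrier G"
  using sigma_closed tau_closed by (cases L) auto

lemma omega_powi_pow: "(omega n powi x) ^ n = 1"
proof -
  have "(omega n powi x) ^ n = (omega n powi int n) powi x"
    by (simp only: power_int_mult[symmetric] power_int_of_nat[symmetric] mult.commute)
  then show ?thesis by (simp add: omega_power_eq_one[OF n_pos])
qed

lemma tau_tau_label:
  assumes "L \<in> irrep_labels n" "b < irrep_dim n L"
  shows "tau_perm n L (tau_perm n L b) = b" "tau_coeff L (tau_perm n L b) * tau_coeff L b = 1"
proof -
  show "tau_coeff L (tau_perm n L b) * tau_coeff L b = 1"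
    using assms by (cases L) (auto simp: labels_iff)
  show "tau_perm n L (tau_perm n L b) = b"
  proof (cases L)
    case (Reflection \<epsilon>)
    then have b: "b < n" using assms by simp
    have "n dvd (n - b) mod n + b" using b n_pos neg_mod_iff[of "(n - b) mod n" n b] by simp
    then have "b = (n - (n - b) mod n) mod n"
      using b n_pos by (subst neg_mod_iff) (simp_all add: add.commute less_imp_le)
    then show ?thesis using Reflection by simp
  qed (use assms in auto)
qed

lemma sigma_tau_sigma_label:
  assumes "b < irrep_dim n L"
  shows "sigma_perm n L (tau_perm n L (sigma_perm n L b)) = tau_perm n L b"
    "sigma_coeff n L (tau_perm n L (sigma_perm n L b)) * tau_coeff L (sigma_perm n L b) * sigma_coeff n L b
     = tau_coeff L b"
proof -
  show "sigma_coeff n L (tau_perm n L (sigma_perm n L b)) * tau_coeff L (sigma_perm n L b) * sigma_coeff n L b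
     = tau_coeff L b"
    using assms omega_nonzero[of n] by (cases L) (auto simp: less_Suc_eq numeral_2_eq_2 power_int_minus)
  show "sigma_perm n L (tau_perm n L (sigma_perm n L b)) = tau_perm n L b"
  proof (cases L)
    case (Reflection \<epsilon>)
    then have b: "b < n" using assms by simp
    let ?c = "(b + 2) mod n"
    have "(((n - ?c) mod n + 2) mod n + b) mod n = ((n - ?c) + (b + 2)) mod n"
      by (simp add: mod_simps ac_simps)
    also have "\<dots> = ((n - ?c) + ?c) mod n" by (simp add: mod_simps)
    also have "\<dots> = 0" using n_pos by (simp add: less_imp_le)
    finally have "n dvd ((n - ?c) mod n + 2) mod n + b" by (simp add: mod_eq_0_iff_dvd)
    then have "((n - ?c) mod n + 2) mod n = (n - b) mod n"
      using b n_pos by (subst neg_mod_iff) (simp_all add: less_imp_le)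
    then show ?thesis using Reflection by simp
  qed (use assms in auto)
qed

lemma label_degree_conj:
  assumes "b < irrep_dim n L"
  shows "label_degree L (sigma_perm n L b) = \<sigma> \<otimes> label_degree L b \<otimes> inv \<sigma>"
    "label_degree L (tau_perm n L b) = \<tau> \<otimes> label_degree L b \<otimes> inv \<tau>"
proof -
  note cs = conj_sigma[of 1, unfolded sigma_int_1]
  show "label_degree L (sigma_perm n L b) = \<sigma> \<otimes> label_degree L b \<otimes> inv \<sigma>"
  proof (cases L)
    case (Reflection \<epsilon>)
    have "\<sigma> [^] int ((b + 2) mod n) \<otimes> \<tau> = \<sigma> [^] (int b + 2) \<otimes> \<tau>"
      unfolding of_nat_mod sigma_int_mod by (simp add: add.commute)
    then show ?thesis using Reflection cs(2)[of "int b"] by simp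
  qed (use sigma_closed cs(1) in auto)
  show "label_degree L (tau_perm n L b) = \<tau> \<otimes> label_degree L b \<otimes> inv \<tau>"
  proof (cases L)
    case (Reflection \<epsilon>)
    then have b: "b < n" using assms by simp
    have "n dvd (n - b) mod n + b" using b n_pos neg_mod_iff[of "(n - b) mod n" n b] by simp
    then have "int n dvd int ((n - b) mod n) - - int b"
      by (metis diff_minus_eq_add of_nat_add of_nat_dvd_iff)
    then have "\<sigma> [^] int ((n - b) mod n) \<otimes> \<tau> = \<sigma> [^] (- int b) \<otimes> \<tau>"
      by (simp only: sigma_tau_eq_iff)
    then show ?thesis using Reflection conj_tau(2)[of "int b"] by simp
  next
    case (Rotation j k)
    then show ?thesis using assms conj_tau(1)[of "int k"] conj_tau(1)[of "- int k"] by (auto simp: less_2_cases_iff)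
  qed (use tau_closed in auto)
qed

lemma exists_listed:
  assumes L: "L \<in> irrep_labels n"
  shows "\<exists>\<rho>. irrep_listed G n \<sigma> \<tau> L \<rho>"
  unfolding irrep_listed_iff[OF L]
proof (rule exists_monomial_rep)
  fix b assume b: "b < irrep_dim n L"
  show "sigma_perm n L b < irrep_dim n L" "tau_perm n L b < irrep_dim n L" by (fact perm_less[OF b])+
  show "(sigma_perm n L ^^ n) b = b"
    unfolding sigma_perm_pow[OF b] using b by (cases L) auto
  show "(\<Prod>i<n. sigma_coeff n L ((sigma_perm n L ^^ i) b)) = 1"
    unfolding sigma_perm_pow[OF b] by (cases L) (simp_all add: omega_powi_pow del: power_int_minus)
  show "tau_perm n L (tau_perm n L b) = b" "tau_coeff L (tau_perm n L b) * tau_coeff L b = 1"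
    by (fact tau_tau_label[OF L b])+
  show "sigma_perm n L (tau_perm n L (sigma_perm n L b)) = tau_perm n L b"
    "sigma_coeff n L (tau_perm n L (sigma_perm n L b)) * tau_coeff L (sigma_perm n L b) * sigma_coeff n L b
     = tau_coeff L b"
    by (fact sigma_tau_sigma_label[OF b])+
  show "label_degree L b \<in> carrier G" by (rule label_degree_closed)
  show "label_degree L (sigma_perm n L b) = \<sigma> \<otimes> label_degree L b \<otimes> inv \<sigma>"
    "label_degree L (tau_perm n L b) = \<tau> \<otimes> label_degree L b \<otimes> inv \<tau>"
    by (fact label_degree_conj[OF b])+
qed

text \<open>The identity matrix intertwines two representations with the same values on the generators.\<close>

lemma listed_unique:
  assumes L: "L \<in> irrep_labels n"
    and \<rho>: "irrep_listed G n \<sigma> \<tau> L \<rho>" "irrep_listed G n \<sigma> \<tau> L \<rho>'"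
    and x: "x \<in> carrier (quantum_double G)"
  shows "\<rho> x = \<rho>' x"
proof -
  let ?d = "irrep_dim n L"
  have rep: "qd_rep G ?d \<rho>" "qd_rep G ?d \<rho>'" using \<rho> by (simp_all add: irrep_listed_def)
  interpret A: qd_module G ?d \<rho> by unfold_locales (fact finite_carrier rep)+
  interpret B: qd_module G ?d \<rho>' by unfold_locales (fact finite_carrier rep)+
  have "\<rho> x * 1\<^sub>m ?d = 1\<^sub>m ?d * \<rho>' x"
    by (rule intertwines_if_generators[OF rep _ _ _ _ x])
       (use \<rho> in \<open>simp_all add: irrep_listed_iff[OF L] monomial_mat_closed
          right_mult_one_mat[OF monomial_mat_closed] left_mult_one_mat[OF monomial_mat_closed]\<close>)
  then show ?thesis using A.rho_closed[OF x] B.rho_closed[OF x] by simp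
qed

end

subsection \<open>Irreducibility\<close>

lemma monomial_add: "monomial_mat d \<pi> c + monomial_mat d \<pi> c' = monomial_mat d \<pi> (\<lambda>b. c b + c' b)"
  by (rule eq_matI) (auto simp: monomial_mat_def)

locale listed_rep = odd_dihedral +
  fixes L and \<rho>
  assumes label: "L \<in> irrep_labels n" and listed: "irrep_listed G n \<sigma> \<tau> L \<rho>"
begin

abbreviation "label_dim \<equiv> irrep_dim n L"

sublocale qd_module G label_dim \<rho>
  by unfold_locales (use listed in \<open>simp_all add: finite_carrier irrep_listed_def\<close>)

lemma rho_sigma: "grp \<sigma> = monomial_mat label_dim (sigma_perm n L) (sigma_coeff n L)"
  and rho_tau: "grp \<tau> = monomial_mat label_dim (tau_perm n L) (tau_coeff L)"
  and rho_dual: "h \<in> carrier G \<Longrightarrow>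
    dual h = monomial_mat label_dim (\<lambda>b. b) (\<lambda>b. if label_degree L b = h then 1 else 0)"
  using listed unfolding irrep_listed_iff[OF label] by blast+

text \<open>When the degrees of the unit vectors are distinct, the dual elements are the required
  projections. The degrees coincide only in the two-dimensional representations with trivial
  grading; there \<open>\<sigma>\<close> has two distinct eigenvalues, and the projections are linear polynomials
  in \<open>\<sigma>\<close>.\<close>

lemma diagonal_unit_in_image:
  assumes b: "b < label_dim"
  shows "\<exists>x\<in>carrier D. \<rho> x = monomial_mat label_dim (\<lambda>a. a) (\<lambda>a. if a = b then 1 else 0)"
proof (cases "\<forall>a<label_dim. label_degree L a = label_degree L b \<longrightarrow> a = b")
  case True
  have "dual (label_degree L b) = monomial_mat label_dim (\<lambda>a. a) (\<lambda>a. if a = b then 1 else 0)"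
    unfolding rho_dual[OF label_degree_closed] by (rule monomial_mat_cong) (use True in auto)
  then show ?thesis using dual_in label_degree_closed by blast
next
  case False
  have "\<exists>k. L = Planar k"
  proof (cases L)
    case (Char \<epsilon>)
    then show ?thesis using False b by auto
  next
    case (Rotation j k)
    then have k: "0 < k" "2 * k < n" using label by (simp_all add: labels_iff)
    have ne: "\<sigma> [^] int k \<noteq> \<sigma> [^] (- int k)" unfolding sigma_eq_iff using double_not_dvd k by simp
    then have ne': "\<sigma> [^] (- int k) \<noteq> \<sigma> [^] int k" by (rule not_sym)
    show ?thesis using False b Rotation ne ne' by (auto simp: less_2_cases_iff split: if_splits)
  next
    case (Reflection \<epsilon>)
    then obtain a where a: "a < n" "a \<noteq> b" "\<sigma> [^] int a \<otimes> \<tau> = \<sigma> [^] int b \<otimes> \<tau>"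
      using False by auto
    have "\<bar>int a - int b\<bar> < int n" using a(1) b Reflection by simp
    then show ?thesis using a(2,3) dvd_small[of "int a - int b"] by (simp add: sigma_tau_eq_iff)
  qed auto
  then obtain k where L: "L = Planar k" by blast
  then have k: "0 < k" "2 * k < n" using label by (simp_all add: labels_iff)
  let ?z = "sigma_coeff n L b" and ?z' = "sigma_coeff n L (1 - b)"
  have b2: "b = 0 \<or> b = 1" using b L by (auto simp: less_2_cases_iff)
  have ne: "omega n powi int k \<noteq> omega n powi (- int k)"
    unfolding omega_powi_eq_iff[OF n_pos] using double_not_dvd k by simp
  then have z: "?z \<noteq> ?z'" using b2 L by auto
  let ?y = "qd_grp G \<sigma> \<oplus>\<^bsub>D\<^esub> ((- ?z') \<odot>\<^bsub>D\<^esub> qd_grp G \<one>)"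
  have y: "?y \<in> carrier D" by (intro qd_add_closed qd_smult_closed grp_in sigma_closed one_closed)
  have perm: "monomial_mat label_dim (sigma_perm n L) (sigma_coeff n L)
      = monomial_mat label_dim (\<lambda>a. a) (sigma_coeff n L)"
    by (rule monomial_mat_cong) (simp_all add: L)
  have "\<rho> (inverse (?z - ?z') \<odot>\<^bsub>D\<^esub> ?y) = inverse (?z - ?z') \<cdot>\<^sub>m (grp \<sigma> + (- ?z') \<cdot>\<^sub>m 1\<^sub>m label_dim)"
    using y by (simp add: rho_smult rho_add grp_in sigma_closed qd_smult_closed grp_one)
  also have "\<dots> = inverse (?z - ?z') \<cdot>\<^sub>m (monomial_mat label_dim (\<lambda>a. a) (sigma_coeff n L)
      + (- ?z') \<cdot>\<^sub>m monomial_mat label_dim (\<lambda>a. a) (\<lambda>_. 1))"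
    by (simp only: rho_sigma monomial_mat_one perm)
  also have "\<dots> = monomial_mat label_dim (\<lambda>a. a) (\<lambda>a. inverse (?z - ?z') * (sigma_coeff n L a + - ?z' * 1))"
    unfolding smult_monomial monomial_add ..
  also have "\<dots> = monomial_mat label_dim (\<lambda>a. a) (\<lambda>a. if a = b then 1 else 0)"
  proof (rule monomial_mat_cong)
    fix a assume "a < label_dim"
    then have "a = b \<or> a = 1 - b" using b2 L by (auto simp: less_2_cases_iff)
    then show "inverse (?z - ?z') * (sigma_coeff n L a + - ?z' * 1) = (if a = b then 1 else 0)"
      using z b2 by auto
  qed simp
  finally show ?thesis using y qd_smult_closed by blast
qed

lemma sigma_power_unit_vec:
  assumes "L = Reflection \<epsilon>" "b < n"
  shows "grp (\<sigma> [^] m) *\<^sub>v unit_vec n b = unit_vec n ((b + 2 * m) mod n)"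
proof (induction m)
  case 0
  then show ?case using assms grp_one by simp
next
  case (Suc m)
  let ?b = "(b + 2 * m) mod n"
  have "grp (\<sigma> [^] Suc m) *\<^sub>v unit_vec n b = grp \<sigma> *\<^sub>v (grp (\<sigma> [^] m) *\<^sub>v unit_vec n b)"
    using assms sigma_closed grp_mult_vec[of \<sigma> "\<sigma> [^] m" "unit_vec n b"] nat_pow_Suc2[of \<sigma> m] by simp
  also have "\<dots> = unit_vec n ((?b + 2) mod n)"
    unfolding Suc rho_sigma using n_pos assms(1) by (simp add: monomial_mat_unit_vec)
  finally show ?case by (simp add: mod_simps)
qed

lemma irreducible: "qd_irreducible G label_dim \<rho>"
proof (rule irreducible_if_projections_transitive)
  show "finite (carrier G)" "qd_rep G label_dim \<rho>" by (fact finite_carrier rep)+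
  show "0 < label_dim" using label by (rule irrep_dim_pos)
  fix b assume b: "b < label_dim"
  obtain x where x: "x \<in> carrier D" "\<rho> x = monomial_mat label_dim (\<lambda>a. a) (\<lambda>a. if a = b then 1 else 0)"
    using diagonal_unit_in_image[OF b] by blast
  have "\<rho> x *\<^sub>v v = v $ b \<cdot>\<^sub>v unit_vec label_dim b" if "v \<in> carrier_vec label_dim" for v
    unfolding x(2) diagonal_mat_mult_vec[OF that] by (rule eq_vecI) (use b in auto)
  then show "\<exists>x\<in>carrier D. \<forall>v\<in>carrier_vec label_dim. \<rho> x *\<^sub>v v = v $ b \<cdot>\<^sub>v unit_vec label_dim b"
    using x(1) by blast
  fix a assume a: "a < label_dim"
  show "\<exists>x\<in>carrier D. \<exists>c. c \<noteq> 0 \<and> \<rho> x *\<^sub>v unit_vec label_dim b = c \<cdot>\<^sub>v unit_vec label_dim a"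
  proof (cases "a = b")
    case True
    then show ?thesis
      by (intro bexI[of _ "qd_grp G \<one>"] exI[of _ 1]) (simp_all add: grp_in grp_one)
  next
    case False
    show ?thesis
    proof (cases "\<exists>\<epsilon>. L = Reflection \<epsilon>")
      case True
      then obtain \<epsilon> where L: "L = Reflection \<epsilon>" by blast
      then have ab: "a < n" "b < n" using a b by simp_all
      \<comment> \<open>\<open>(n + 1) / 2\<close> inverts 2 modulo \<open>n\<close>, so \<open>\<sigma>\<^sup>m\<close> shifts indices by \<open>a - b\<close>; the summand \<open>n\<close> avoids truncated subtraction\<close>
      define m where "m = (n + a - b) * ((n + 1) div 2)"
      have "2 * ((n + 1) div 2) = n + 1" using odd_n by simp
      moreover have "2 * m = (n + a - b) * (2 * ((n + 1) div 2))"
        unfolding m_def by (rule mult.left_commute)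
      ultimately have "2 * m = (n + a - b) * (n + 1)" by simp
      moreover have "b + (n + a - b) = n + a" using ab by simp
      ultimately have "b + 2 * m = a + n * (n + a - b + 1)"
        by (simp only: add_mult_distrib2 mult_1_right) (simp only: ac_simps)
      then have "(b + 2 * m) mod n = a mod n" by (simp only: mod_mult_self2)
      then have "(b + 2 * m) mod n = a" using ab by simp
      then have "grp (\<sigma> [^] m) *\<^sub>v unit_vec n b = unit_vec n a"
        using sigma_power_unit_vec[OF L ab(2), of m] by simp
      then show ?thesis using L sigma_closed
        by (intro bexI[of _ "qd_grp G (\<sigma> [^] m)"] exI[of _ 1]) (simp_all add: grp_in)
    next
      case other: False
      have "tau_perm n L b = a" "tau_coeff L b = 1"
        using other False a b by (cases L; auto simp: less_2_cases_iff)+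
      then have "grp \<tau> *\<^sub>v unit_vec label_dim b = 1 \<cdot>\<^sub>v unit_vec label_dim a"
        unfolding rho_tau using a b by (simp add: monomial_mat_unit_vec)
      then show ?thesis using tau_closed
        by (intro bexI[of _ "qd_grp G \<tau>"] exI[of _ 1]) (simp_all add: grp_in)
    qed
  qed
qed

end

subsection \<open>Pairwise inequivalence\<close>

lemma (in dihedral) sigma_one_iff: "\<sigma> [^] (i :: int) = \<one> \<longleftrightarrow> int n dvd i"
  using sigma_eq_iff[of i 0] by simp

lemma (in dihedral) reflection_neq_one: "\<sigma> [^] (i :: int) \<otimes> \<tau> \<noteq> \<one>"
  using sigma_tau_neq(1)[of i 0] by simp

context odd_dihedral
begin

text \<open>A dual element \<open>h\<^sup>*\<close> acts by zero unless \<open>h\<close> is the degree of some unit vector, and isomorphic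
  representations are annihilated by the same dual elements.\<close>

lemma isomorphic_listed_degree:
  assumes L: "L \<in> irrep_labels n" "L' \<in> irrep_labels n"
    and \<rho>: "irrep_listed G n \<sigma> \<tau> L \<rho>" "irrep_listed G n \<sigma> \<tau> L' \<rho>'"
    and iso: "qd_isomorphic G (irrep_dim n L) \<rho> (irrep_dim n L') \<rho>'"
  shows "label_degree L' 0 \<in> label_degree L ` {..<irrep_dim n L}"
proof (rule ccontr)
  assume not: "\<not> ?thesis"
  interpret A: listed_rep G n \<sigma> \<tau> L \<rho> by unfold_locales (fact L \<rho>)+
  interpret B: listed_rep G n \<sigma> \<tau> L' \<rho>' by unfold_locales (fact L \<rho>)+
  let ?h = "label_degree L' 0"
  note h = label_degree_closed[of L' 0]
  have ne: "label_degree L b \<noteq> ?h" if "b < irrep_dim n L" for b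
    using not that by (metis image_eqI lessThan_iff)
  have "A.dual ?h = 0 \<cdot>\<^sub>m A.dual ?h"
    unfolding A.rho_dual[OF h] smult_monomial using ne by (intro monomial_mat_cong) auto
  from isomorphic_transfers_relation[OF finite_carrier A.rep B.rep iso A.dual_in[OF h] A.dual_in[OF h] this]
  have "B.dual ?h = 0 \<cdot>\<^sub>m B.dual ?h" .
  then have "B.dual ?h $$ (0, 0) = (0 \<cdot>\<^sub>m B.dual ?h) $$ (0, 0)" by simp
  then show False
    using irrep_dim_pos[OF L(2)] by (simp add: B.rho_dual[OF h] monomial_mat_index monomial_mat_dim)
qed

text \<open>Degrees and dimensions determine the family and, in the second family, the index \<open>k\<close>. The
  remaining parameter is read off from a relation: \<open>\<tau> = \<epsilon>\<close> for characters,
  \<open>\<sigma>\<^sup>2 + 1 = (\<omega>\<^sup>k + \<omega>\<^sup>-\<^sup>k) \<sigma>\<close> in the planar case, \<open>\<sigma> (\<sigma>\<^sup>k)\<^sup>* = \<omega>\<^sup>j (\<sigma>\<^sup>k)\<^sup>*\<close> for rotations and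
  \<open>\<tau> \<tau>\<^sup>* = \<epsilon> \<tau>\<^sup>*\<close> for reflections.\<close>

lemma label_eq_if_isomorphic:
  assumes L: "L \<in> irrep_labels n" "L' \<in> irrep_labels n"
    and \<rho>: "irrep_listed G n \<sigma> \<tau> L \<rho>" "irrep_listed G n \<sigma> \<tau> L' \<rho>'"
    and iso: "qd_isomorphic G (irrep_dim n L) \<rho> (irrep_dim n L') \<rho>'"
  shows "L = L'"
proof -
  interpret A: listed_rep G n \<sigma> \<tau> L \<rho> by unfold_locales (fact L \<rho>)+
  interpret B: listed_rep G n \<sigma> \<tau> L' \<rho>' by unfold_locales (fact L \<rho>)+
  note transfer = isomorphic_transfers_relation[OF finite_carrier A.rep B.rep iso]
  note degree = isomorphic_listed_degree[OF L \<rho> iso]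
  have dim: "irrep_dim n L = irrep_dim n L'" using iso by (simp add: qd_isomorphic_def)
  have not_dvd: "\<not> int n dvd int k" if "0 < k" "2 * k < n" for k
    using dvd_small[of "int k"] that by auto
  have eq: "k = k'" if "int n dvd int k' - int k \<or> int n dvd int k' - - int k"
    "0 < k" "2 * k < n" "0 < k'" "2 * k' < n" for k k'
    using that dvd_small[of "int k' - int k"] dvd_small[of "int k' - - int k"] by auto
  have unit: "(monomial_mat (Suc d) (\<lambda>b. b) c = monomial_mat (Suc d) (\<lambda>b. b) c') \<Longrightarrow> c 0 = c' 0" for d c c'
    by (drule arg_cong[where f = "\<lambda>M. M $$ (0, 0)"]) (simp add: monomial_mat_index)
  have degree_one: "(\<exists>\<epsilon>. L' = Char \<epsilon>) \<or> (\<exists>k. L' = Planar k)" if "label_degree L' 0 = \<one>"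
  proof (cases L')
    case (Rotation j k)
    then have "int n dvd int k" "0 < k" "2 * k < n"
      using that L(2) sigma_one_iff[of "int k"] by (simp_all add: labels_iff)
    then show ?thesis using not_dvd by blast
  next
    case (Reflection \<epsilon>)
    then show ?thesis using that reflection_neq_one[of 0] by simp
  qed auto
  have degree_rotation: "\<exists>j k. L' = Rotation j k \<and> int n dvd int k - i"
    if "label_degree L' 0 = \<sigma> [^] i" "\<not> int n dvd i" for i
  proof (cases L')
    case (Rotation j k)
    then show ?thesis using that(1) sigma_eq_iff[of "int k" i] by simp
  next
    case (Reflection \<epsilon>)
    then show ?thesis using that(1) sigma_tau_neq(1)[of 0 i] by simp
  qed (use that sigma_one_iff[of i] in auto)
  have degree_reflection: "\<exists>\<epsilon>. L' = Reflection \<epsilon>" if "label_degree L' 0 = \<sigma> [^] i \<otimes> \<tau>" for i :: int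
    using that sigma_tau_neq(1)[of i] reflection_neq_one[of i] by (cases L') (auto dest: sym)
  consider (char) \<epsilon> \<epsilon>' where "L = Char \<epsilon>" "L' = Char \<epsilon>'"
    | (planar) k k' where "L = Planar k" "L' = Planar k'"
    | (rotation) j j' k where "L = Rotation j k" "L' = Rotation j' k"
    | (reflection) \<epsilon> \<epsilon>' where "L = Reflection \<epsilon>" "L' = Reflection \<epsilon>'"
  proof (cases L)
    case (Char \<epsilon>)
    then show ?thesis using degree degree_one dim char by auto
  next
    case (Planar k)
    then show ?thesis using degree degree_one dim planar by auto
  next
    case (Rotation j k)
    then have k: "0 < k" "2 * k < n" using L by (simp_all add: labels_iff)
    then have nd: "\<not> int n dvd int k" "\<not> int n dvd - int k" using not_dvd by simp_all
    have "label_degree L' 0 = \<sigma> [^] int k \<or> label_degree L' 0 = \<sigma> [^] (- int k)"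
      using degree Rotation by auto
    then obtain j' k' where L': "L' = Rotation j' k'" and "int n dvd int k' - int k \<or> int n dvd int k' - - int k"
      using degree_rotation[OF _ nd(1)] degree_rotation[OF _ nd(2)] by blast
    then have "k = k'" using eq[of k' k] k L(2) L' by (simp add: labels_iff)
    then show ?thesis using rotation Rotation L' by simp
  next
    case (Reflection \<epsilon>)
    then show ?thesis using degree degree_reflection reflection by auto
  qed
  then show ?thesis
  proof cases
    case char
    have "\<rho>' (qd_grp G \<tau>) = \<epsilon> \<cdot>\<^sub>m \<rho>' (qd_grp G \<one>)"
      by (rule transfer) (use \<rho>(1) char A.grp_one tau_closed in \<open>auto simp: irrep_listed_def A.grp_in\<close>)
    then have "(\<epsilon>' \<cdot>\<^sub>m 1\<^sub>m 1) $$ (0, 0) = (\<epsilon> \<cdot>\<^sub>m 1\<^sub>m 1 :: complex mat) $$ (0, 0)"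
      using \<rho>(2) char B.grp_one by (simp add: irrep_listed_def)
    then show ?thesis using char by simp
  next
    case planar
    have k: "0 < k" "2 * k < n" "0 < k'" "2 * k' < n" using L planar by (simp_all add: labels_iff)
    let ?x = "(qd_grp G \<sigma> \<otimes>\<^bsub>A.D\<^esub> qd_grp G \<sigma>) \<oplus>\<^bsub>A.D\<^esub> qd_grp G \<one>"
    let ?z = "omega n powi int k" and ?z' = "omega n powi int k'"
    have x: "?x \<in> carrier A.D" by (intro qd_add_closed qd_mult_closed A.grp_in one_closed)
    have val: "r ?x = monomial_mat 2 (\<lambda>b. b) (\<lambda>b. sigma_coeff n (Planar l) b * sigma_coeff n (Planar l) b + 1)
        \<and> r (qd_grp G \<sigma>) = monomial_mat 2 (\<lambda>b. b) (sigma_coeff n (Planar l))"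
      if "listed_rep G n \<sigma> \<tau> (Planar l) r" for l r
    proof -
      interpret C: listed_rep G n \<sigma> \<tau> "Planar l" r by (rule that)
      have s: "r (qd_grp G \<sigma>) = monomial_mat 2 (\<lambda>b. b) (sigma_coeff n (Planar l))"
        unfolding C.rho_sigma irrep_dim.simps by (rule monomial_mat_cong) simp_all
      moreover have "r ?x = r (qd_grp G \<sigma>) * r (qd_grp G \<sigma>) + 1\<^sub>m 2"
        using sigma_closed C.grp_one by (simp add: C.rho_add C.rho_mult C.grp_in qd_mult_closed)
      ultimately show ?thesis
        by (simp add: monomial_mat_mult monomial_add flip: monomial_mat_one)
    qed
    have "\<rho> ?x = (?z + inverse ?z) \<cdot>\<^sub>m \<rho> (qd_grp G \<sigma>)"
      using val[of k \<rho>] A.listed_rep_axioms planar omega_nonzero[of n]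
      by (auto simp: smult_monomial power_int_minus field_simps intro!: monomial_mat_cong)
    from transfer[OF x A.grp_in[OF sigma_closed] this]
    have "monomial_mat 2 (\<lambda>b. b) (\<lambda>b. sigma_coeff n (Planar k') b * sigma_coeff n (Planar k') b + 1)
        = monomial_mat 2 (\<lambda>b. b) (\<lambda>b. (?z + inverse ?z) * sigma_coeff n (Planar k') b)"
      unfolding val[OF B.listed_rep_axioms[unfolded planar(2)], THEN conjunct1]
        val[OF B.listed_rep_axioms[unfolded planar(2)], THEN conjunct2] smult_monomial .
    then have "?z' * ?z' + 1 = (?z + inverse ?z) * ?z'"
      unfolding numeral_2_eq_2 by (drule_tac unit) simp
    \<comment> \<open>the eigenvalues of \<open>\<sigma>\<close> are the roots of the quadratic relation, and the range of \<open>k\<close> selects one of each inverse pair\<close>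
    then have "(?z' - ?z) * (?z' - inverse ?z) = 0"
      using omega_nonzero[of n] by (simp add: algebra_simps)
    then have "?z' = ?z \<or> ?z' = omega n powi (- int k)"
      by (simp add: power_int_minus)
    then have "k = k'" using eq k unfolding omega_powi_eq_iff[OF n_pos] by auto
    then show ?thesis using planar by simp
  next
    case rotation
    have k: "0 < k" "2 * k < n" "j < n" "j' < n" using L rotation by (simp_all add: labels_iff)
    let ?h = "\<sigma> [^] int k"
    have h: "?h \<in> carrier G" using sigma_closed by simp
    let ?x = "qd_grp G \<sigma> \<otimes>\<^bsub>A.D\<^esub> qd_dual G ?h"
    have ne: "\<sigma> [^] (- int k) \<noteq> \<sigma> [^] int k"
      unfolding sigma_eq_iff using double_not_dvd[of k] k by (metis dvd_minus_iff minus_diff_eq)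
    have val: "r ?x = monomial_mat 2 (\<lambda>b. b) (\<lambda>b. if b = 0 then omega n powi int l else 0)
        \<and> r (qd_dual G ?h) = monomial_mat 2 (\<lambda>b. b) (\<lambda>b. if b = 0 then 1 else 0)"
      if "listed_rep G n \<sigma> \<tau> (Rotation l k) r" for l r
    proof -
      interpret C: listed_rep G n \<sigma> \<tau> "Rotation l k" r by (rule that)
      have s: "r (qd_grp G \<sigma>) = monomial_mat 2 (\<lambda>b. b) (sigma_coeff n (Rotation l k))"
        unfolding C.rho_sigma irrep_dim.simps by (rule monomial_mat_cong) simp_all
      have t: "r (qd_dual G ?h) = monomial_mat 2 (\<lambda>b. b) (\<lambda>b. if b = 0 then 1 else 0)"
        unfolding C.rho_dual[OF h] irrep_dim.simps using ne by (intro monomial_mat_cong) auto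
      have "r ?x = r (qd_grp G \<sigma>) * r (qd_dual G ?h)"
        using sigma_closed h by (simp add: C.rho_mult C.grp_in C.dual_in)
      also have "\<dots> = monomial_mat 2 (\<lambda>b. b) (\<lambda>b. if b = 0 then omega n powi int l else 0)"
        unfolding s t by (subst monomial_mat_mult) (auto intro!: monomial_mat_cong)
      finally show ?thesis using t by simp
    qed
    have "\<rho> ?x = omega n powi int j \<cdot>\<^sub>m \<rho> (qd_dual G ?h)"
      using val[of j \<rho>] A.listed_rep_axioms rotation
      by (auto simp: smult_monomial intro!: monomial_mat_cong)
    from transfer[OF qd_mult_closed A.dual_in[OF h] this]
    have "monomial_mat 2 (\<lambda>b. b) (\<lambda>b. if b = 0 then omega n powi int j' else 0)
        = monomial_mat 2 (\<lambda>b. b) (\<lambda>b. omega n powi int j * (if b = 0 then 1 else 0))"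
      unfolding val[OF B.listed_rep_axioms[unfolded rotation(2)], THEN conjunct1]
        val[OF B.listed_rep_axioms[unfolded rotation(2)], THEN conjunct2] smult_monomial .
    then have "omega n powi int j' = omega n powi int j"
      unfolding numeral_2_eq_2 by (drule_tac unit) simp
    then have "j = j'" unfolding omega_powi_eq_iff[OF n_pos] using k dvd_small[of "int j' - int j"] by auto
    then show ?thesis using rotation by simp
  next
    case reflection
    let ?x = "qd_grp G \<tau> \<otimes>\<^bsub>A.D\<^esub> qd_dual G \<tau>"
    have eq0: "\<sigma> [^] int b \<otimes> \<tau> = \<tau> \<longleftrightarrow> b = 0" if "b < n" for b
      using sigma_tau_eq_iff[of "int b" 0] dvd_small[of "int b"] that tau_closed by auto
    have val: "r ?x = monomial_mat n (\<lambda>b. b) (\<lambda>b. if b = 0 then e else 0)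
        \<and> r (qd_dual G \<tau>) = monomial_mat n (\<lambda>b. b) (\<lambda>b. if b = 0 then 1 else 0)"
      if "listed_rep G n \<sigma> \<tau> (Reflection e) r" for e r
    proof -
      interpret C: listed_rep G n \<sigma> \<tau> "Reflection e" r by (rule that)
      have t: "r (qd_dual G \<tau>) = monomial_mat n (\<lambda>b. b) (\<lambda>b. if b = 0 then 1 else 0)"
        unfolding C.rho_dual[OF tau_closed] irrep_dim.simps using eq0 by (intro monomial_mat_cong) auto
      have "r ?x = r (qd_grp G \<tau>) * r (qd_dual G \<tau>)"
        using tau_closed by (simp add: C.rho_mult C.grp_in C.dual_in)
      also have "\<dots> = monomial_mat n (\<lambda>b. (n - b) mod n) (\<lambda>b. if b = 0 then e else 0)"
        unfolding C.rho_tau t irrep_dim.simps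
        by (subst monomial_mat_mult) (auto intro!: monomial_mat_cong)
      also have "\<dots> = monomial_mat n (\<lambda>b. b) (\<lambda>b. if b = 0 then e else 0)"
        by (rule eq_matI) (auto simp: monomial_mat_def)
      finally show ?thesis using t by simp
    qed
    have "\<rho> ?x = \<epsilon> \<cdot>\<^sub>m \<rho> (qd_dual G \<tau>)"
      using val[of \<epsilon> \<rho>] A.listed_rep_axioms reflection
      by (auto simp: smult_monomial intro!: monomial_mat_cong)
    from transfer[OF qd_mult_closed A.dual_in[OF tau_closed] this]
    have "monomial_mat n (\<lambda>b. b) (\<lambda>b. if b = 0 then \<epsilon>' else 0)
        = monomial_mat n (\<lambda>b. b) (\<lambda>b. \<epsilon> * (if b = 0 then 1 else 0))"
      unfolding val[OF B.listed_rep_axioms[unfolded reflection(2)], THEN conjunct1]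
        val[OF B.listed_rep_axioms[unfolded reflection(2)], THEN conjunct2] smult_monomial .
    then have "\<epsilon>' = \<epsilon>" using unit[of "n - 1"] n_pos by (metis (mono_tags, lifting) Suc_pred' mult_1_right)
    then show ?thesis using reflection by simp
  qed
qed

end

subsection \<open>Completeness\<close>

lemma odd_half_cases [consumes 2, case_names zero small large]:
  fixes i n :: nat
  assumes "odd n" "i < n"
  obtains "i = 0" | "0 < i" "2 * i < n" | "0 < n - i" "2 * (n - i) < n"
proof -
  have "2 * i \<noteq> n" using assms(1) by auto
  then consider "i = 0" | "0 < i \<and> 2 * i < n" | "0 < n - i \<and> 2 * (n - i) < n"
    using assms(2) by linarith
  then show thesis using that by cases auto
qed

text \<open>The candidates \<open>u + M u\<close> and \<open>u - M u\<close> add up to \<open>2 u\<close>, so they do not both vanish.\<close>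

lemma sign_eigenvector:
  fixes M :: "complex mat"
  assumes M: "M \<in> carrier_mat d d" and u: "u \<in> carrier_vec d" "u \<noteq> 0\<^sub>v d"
    and inv: "M *\<^sub>v (M *\<^sub>v u) = u"
  obtains \<epsilon> where "\<epsilon> = 1 \<or> \<epsilon> = -1" "u + \<epsilon> \<cdot>\<^sub>v (M *\<^sub>v u) \<noteq> 0\<^sub>v d"
    "M *\<^sub>v (u + \<epsilon> \<cdot>\<^sub>v (M *\<^sub>v u)) = \<epsilon> \<cdot>\<^sub>v (u + \<epsilon> \<cdot>\<^sub>v (M *\<^sub>v u))"
proof -
  let ?w = "\<lambda>\<epsilon>. u + \<epsilon> \<cdot>\<^sub>v (M *\<^sub>v u)"
  have Mu: "M *\<^sub>v u \<in> carrier_vec d" using M u by simp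
  have eig: "M *\<^sub>v ?w \<epsilon> = \<epsilon> \<cdot>\<^sub>v ?w \<epsilon>" if "\<epsilon> = 1 \<or> \<epsilon> = -1" for \<epsilon>
  proof -
    have "M *\<^sub>v ?w \<epsilon> = M *\<^sub>v u + \<epsilon> \<cdot>\<^sub>v u"
      using M u(1) Mu by (simp add: mult_add_distrib_mat_vec[of _ d d] mult_mat_vec[of _ d d] inv)
    also have "\<dots> = \<epsilon> \<cdot>\<^sub>v ?w \<epsilon>"
      using that u(1) M by (intro eq_vecI) auto
    finally show ?thesis .
  qed
  have "?w 1 \<noteq> 0\<^sub>v d \<or> ?w (-1) \<noteq> 0\<^sub>v d"
  proof (rule ccontr)
    assume "\<not> ?thesis"
    then have z: "?w 1 = 0\<^sub>v d" "?w (-1) = 0\<^sub>v d" by simp_all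
    have "u $ i = 0" if i: "i < d" for i
    proof -
      have "?w 1 $ i = 0" "?w (-1) $ i = 0" unfolding z using i by simp_all
      then have "u $ i + (M *\<^sub>v u) $ i = 0" "u $ i - (M *\<^sub>v u) $ i = 0"
        using i u(1) Mu carrier_vecD[OF Mu] by (simp_all del: index_mult_mat_vec)
      then show ?thesis by simp
    qed
    then have "u = 0\<^sub>v d" using u(1) by (intro eq_vecI) auto
    then show False using u(2) by simp
  qed
  then show thesis using that eig by blast
qed

locale irreducible_rep = odd_dihedral +
  fixes d \<rho>
  assumes irr: "qd_irreducible G d \<rho>"
begin

sublocale qd_module G d \<rho>
  by unfold_locales (use irr in \<open>simp_all add: finite_carrier qd_irreducible_def\<close>)

abbreviation "in_list \<equiv> \<exists>L\<in>irrep_labels n. \<exists>\<rho>'. irrep_listed G n \<sigma> \<tau> L \<rho>' \<and>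
  qd_isomorphic G d \<rho> (irrep_dim n L) \<rho>'"

text \<open>An irreducible representation is in the list as soon as it contains vectors that behave like
  the unit vectors of a listed representation: they are the columns of an intertwiner, to which
  Schur's lemma applies.\<close>

lemma in_list_if_vectors:
  assumes L: "L \<in> irrep_labels n"
    and w: "\<And>b. b < irrep_dim n L \<Longrightarrow> w b \<in> graded (label_degree L b)"
    and sig: "\<And>b. b < irrep_dim n L \<Longrightarrow>
      grp \<sigma> *\<^sub>v w b = sigma_coeff n L b \<cdot>\<^sub>v w (sigma_perm n L b)"
    and tau: "\<And>b. b < irrep_dim n L \<Longrightarrow> grp \<tau> *\<^sub>v w b = tau_coeff L b \<cdot>\<^sub>v w (tau_perm n L b)"
    and nz: "w 0 \<noteq> 0\<^sub>v d"
  shows in_list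
proof -
  obtain \<rho>' where \<rho>': "irrep_listed G n \<sigma> \<tau> L \<rho>'" using exists_listed[OF L] by blast
  interpret B: listed_rep G n \<sigma> \<tau> L \<rho>' by unfold_locales (fact L \<rho>')+
  let ?m = "irrep_dim n L"
  let ?F = "mat d ?m (\<lambda>(i, b). w b $ i)"
  have wc: "w b \<in> carrier_vec d" if "b < ?m" for b using w[OF that] gradedD by blast
  have F: "?F \<in> carrier_mat d ?m" by simp
  have "?F \<noteq> 0\<^sub>m d ?m"
  proof
    assume z: "?F = 0\<^sub>m d ?m"
    have m: "0 < ?m" using irrep_dim_pos[OF L] .
    have "w 0 $ i = 0" if "i < d" for i
      using arg_cong[OF z, of "\<lambda>M. M $$ (i, 0)"] that m by simp
    then have "w 0 = 0\<^sub>v d" using wc[OF m] by (intro eq_vecI) auto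
    then show False using nz by simp
  qed
  moreover have "\<rho> x * ?F = ?F * \<rho>' x" if x: "x \<in> carrier D" for x
  proof (rule intertwines_if_generators[OF rep B.rep F _ _ _ x])
    show "grp \<sigma> * ?F = ?F * \<rho>' (qd_grp G \<sigma>)"
      unfolding B.rho_sigma
      by (rule intertwines_monomial) (simp_all add: grp_closed sigma_closed wc perm_less sig)
    show "grp \<tau> * ?F = ?F * \<rho>' (qd_grp G \<tau>)"
      unfolding B.rho_tau
      by (rule intertwines_monomial) (simp_all add: grp_closed tau_closed wc perm_less tau)
    fix h assume h: "h \<in> carrier G"
    show "dual h * ?F = ?F * \<rho>' (qd_dual G h)"
      unfolding B.rho_dual[OF h]
    proof (rule intertwines_monomial)
      show "dual h \<in> carrier_mat d d" using h by (rule dual_closed)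
      fix b assume b: "b < ?m"
      show "w b \<in> carrier_vec d" "b < ?m" by (fact wc[OF b] b)+
      show "dual h *\<^sub>v w b = (if label_degree L b = h then 1 else 0) \<cdot>\<^sub>v w b"
        using dual_graded[OF h label_degree_closed w[OF b]] wc[OF b] by auto
    qed
  qed
  ultimately have "qd_isomorphic G d \<rho> ?m \<rho>'"
    using isomorphic_if_nonzero_intertwiner[OF finite_carrier irr B.irreducible F] by blast
  then show ?thesis using L \<rho>' by blast
qed

lemma sigma_sigma_vec:
  "v \<in> carrier_vec d \<Longrightarrow>
   grp (\<sigma> [^] (a :: int)) *\<^sub>v (grp (\<sigma> [^] (b :: int)) *\<^sub>v v) = grp (\<sigma> [^] (a + b)) *\<^sub>v v"
  using sigma_closed by (simp add: grp_mult_vec sigma_mult)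

lemma tau_tau_vec: "v \<in> carrier_vec d \<Longrightarrow> grp \<tau> *\<^sub>v (grp \<tau> *\<^sub>v v) = v"
  using tau_closed by (simp add: grp_mult_vec pair.t_t grp_one)

lemma tau_sigma_vec:
  assumes v: "v \<in> carrier_vec d"
  shows "grp \<tau> *\<^sub>v (grp (\<sigma> [^] (a :: int)) *\<^sub>v v) = grp (\<sigma> [^] (- a)) *\<^sub>v (grp \<tau> *\<^sub>v v)"
  using v sigma_closed tau_closed by (simp add: grp_mult_vec tau_sigma_int)

text \<open>Since \<open>n\<close> is odd, the degree may be conjugated to \<open>\<tau>\<close>. An eigenvector \<open>w\<close> of \<open>\<tau>\<close> in this
  component generates the representation: \<open>\<sigma>\<^sup>m w\<close> has degree \<open>\<sigma>\<^sup>2\<^sup>m \<tau>\<close>, so \<open>w\<close> multiplied by the power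
  of \<open>\<sigma>\<close> whose exponent is half of \<open>b\<close> modulo \<open>n\<close> plays the role of the \<open>b\<close>-th unit vector.\<close>

lemma in_list_if_reflection:
  assumes v: "v \<in> graded (\<sigma> [^] (i :: int) \<otimes> \<tau>)" "v \<noteq> 0\<^sub>v d"
  shows in_list
proof -
  have sc: "\<sigma> [^] (a :: int) \<in> carrier G" for a using sigma_closed by simp
  \<comment> \<open>chosen so that \<open>i + 2 a\<close> is a multiple of \<open>n\<close>\<close>
  define a where "a = i * ((int n - 1) div 2)"
  \<comment> \<open>the inverse of 2 modulo \<open>n\<close>\<close>
  define h where "h = (int n + 1) div 2"
  have two_a: "i + 2 * a = i * int n"
  proof -
    have "2 * ((int n - 1) div 2) = int n - 1" using odd_n by simp
    moreover have "2 * a = i * (2 * ((int n - 1) div 2))" unfolding a_def by (rule mult.left_commute)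
    ultimately have "i + 2 * a = i + i * (int n - 1)" by (simp only:)
    then show ?thesis by (simp add: algebra_simps)
  qed
  have two_h: "2 * h = int n + 1" using odd_n by (auto simp: h_def elim!: oddE)
  have t: "\<sigma> [^] (0 :: int) \<otimes> \<tau> = \<tau>" using tau_closed by simp
  define u where "u = grp (\<sigma> [^] a) *\<^sub>v v"
  have "u \<in> graded (\<sigma> [^] (i + 2 * a) \<otimes> \<tau>)"
    using grp_graded[OF sc[of a] _ v(1)] sc[of i] tau_closed unfolding u_def conj_sigma(2) by simp
  moreover have "\<sigma> [^] (i + 2 * a) \<otimes> \<tau> = \<tau>"
    using sigma_tau_eq_iff[of "i + 2 * a" 0] unfolding t two_a by simp
  ultimately have u: "u \<in> graded \<tau>" by simp
  note uc = gradedD(1)[OF u]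
  have unz: "u \<noteq> 0\<^sub>v d" unfolding u_def by (rule grp_vec_nonzero[OF sc gradedD(1)[OF v(1)] v(2)])
  obtain \<epsilon> where \<epsilon>: "\<epsilon> = 1 \<or> \<epsilon> = -1" "u + \<epsilon> \<cdot>\<^sub>v (grp \<tau> *\<^sub>v u) \<noteq> 0\<^sub>v d"
    "grp \<tau> *\<^sub>v (u + \<epsilon> \<cdot>\<^sub>v (grp \<tau> *\<^sub>v u)) = \<epsilon> \<cdot>\<^sub>v (u + \<epsilon> \<cdot>\<^sub>v (grp \<tau> *\<^sub>v u))"
    using sign_eigenvector[OF grp_closed[OF tau_closed] uc unz tau_tau_vec[OF uc]] by blast
  define w where "w = u + \<epsilon> \<cdot>\<^sub>v (grp \<tau> *\<^sub>v u)"
  have "grp \<tau> *\<^sub>v u \<in> graded \<tau>"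
    using grp_graded[OF tau_closed tau_closed u] tau_closed by (simp add: inv_tau m_assoc pair.t_t)
  then have w: "w \<in> graded \<tau>"
    unfolding w_def by (intro graded_add graded_smult tau_closed u)
  note wc = gradedD(1)[OF w]
  have tw: "grp \<tau> *\<^sub>v w = \<epsilon> \<cdot>\<^sub>v w" using \<epsilon>(3) by (simp only: w_def)
  define f where "f b = grp (\<sigma> [^] (int b * h)) *\<^sub>v w" for b
  show ?thesis
  proof (rule in_list_if_vectors)
    let ?L = "Reflection \<epsilon>"
    show "?L \<in> irrep_labels n" using \<epsilon>(1) by (simp add: labels_iff)
    show "f 0 \<noteq> 0\<^sub>v d" using \<epsilon>(2) wc by (simp add: f_def w_def grp_one)
    fix b assume "b < irrep_dim n ?L"
    then have b: "b < n" by simp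
    have "f b \<in> graded (\<sigma> [^] (0 + 2 * (int b * h)) \<otimes> \<tau>)"
      using grp_graded[OF sc[of "int b * h"] tau_closed w] unfolding f_def
      using conj_sigma(2)[of "int b * h" 0] unfolding t by simp
    moreover have "\<sigma> [^] (0 + 2 * (int b * h)) \<otimes> \<tau> = \<sigma> [^] int b \<otimes> \<tau>"
    proof -
      have "0 + 2 * (int b * h) - int b = int b * (2 * h) - int b" by simp
      then show ?thesis unfolding sigma_tau_eq_iff two_h by (simp add: algebra_simps)
    qed
    ultimately show "f b \<in> graded (label_degree ?L b)" by simp
    have "grp \<sigma> *\<^sub>v f b = grp (\<sigma> [^] (1 + int b * h)) *\<^sub>v w"
      unfolding f_def using sigma_sigma_vec[OF wc, of 1] by (simp only: sigma_int_1)
    also have "\<sigma> [^] (1 + int b * h) = \<sigma> [^] (int ((b + 2) mod n) * h)"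
      unfolding sigma_eq_iff
    proof -
      define q where "q = (int b + 2) div int n"
      have q: "int ((b + 2) mod n) = int b + 2 - int n * q"
        unfolding q_def by (simp add: of_nat_mod minus_mult_div_eq_mod add.commute)
      have "1 + int b * h - int ((b + 2) mod n) * h = 1 - 2 * h + int n * (q * h)"
        unfolding q by (simp add: algebra_simps)
      also have "\<dots> = int n * (q * h - 1)" unfolding two_h by (simp add: algebra_simps)
      finally show "int n dvd 1 + int b * h - int ((b + 2) mod n) * h" by simp
    qed
    finally show "grp \<sigma> *\<^sub>v f b = sigma_coeff n ?L b \<cdot>\<^sub>v f (sigma_perm n ?L b)"
      by (simp add: f_def)
    have "grp \<tau> *\<^sub>v f b = grp (\<sigma> [^] (- (int b * h))) *\<^sub>v (\<epsilon> \<cdot>\<^sub>v w)"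
      unfolding f_def tau_sigma_vec[OF wc] tw ..
    also have "\<dots> = \<epsilon> \<cdot>\<^sub>v (grp (\<sigma> [^] (- (int b * h))) *\<^sub>v w)"
      by (rule mult_mat_vec[OF grp_closed[OF sc] wc])
    also have "\<sigma> [^] (- (int b * h)) = \<sigma> [^] (int ((n - b) mod n) * h)"
      unfolding sigma_eq_iff
    proof -
      have "n dvd (n - b) mod n + b" using b neg_mod_iff[of "(n - b) mod n" n b] by simp
      then have "int n dvd int ((n - b) mod n) + int b" by (metis of_nat_add of_nat_dvd_iff)
      then have "int n dvd - ((int ((n - b) mod n) + int b) * h)" by simp
      then show "int n dvd - (int b * h) - int ((n - b) mod n) * h" by (simp add: algebra_simps)
    qed
    finally show "grp \<tau> *\<^sub>v f b = tau_coeff ?L b \<cdot>\<^sub>v f (tau_perm n ?L b)"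
      by (simp add: f_def)
  qed
qed

text \<open>Powers of \<open>\<sigma>\<close> commute with \<open>\<sigma>\<^sup>i\<close>, so they preserve the component of this degree, and the Fourier
  transform of an orbit remains in it.\<close>

lemma sigma_eigenvector:
  assumes v: "v \<in> graded (\<sigma> [^] (i :: int))" "v \<noteq> 0\<^sub>v d"
  obtains j w where "j < n" "w \<in> graded (\<sigma> [^] i)" "w \<noteq> 0\<^sub>v d"
    "grp \<sigma> *\<^sub>v w = omega n powi int j \<cdot>\<^sub>v w"
proof -
  have sc: "\<sigma> [^] (a :: int) \<in> carrier G" for a using sigma_closed by simp
  note vc = gradedD(1)[OF v(1)]
  define f where "f m = grp (\<sigma> [^] int m) *\<^sub>v v" for m
  have fg: "f m \<in> graded (\<sigma> [^] i)" for m
    using grp_graded[OF sc sc v(1), of "int m"] unfolding f_def conj_sigma(1) .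
  have step: "grp \<sigma> *\<^sub>v f m = f (Suc m)" for m
    using sigma_sigma_vec[OF vc, of 1 "int m"] unfolding sigma_int_1 f_def by simp
  have period: "f n = f 0"
    using sigma_eq_iff[of "int n" 0] by (simp add: f_def)
  have f0: "f 0 = v" using vc by (simp add: f_def grp_one)
  obtain j c where j: "j < n" and nz: "vec d (\<lambda>i. \<Sum>m<n. c m * f m $ i) \<noteq> 0\<^sub>v d"
    and eig: "grp \<sigma> *\<^sub>v vec d (\<lambda>i. \<Sum>m<n. c m * f m $ i)
      = omega n powi int j \<cdot>\<^sub>v vec d (\<lambda>i. \<Sum>m<n. c m * f m $ i)"
    by (rule fourier_eigenvector[OF n_pos grp_closed[OF sigma_closed] _ step period])
       (use f0 v(2) gradedD(1)[OF fg] in auto)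
  have "vec d (\<lambda>i. \<Sum>m<n. c m * f m $ i) \<in> graded (\<sigma> [^] i)"
  proof -
    have "dual (\<sigma> [^] i) *\<^sub>v vec d (\<lambda>i. \<Sum>m<n. c m * f m $ i)
        = vec d (\<lambda>l. \<Sum>m<n. c m * (dual (\<sigma> [^] i) *\<^sub>v f m) $ l)"
      by (rule mat_mult_vec_comb) (simp_all add: dual_closed sc gradedD(1)[OF fg])
    then show ?thesis by (simp add: graded_def gradedD(2)[OF fg])
  qed
  then show thesis using that j nz eig by blast
qed

lemma tau_sigma_eigenvector:
  assumes w: "w \<in> carrier_vec d" and eig: "grp \<sigma> *\<^sub>v w = omega n powi j \<cdot>\<^sub>v w"
  shows "grp \<sigma> *\<^sub>v (grp \<tau> *\<^sub>v w) = omega n powi (- j) \<cdot>\<^sub>v (grp \<tau> *\<^sub>v w)"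
proof -
  let ?z = "omega n powi j" and ?S = "grp (\<sigma> [^] (- 1 :: int))"
  have S: "?S \<in> carrier_mat d d" using sigma_closed by (simp add: grp_closed del: int_pow_neg)
  have "w = ?S *\<^sub>v (grp \<sigma> *\<^sub>v w)"
    using sigma_sigma_vec[OF w, of "- 1" 1] w by (simp only: sigma_int_1) (simp add: grp_one)
  also have "\<dots> = ?z \<cdot>\<^sub>v (?S *\<^sub>v w)" unfolding eig by (rule mult_mat_vec[OF S w])
  finally have "inverse ?z \<cdot>\<^sub>v w = inverse ?z \<cdot>\<^sub>v (?z \<cdot>\<^sub>v (?S *\<^sub>v w))" by simp
  also have "\<dots> = ?S *\<^sub>v w" using omega_nonzero[of n] by (simp add: smult_smult_assoc)
  finally have inv: "?S *\<^sub>v w = omega n powi (- j) \<cdot>\<^sub>v w" by (simp add: power_int_minus)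
  have "grp \<sigma> *\<^sub>v (grp \<tau> *\<^sub>v w) = grp \<tau> *\<^sub>v (?S *\<^sub>v w)"
    using tau_sigma_vec[OF w, of "- 1"] by (simp only: minus_minus sigma_int_1)
  also have "\<dots> = omega n powi (- j) \<cdot>\<^sub>v (grp \<tau> *\<^sub>v w)"
    unfolding inv by (rule mult_mat_vec[OF grp_closed[OF tau_closed] w])
  finally show ?thesis .
qed

text \<open>Since \<open>\<tau>\<close> inverts \<open>\<sigma>\<close>, the eigenvalues of \<open>\<sigma>\<close> on \<open>w\<close> and \<open>\<tau> w\<close> are inverse to each other and
  their degrees are exchanged by \<open>\<tau>\<close>, just as for the two unit vectors of a listed representation.\<close>

lemma in_list_if_two_dim:
  assumes L: "L \<in> irrep_labels n" and dim: "irrep_dim n L = 2"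
    and w: "w \<in> graded (label_degree L 0)" "w \<noteq> 0\<^sub>v d"
    and eig: "grp \<sigma> *\<^sub>v w = sigma_coeff n L 0 \<cdot>\<^sub>v w"
    and data: "(\<exists>k. L = Planar k) \<or> (\<exists>j k. L = Rotation j k)"
  shows in_list
proof -
  define f where "f b = (if b = 0 then w else grp \<tau> *\<^sub>v w)" for b :: nat
  show ?thesis
  proof (rule in_list_if_vectors[OF L])
  note wc = gradedD(1)[OF w(1)]
  show "f 0 \<noteq> 0\<^sub>v d" using w(2) by (simp add: f_def)
  fix b assume "b < irrep_dim n L"
  then have b: "b = 0 \<or> b = 1" using dim by auto
  obtain j where j: "\<And>b. sigma_coeff n L b = omega n powi (if b = 0 then j else - j)"
  proof -
    from data consider k where "L = Planar k" | j k where "L = Rotation j k" by blast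
    then show thesis
    proof cases
      case (1 k)
      show thesis by (rule that[of "int k"]) (simp only: 1 sigma_coeff.simps)
    next
      case (2 j k)
      show thesis by (rule that[of "int j"]) (simp only: 2 sigma_coeff.simps)
    qed
  qed
  have perm: "sigma_perm n L b = b" "tau_perm n L b = 1 - b" "tau_coeff L b = 1" using data by auto
  have "label_degree L 1 = \<tau> \<otimes> label_degree L 0 \<otimes> inv \<tau>"
    using label_degree_conj(2)[of 0 L] dim data by auto
  then have "grp \<tau> *\<^sub>v w \<in> graded (label_degree L 1)"
    using grp_graded[OF tau_closed label_degree_closed w(1)] by simp
  then show "f b \<in> graded (label_degree L b)" using b w(1) by (auto simp: f_def)
  show "grp \<sigma> *\<^sub>v f b = sigma_coeff n L b \<cdot>\<^sub>v f (sigma_perm n L b)"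
    using b eig tau_sigma_eigenvector[OF wc, of j] unfolding perm j by (auto simp: f_def)
  show "grp \<tau> *\<^sub>v f b = tau_coeff L b \<cdot>\<^sub>v f (tau_perm n L b)"
    using b tau_tau_vec[OF wc] unfolding perm by (auto simp: f_def)
  qed
qed

lemma in_list_if_rotation:
  assumes v: "v \<in> graded (\<sigma> [^] int i)" "v \<noteq> 0\<^sub>v d" and i: "0 < i" "2 * i < n"
  shows in_list
proof -
  obtain j w where j: "j < n" and w: "w \<in> graded (\<sigma> [^] int i)" "w \<noteq> 0\<^sub>v d"
    and eig: "grp \<sigma> *\<^sub>v w = omega n powi int j \<cdot>\<^sub>v w"
    using sigma_eigenvector[OF v] by blast
  show ?thesis
    by (rule in_list_if_two_dim[of "Rotation j i", OF _ _ _ w(2)]) (use i j w eig in \<open>simp_all add: labels_iff\<close>)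
qed

text \<open>The component of degree \<open>1\<close> is stable under the whole group. Let \<open>w\<close> be an eigenvector of \<open>\<sigma>\<close> in
  it, with eigenvalue \<open>\<omega>\<^sup>j\<close>. For \<open>j = 0\<close> a combination of \<open>w\<close> and \<open>\<tau> w\<close> spans a character; otherwise
  \<open>w\<close> and \<open>\<tau> w\<close>, whose eigenvalue is \<open>\<omega>\<^sup>-\<^sup>j\<close>, give a planar representation, and they are exchanged
  if \<open>j > n / 2\<close>.\<close>

lemma in_list_if_trivial_degree:
  assumes v: "v \<in> graded \<one>" "v \<noteq> 0\<^sub>v d"
  shows in_list
proof -
  have "v \<in> graded (\<sigma> [^] (0 :: int))" using v(1) by simp
  then obtain j w where j: "j < n" and w: "w \<in> graded \<one>" "w \<noteq> 0\<^sub>v d"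
    and eig: "grp \<sigma> *\<^sub>v w = omega n powi int j \<cdot>\<^sub>v w"
    using sigma_eigenvector[of v 0] v(2) by (metis int_pow_0)
  note wc = gradedD(1)[OF w(1)]
  have tw: "grp \<tau> *\<^sub>v w \<in> graded \<one>"
    using grp_graded[OF tau_closed one_closed w(1)] tau_closed by simp
  note teig = tau_sigma_eigenvector[OF wc eig]
  from odd_n j show ?thesis
  proof (cases rule: odd_half_cases)
    case zero
    obtain \<epsilon> where \<epsilon>: "\<epsilon> = 1 \<or> \<epsilon> = -1" "w + \<epsilon> \<cdot>\<^sub>v (grp \<tau> *\<^sub>v w) \<noteq> 0\<^sub>v d"
      "grp \<tau> *\<^sub>v (w + \<epsilon> \<cdot>\<^sub>v (grp \<tau> *\<^sub>v w)) = \<epsilon> \<cdot>\<^sub>v (w + \<epsilon> \<cdot>\<^sub>v (grp \<tau> *\<^sub>v w))"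
      using sign_eigenvector[OF grp_closed[OF tau_closed] wc w(2) tau_tau_vec[OF wc]] by blast
    have S: "grp \<sigma> \<in> carrier_mat d d" by (rule grp_closed[OF sigma_closed])
    have fixed: "grp \<sigma> *\<^sub>v w = w" "grp \<sigma> *\<^sub>v (grp \<tau> *\<^sub>v w) = grp \<tau> *\<^sub>v w"
      using eig teig zero by simp_all
    show ?thesis
    proof (rule in_list_if_vectors[of "Char \<epsilon>" "\<lambda>_. w + \<epsilon> \<cdot>\<^sub>v (grp \<tau> *\<^sub>v w)"])
      show "Char \<epsilon> \<in> irrep_labels n" using \<epsilon>(1) by (simp add: labels_iff)
      fix b
      show "w + \<epsilon> \<cdot>\<^sub>v (grp \<tau> *\<^sub>v w) \<in> graded (label_degree (Char \<epsilon>) b)"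
        using graded_add[OF one_closed w(1) graded_smult[OF one_closed tw]] by simp
      show "grp \<sigma> *\<^sub>v (w + \<epsilon> \<cdot>\<^sub>v (grp \<tau> *\<^sub>v w))
          = sigma_coeff n (Char \<epsilon>) b \<cdot>\<^sub>v (w + \<epsilon> \<cdot>\<^sub>v (grp \<tau> *\<^sub>v w))"
        using S wc gradedD(1)[OF tw]
        by (simp add: mult_add_distrib_mat_vec[of _ d d] mult_mat_vec[of _ d d] fixed)
      show "grp \<tau> *\<^sub>v (w + \<epsilon> \<cdot>\<^sub>v (grp \<tau> *\<^sub>v w))
          = tau_coeff (Char \<epsilon>) b \<cdot>\<^sub>v (w + \<epsilon> \<cdot>\<^sub>v (grp \<tau> *\<^sub>v w))"
        using \<epsilon>(3) by simp
    qed (fact \<epsilon>(2))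
  next
    case small
    show ?thesis
      by (rule in_list_if_two_dim[of "Planar j", OF _ _ _ w(2)]) (use small w eig in \<open>simp_all add: labels_iff\<close>)
  next
    case large
    have "omega n powi (- int j) = omega n powi int (n - j)"
      unfolding omega_powi_eq_iff[OF n_pos] using j by (simp add: of_nat_diff)
    then have "grp \<sigma> *\<^sub>v (grp \<tau> *\<^sub>v w) = sigma_coeff n (Planar (n - j)) 0 \<cdot>\<^sub>v (grp \<tau> *\<^sub>v w)"
      using teig by simp
    then show ?thesis
      by (intro in_list_if_two_dim[of "Planar (n - j)", OF _ _ _ grp_vec_nonzero[OF tau_closed wc w(2)]])
         (use large tw in \<open>simp_all add: labels_iff\<close>)
  qed
qed

lemma irreducible_in_list: in_list
proof -
  have "d > 0" using irr by (simp add: qd_irreducible_def)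
  then obtain h v where h: "h \<in> carrier G" and v: "v \<in> graded h" "v \<noteq> 0\<^sub>v d"
    by (rule exists_graded)
  show ?thesis using h
  proof (cases h rule: carrier_cases)
    case (1 i)
    from odd_n 1(1) show ?thesis
    proof (cases rule: odd_half_cases)
      case zero
      then show ?thesis using in_list_if_trivial_degree v \<open>h = _\<close> by simp
    next
      case small
      then show ?thesis using in_list_if_rotation v \<open>h = _\<close> by simp
    next
      case large
      have "\<sigma> [^] (- int i) = \<sigma> [^] int (n - i)"
        unfolding sigma_eq_iff using \<open>i < n\<close> by (simp add: of_nat_diff)
      then have "grp \<tau> *\<^sub>v v \<in> graded (\<sigma> [^] int (n - i))"
        using grp_graded[OF tau_closed h v(1)] \<open>h = _\<close> conj_tau(1)[of "int i"] by simp
      then show ?thesis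
        using in_list_if_rotation grp_vec_nonzero[OF tau_closed gradedD(1)[OF v(1)] v(2)] large by blast
    qed
  next
    case (2 i)
    then show ?thesis using in_list_if_reflection v by simp
  qed
qed

end

section \<open>The classification\<close>

lemma mset_dims_const:
  assumes "\<And>x. x \<in> S \<Longrightarrow> f x = c"
  shows "image_mset f (mset_set S) = replicate_mset (card S) c"
proof (cases "finite S")
  case True
  then have "image_mset f (mset_set S) = image_mset (\<lambda>_. c) (mset_set S)"
    using assms by (intro image_mset_cong) simp
  then show ?thesis by (simp add: image_mset_const_eq)
qed simp

lemma dimension_count:
  assumes n: "odd n"
  shows "image_mset (irrep_dim n) (mset_set (irrep_labels n)) =
    {#1, 1, n, n#} + replicate_mset ((n\<^sup>2 - 1) div 2) 2"
proof -
  let ?K = "{1..(n - 1) div 2}"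
  let ?A = "Char ` {1, -1}" and ?B = "Planar ` ?K"
    and ?C = "(\<lambda>(j, k). Rotation j k) ` ({..<n} \<times> ?K)" and ?D = "Reflection ` {1, -1}"
  have labels: "irrep_labels n = ((?A \<union> ?B) \<union> ?C) \<union> ?D"
    unfolding irrep_labels_def by (auto simp: image_iff)
  have card: "card ?A = 2" "card ?B = (n - 1) div 2" "card ?C = n * ((n - 1) div 2)" "card ?D = 2"
    by (subst card_image; auto simp: inj_on_def card_cartesian_product)+
  have dims: "image_mset (irrep_dim n) (mset_set ?A) = replicate_mset (card ?A) 1"
    "image_mset (irrep_dim n) (mset_set ?B) = replicate_mset (card ?B) 2"
    "image_mset (irrep_dim n) (mset_set ?C) = replicate_mset (card ?C) 2"
    "image_mset (irrep_dim n) (mset_set ?D) = replicate_mset (card ?D) n"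
    by (rule mset_dims_const; auto)+
  have union: "image_mset (irrep_dim n) (mset_set (X \<union> Y))
      = image_mset (irrep_dim n) (mset_set X) + image_mset (irrep_dim n) (mset_set Y)"
    if "finite X" "finite Y" "X \<inter> Y = {}" for X Y
    using that by (simp add: mset_set_Union)
  have unions: "image_mset (irrep_dim n) (mset_set (((?A \<union> ?B) \<union> ?C) \<union> ?D))
      = image_mset (irrep_dim n) (mset_set ((?A \<union> ?B) \<union> ?C)) + image_mset (irrep_dim n) (mset_set ?D)"
    "image_mset (irrep_dim n) (mset_set ((?A \<union> ?B) \<union> ?C))
      = image_mset (irrep_dim n) (mset_set (?A \<union> ?B)) + image_mset (irrep_dim n) (mset_set ?C)"
    "image_mset (irrep_dim n) (mset_set (?A \<union> ?B))
      = image_mset (irrep_dim n) (mset_set ?A) + image_mset (irrep_dim n) (mset_set ?B)"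
    by (rule union; auto)+
  have "image_mset (irrep_dim n) (mset_set (irrep_labels n))
      = image_mset (irrep_dim n) (mset_set ?A) + image_mset (irrep_dim n) (mset_set ?B)
        + image_mset (irrep_dim n) (mset_set ?C) + image_mset (irrep_dim n) (mset_set ?D)"
    unfolding labels unions ..
  also have "\<dots> = replicate_mset 2 1 + replicate_mset ((n - 1) div 2) 2
      + replicate_mset (n * ((n - 1) div 2)) 2 + replicate_mset 2 n"
    unfolding dims card ..
  also have "\<dots> = {#1, 1, n, n#} + replicate_mset ((n - 1) div 2 + n * ((n - 1) div 2)) 2"
    by (rule multiset_eqI) (simp add: numeral_2_eq_2)
  also have "(n - 1) div 2 + n * ((n - 1) div 2) = (n\<^sup>2 - 1) div 2"
  proof -
    obtain m where m: "n = 2 * m + 1" using n by (rule oddE)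
    have "n\<^sup>2 - 1 = 2 * (m + n * m)" unfolding m by (simp add: power2_eq_square algebra_simps)
    then show ?thesis using m by simp
  qed
  finally show ?thesis .
qed

theorem mainTheorem2:
  fixes G :: "('a, 'm) monoid_scheme" and n :: nat and \<sigma> \<tau> :: 'a
  assumes "odd n" and "dihedral G n \<sigma> \<tau>"
  shows
    "(\<forall>L\<in>irrep_labels n. \<exists>\<rho>. irrep_listed G n \<sigma> \<tau> L \<rho>) \<and>
     (\<forall>L\<in>irrep_labels n. \<forall>\<rho> \<rho>'. irrep_listed G n \<sigma> \<tau> L \<rho> \<and> irrep_listed G n \<sigma> \<tau> L \<rho>' \<longrightarrow>
        (\<forall>x\<in>carrier (quantum_double G). \<rho> x = \<rho>' x)) \<and>
     (\<forall>L\<in>irrep_labels n. \<forall>\<rho>. irrep_listed G n \<sigma> \<tau> L \<rho> \<longrightarrow> qd_irreducible G (irrep_dim n L) \<rho>) \<and>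
     (\<forall>L\<in>irrep_labels n. \<forall>L'\<in>irrep_labels n. \<forall>\<rho> \<rho>'.
        irrep_listed G n \<sigma> \<tau> L \<rho> \<and> irrep_listed G n \<sigma> \<tau> L' \<rho>' \<and>
        qd_isomorphic G (irrep_dim n L) \<rho> (irrep_dim n L') \<rho>' \<longrightarrow> L = L') \<and>
     (\<forall>d \<rho>. qd_irreducible G d \<rho> \<longrightarrow>
        (\<exists>L\<in>irrep_labels n. \<exists>\<rho>'. irrep_listed G n \<sigma> \<tau> L \<rho>' \<and>
           qd_isomorphic G d \<rho> (irrep_dim n L) \<rho>')) \<and>
     image_mset (irrep_dim n) (mset_set (irrep_labels n)) =
        {#1, 1, n, n#} + replicate_mset ((n\<^sup>2 - 1) div 2) 2"
proof -
  interpret odd_dihedral G n \<sigma> \<tau>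
    using assms by (simp add: odd_dihedral_def odd_dihedral_axioms_def)
  show ?thesis
  proof (intro conjI ballI allI impI)
    fix L assume L: "L \<in> irrep_labels n"
    show "\<exists>\<rho>. irrep_listed G n \<sigma> \<tau> L \<rho>" using L by (rule exists_listed)
    show "\<rho> x = \<rho>' x"
      if "irrep_listed G n \<sigma> \<tau> L \<rho> \<and> irrep_listed G n \<sigma> \<tau> L \<rho>'" "x \<in> carrier (quantum_double G)"
      for \<rho> \<rho>' x
      using that listed_unique[OF L] by blast
    show "qd_irreducible G (irrep_dim n L) \<rho>" if "irrep_listed G n \<sigma> \<tau> L \<rho>" for \<rho>
      by (rule listed_rep.irreducible) (unfold_locales, fact L, fact that)
    show "L = L'"
      if "L' \<in> irrep_labels n" "irrep_listed G n \<sigma> \<tau> L \<rho> \<and> irrep_listed G n \<sigma> \<tau> L' \<rho>' \<and>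
        qd_isomorphic G (irrep_dim n L) \<rho> (irrep_dim n L') \<rho>'" for L' \<rho> \<rho>'
      using that label_eq_if_isomorphic[OF L] by blast
  next
    fix d \<rho> assume "qd_irreducible G d \<rho>"
    then show "\<exists>L\<in>irrep_labels n. \<exists>\<rho>'. irrep_listed G n \<sigma> \<tau> L \<rho>' \<and>
        qd_isomorphic G d \<rho> (irrep_dim n L) \<rho>'"
      by (intro irreducible_rep.irreducible_in_list) unfold_locales
  qed (rule dimension_count[OF assms(1)])
qed

end
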